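(* Let $X$ be a real Banach space, let $(x_n)$ be a sequence in $X$ which does not converge in norm, and let $E\subseteq X^*$ be an isomorphically precisely norming set for $X$ such that \[ \sum_n | x^*(x_{n+1}-x_n)| < \infty \quad \text{for all } x^* \in E. \] Then there exists a subsequence of $(x_n)$ whose closed linear span is an isomorphically polyhedral Banach space. Conversely, if $Y$ is a separable isomorphically polyhedral Banach space, then there exist a sequence $(x_n)$ in $Y$ which does not converge in norm and an isomorphically precisely norming set $E\subseteq Y^*$ for $Y$ such that the closed linear span of $(x_n)$ equals $Y$ and $\sum_n | x^*(x_{n+1}-x_n)| < \infty$ for all $x^* \in E$.
   Context: A set $E \subseteq X^*$ is called isomorphically precisely norming for a Banach space $(X,\|\cdot\|)$ if there exists $C \ge 1$ such that (a) $E \subseteq C\cdot Ba(X^* )$ (where $Ba(X^* )$ is the closed unit ball of $X^*$); (b) $\frac{1}{C}\|x\| \le \sup_{e\in E}|e(x)|$ for all $x \in X$; and (c) for every $x\in X$ there is $e_0 \in E$ with $|e_0(x)| = \sup_{e\in E}|e(x)|$. An infinite dimensional Banach space is polyhedral if the closed unit ball of each of its finite dimensional subspaces has finitely many extreme points. A Banach space is isomorphically polyhedral if it is polyhedral under some equivalent norm. *)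

theory Defs
  imports "HOL-Analysis.Analysis"
begin

definition dual_ball :: "real \<Rightarrow> ('a::real_normed_vector \<Rightarrow> real) set" where
  "dual_ball C = {f. bounded_linear f \<and> onorm f \<le> C}"

definition iso_precisely_norming :: "('a::real_normed_vector \<Rightarrow> real) set \<Rightarrow> bool" where
  "iso_precisely_norming E \<longleftrightarrow>
     (\<exists>C\<ge>1. E \<subseteq> dual_ball C
        \<and> (\<forall>x. norm x / C \<le> (SUP e\<in>E. \<bar>e x\<bar>))
        \<and> (\<forall>x. \<exists>e0\<in>E. \<bar>e0 x\<bar> = (SUP e\<in>E. \<bar>e x\<bar>)))"

definition norm_on :: "'a::real_vector set \<Rightarrow> ('a \<Rightarrow> real) \<Rightarrow> bool" where
  "norm_on Z N \<longleftrightarrow>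
     (\<forall>x\<in>Z. 0 \<le> N x \<and> (N x = 0 \<longleftrightarrow> x = 0))
     \<and> (\<forall>x\<in>Z. \<forall>y\<in>Z. N (x + y) \<le> N x + N y)
     \<and> (\<forall>a. \<forall>x\<in>Z. N (a *\<^sub>R x) = \<bar>a\<bar> * N x)"

definition infinite_dimensional :: "'a::real_vector set \<Rightarrow> bool" where
  "infinite_dimensional Z \<longleftrightarrow> \<not> (\<exists>B. finite B \<and> Z \<subseteq> span B)"

definition polyhedral_wrt :: "'a::real_vector set \<Rightarrow> ('a \<Rightarrow> real) \<Rightarrow> bool" where
  "polyhedral_wrt Z N \<longleftrightarrow>
     infinite_dimensional Z \<and>
     (\<forall>F. subspace F \<and> F \<subseteq> Z \<and> (\<exists>B. finite B \<and> F = span B) \<longrightarrow>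
        finite {p. p extreme_point_of {z\<in>F. N z \<le> 1}})"

definition iso_polyhedral :: "'a::real_normed_vector set \<Rightarrow> bool" where
  "iso_polyhedral Z \<longleftrightarrow>
     (\<exists>N. norm_on Z N \<and> (\<exists>c>0. \<exists>C>0. \<forall>z\<in>Z. c * norm z \<le> N z \<and> N z \<le> C * norm z)
          \<and> polyhedral_wrt Z N)"

end

theory Submission imports Defs "HOL-Complex_Analysis.Great_Picard"
begin

text \<open>
  \<^emph>\<open>Extracting a polyhedral span.\<close> Replace the norm by the equivalent supremum norm over E. Some subsequence
  spans a space with a sequence y of bounded null coordinates on which every functional of E is
  absolutely summable: if the sequence is unbounded, take normalised terms; if its E-limit is an
  element of the space, an argument of Simons gives convex blocks converging in norm, hence a subsequence
  whose differences from the limit are summable on E; otherwise the E-limit is at positive distance from the space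
  and one takes successive differences. In each case Mazur's selection bounds the coordinates.
  The functionals with l1-mass at most n, rounded to a fine grid and truncated where the tail is
  small, are multiplied by weights exceeding 1 that tend to 1 with n and, for fixed n, strictly decrease
  with the mass. In the resulting norm the late functionals lose to those attaining the old norm, while among
  the early ones truncation always wins on a finite-dimensional subspace, whose late coordinates are
  uniformly small. So finitely many functionals determine the norm there.

  \<^emph>\<open>The converse.\<close> By Baire category, a separable polyhedral norm coincides with a linear
  functional near each point of a dense open set, and these functionals form a countable
  boundary (Fonf). Alternate unit vectors annihilated by more and more of them with small multiples of a dense sequence.
\<close>

section \<open>Equivalent norms\<close>

text \<open>The obstacle is that \<open>E\<close> carries no compactness: it may be uncountable and
  coordinatewise limits may leave it, while polyhedrality asks that finitely many functionals decide
  the ball of each finite-dimensional subspace. Once the coordinates are null, the functionals of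
  \<open>E\<close> act as l1 sequences, and balls of l1 are closed under coordinatewise limits.
  Rounding then turns coordinatewise convergence into eventual equality in each coordinate. Only the
  tail remains free, and the dependence of the weight on the mass pays for cutting it off.
  Attainment enters twice: a functional attaining the old norm has finite mass, so the new norm is
  strictly larger than the old one at every nonzero point; and Simons' argument needs a functional
  attaining the norm of the sum of a series. In the converse, planes through a point show that the
  norm is affine on a short initial piece of each ray, and Baire category makes the length of these
  pieces uniform enough to fill a neighbourhood of a smooth point.\<close>

locale equivalent_norm =
  fixes N :: "'a::real_normed_vector \<Rightarrow> real" and c C :: real
  assumes triangle: "N (x + y) \<le> N x + N y"
    and scaleR: "N (a *\<^sub>R x) = \<bar>a\<bar> * N x"
    and c_pos: "0 < c"
    and C_pos: "0 < C"
    and lower: "c * norm x \<le> N x"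
    and upper: "N x \<le> C * norm x"
begin

lemma zero [simp]: "N 0 = 0"
  using scaleR[of 0 0] by simp

lemma nonneg [simp]: "0 \<le> N x"
  using lower[of x] c_pos by (meson mult_nonneg_nonneg norm_ge_zero order_trans less_imp_le)

lemma eq_0_iff [simp]: "N x = 0 \<longleftrightarrow> x = 0"
  using lower[of x] c_pos by (auto simp: mult_le_0_iff)

lemma pos_iff: "0 < N x \<longleftrightarrow> x \<noteq> 0"
  using eq_0_iff[of x] nonneg[of x] by linarith

lemma minus [simp]: "N (- x) = N x"
  using scaleR[of "-1" x] by simp

lemma minus_commute: "N (x - y) = N (y - x)"
  using minus[of "x - y"] by simp

lemma diff_triangle: "N (x - y) \<le> N x + N y"
  using triangle[of x "- y"] by simp

lemma reverse_triangle: "\<bar>N x - N y\<bar> \<le> N (x - y)"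
  using triangle[of "x - y" y] triangle[of "y - x" x] minus_commute[of x y] by auto

lemma tendsto: "(f \<longlongrightarrow> l) F \<Longrightarrow> ((\<lambda>x. N (f x)) \<longlongrightarrow> N l) F"
proof -
  assume f: "(f \<longlongrightarrow> l) F"
  have "((\<lambda>x. N (f x) - N l) \<longlongrightarrow> 0) F"
  proof (rule Lim_null_comparison)
    show "\<forall>\<^sub>F x in F. norm (N (f x) - N l) \<le> C * norm (f x - l)"
      by (intro always_eventually allI, unfold real_norm_def)
        (rule order_trans[OF reverse_triangle upper])
    show "((\<lambda>x. C * norm (f x - l)) \<longlongrightarrow> 0) F"
      using f tendsto_norm_zero tendsto_mult_right_zero LIM_zero by blast
  qed
  then show ?thesis by (rule LIM_zero_cancel)
qed

lemma continuous_on [continuous_intros]: "continuous_on S f \<Longrightarrow> continuous_on S (\<lambda>x. N (f x))"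
  unfolding continuous_on_def by (blast intro: tendsto)

lemma convex_combination:
  assumes "0 \<le> u" "u \<le> 1"
  shows "N ((1 - u) *\<^sub>R x + u *\<^sub>R y) \<le> (1 - u) * N x + u * N y"
  using triangle[of "(1 - u) *\<^sub>R x" "u *\<^sub>R y"] assms by (simp add: scaleR)

end

section \<open>Baire category in a complete metric space\<close>

lemma baire_dense:
  fixes G :: "nat \<Rightarrow> 'a::complete_space set"
  assumes "\<And>n. open (G n)" "\<And>n. closure (G n) = UNIV"
  shows "closure (\<Inter>n. G n) = UNIV"
proof -
  have "euclidean closure_of \<Inter>(range G) = topspace (euclidean :: 'a topology)"
  proof (rule Baire_category)
    show "completely_metrizable_space (euclidean :: 'a topology) \<or>
      locally_compact_space (euclidean :: 'a topology) \<and> regular_space (euclidean :: 'a topology)"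
      by (simp add: completely_metrizable_space_euclidean)
  qed (use assms in auto)
  then show ?thesis by simp
qed

lemma baire_closed_cover:
  fixes A :: "nat \<Rightarrow> 'a::complete_space set"
  assumes "\<And>n. closed (A n)" "(\<Union>n. A n) = UNIV"
  obtains n where "interior (A n) \<noteq> {}"
proof (rule ccontr)
  assume "\<not> thesis"
  then have "interior (A n) = {}" for n using that by blast
  then have "closure (\<Inter>n. - A n) = UNIV"
    using assms(1) by (intro baire_dense) (auto simp: closure_complement)
  moreover have "(\<Inter>n. - A n) = {}" using assms(2) by blast
  ultimately show False by simp
qed

lemma independent_pair_combination:
  assumes "x \<noteq> 0" "\<And>a. y \<noteq> a *\<^sub>R x" "s *\<^sub>R x + t *\<^sub>R y = (0::'a::real_vector)"
  shows "s = 0 \<and> t = 0"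
proof -
  have "t = 0"
  proof (rule ccontr)
    assume "t \<noteq> 0"
    have "t *\<^sub>R y = (- s) *\<^sub>R x" using assms(3) by (simp add: eq_neg_iff_add_eq_0 add.commute)
    then have "(1/t) *\<^sub>R (t *\<^sub>R y) = (1/t) *\<^sub>R ((- s) *\<^sub>R x)" by simp
    then have "y = (- s / t) *\<^sub>R x" using \<open>t \<noteq> 0\<close> by simp
    then show False using assms(2) by blast
  qed
  then show ?thesis using assms by simp
qed

section \<open>Two-dimensional sections of the unit ball and affinity along rays\<close>

context equivalent_norm
begin

lemma convex_on_line: "convex_on UNIV (\<lambda>t. N (x + t *\<^sub>R y))"
proof (rule convex_onI)
  fix t a b :: real
  assume "0 < t" "t < 1"
  have "x + ((1 - t) *\<^sub>R a + t *\<^sub>R b) *\<^sub>R y = (1 - t) *\<^sub>R (x + a *\<^sub>R y) + t *\<^sub>R (x + b *\<^sub>R y)"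
    by (simp add: algebra_simps)
  then show "N (x + ((1 - t) *\<^sub>R a + t *\<^sub>R b) *\<^sub>R y)
    \<le> (1 - t) * N (x + a *\<^sub>R y) + t * N (x + b *\<^sub>R y)"
    using convex_combination[of t "x + a *\<^sub>R y" "x + b *\<^sub>R y"] \<open>0 < t\<close> \<open>t < 1\<close> by simp
qed auto

text \<open>Pulled back along the linear injection \<open>\<phi>\<close>, the section becomes a
  compact convex subset of the plane, which is the hull of its extreme points by Minkowski's
  theorem. Injectivity carries extreme points to extreme points, so there are finitely many.\<close>

lemma plane_ball_polytope:
  assumes fin: "finite {p. p extreme_point_of {z \<in> span {x, y}. N z \<le> 1}}"
    and indep: "x \<noteq> 0" "\<And>a. y \<noteq> a *\<^sub>R x"
  shows "polytope {u :: real \<times> real. N (fst u *\<^sub>R x + snd u *\<^sub>R y) \<le> 1}"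
proof -
  define \<phi> where "\<phi> u = fst u *\<^sub>R x + snd u *\<^sub>R y" for u :: "real \<times> real"
  have lin: "linear \<phi>"
    by (rule linearI) (simp_all add: \<phi>_def algebra_simps)
  have inj0: "\<phi> u = 0 \<Longrightarrow> u = 0" for u
    using independent_pair_combination[OF indep, of "fst u" "snd u"] by (simp add: \<phi>_def prod_eq_iff)
  then have inj: "inj \<phi>"
    using linear_injective_0[OF lin] by blast
  define S where "S = {u. N (\<phi> u) \<le> 1}"
  have cont: "continuous_on UNIV \<phi>"
    unfolding \<phi>_def by (intro continuous_intros)
  have contN: "continuous_on A (\<lambda>u. N (\<phi> u))" for A
    by (intro continuous_intros continuous_on_subset[OF cont]) auto
  have "closed S"
    unfolding S_def by (intro closed_Collect_le contN) auto
  have "bounded S"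
  proof -
    \<comment> \<open>The positive minimum of the norm on the unit circle bounds \<open>S\<close> by
      homogeneity.\<close>
    have "\<exists>u\<in>sphere (0::real \<times> real) 1. \<forall>v\<in>sphere 0 1. N (\<phi> u) \<le> N (\<phi> v)"
    proof (intro continuous_attains_inf contN)
      have "(1, 0) \<in> sphere (0::real \<times> real) 1" by (simp add: norm_prod_def)
      then show "sphere (0::real \<times> real) 1 \<noteq> {}" by blast
    qed auto
    then obtain u where u: "norm u = 1" "\<And>v. norm v = 1 \<Longrightarrow> N (\<phi> u) \<le> N (\<phi> v)" by auto
    have upos: "0 < N (\<phi> u)" using u(1) inj0[of u] by (auto simp: pos_iff)
    have "norm v \<le> 1 / N (\<phi> u)" if v: "v \<in> S" for v
    proof (cases "v = 0")
      case False
      have "N (\<phi> u) \<le> N (\<phi> ((1 / norm v) *\<^sub>R v))" using False by (intro u(2)) simp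
      also have "\<dots> = N (\<phi> v) / norm v" using linear_scale[OF lin] by (simp add: scaleR)
      also have "\<dots> \<le> 1 / norm v" using v by (simp add: S_def divide_right_mono)
      finally show ?thesis using upos False by (simp add: field_simps)
    qed (use upos in auto)
    then show ?thesis unfolding bounded_iff by blast
  qed
  then have "compact S" using \<open>closed S\<close> compact_eq_bounded_closed by blast
  have "convex S"
    unfolding convex_alt
  proof safe
    fix a b u assume *: "a \<in> S" "b \<in> S" "0 \<le> (u::real)" "u \<le> 1"
    have "N (\<phi> ((1 - u) *\<^sub>R a + u *\<^sub>R b)) \<le> (1 - u) * N (\<phi> a) + u * N (\<phi> b)"
      using convex_combination[OF *(3,4)] by (simp add: linear_add[OF lin] linear_scale[OF lin])
    also have "\<dots> \<le> (1 - u) * 1 + u * 1"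
      using * by (intro add_mono mult_left_mono) (auto simp: S_def)
    finally show "(1 - u) *\<^sub>R a + u *\<^sub>R b \<in> S" by (simp add: S_def)
  qed
  have image: "\<phi> ` S = {z \<in> span {x, y}. N z \<le> 1}"
  proof -
    have "z \<in> \<phi> ` UNIV" if z: "z \<in> span {x, y}" for z
    proof -
      obtain a b where "z = a *\<^sub>R x + b *\<^sub>R y"
        using z by (auto simp: span_breakdown_eq algebra_simps)
      then have "z = \<phi> (a, b)" by (simp add: \<phi>_def)
      then show ?thesis by blast
    qed
    moreover have "\<phi> u \<in> span {x, y}" for u
      unfolding \<phi>_def by (intro span_add span_scale span_base) auto
    ultimately show ?thesis by (auto simp: S_def)
  qed
  have "\<phi> p extreme_point_of \<phi> ` S" if "p extreme_point_of S" for p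
    using that face_of_linear_image[OF lin inj, of "{p}" S] by (simp add: face_of_singleton)
  then have "\<phi> ` {p. p extreme_point_of S} \<subseteq> {p. p extreme_point_of \<phi> ` S}"
    by blast
  then have "finite {p. p extreme_point_of S}"
    using fin image inj by (metis finite_imageD finite_subset inj_on_subset subset_UNIV)
  then have "polytope S"
    using Krein_Milman_Minkowski[OF \<open>compact S\<close> \<open>convex S\<close>] unfolding polytope_def by blast
  then show ?thesis by (simp add: S_def \<phi>_def)
qed

text \<open>In the plane of \<open>x\<close> and \<open>y\<close> the norm is a maximum of finitely
  many linear functionals. One of them is active at times arbitrarily close to 0, and convexity
  spreads equality from those times to a whole interval. Dependent \<open>x\<close> and
  \<open>y\<close> span no plane and are treated directly.\<close>

lemma locally_affine_on_rays:
  assumes fin: "finite {p. p extreme_point_of {z \<in> span {x, y}. N z \<le> 1}}"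
  obtains \<epsilon> D where "0 < \<epsilon>" "\<And>t. 0 \<le> t \<Longrightarrow> t \<le> \<epsilon> \<Longrightarrow> N (x + t *\<^sub>R y) = N x + t * D"
proof (cases "x = 0 \<or> (\<exists>a. y = a *\<^sub>R x)")
  case True
  show thesis
  proof (cases "x = 0")
    case True
    then show thesis using that[of 1 "N y"] by (simp add: scaleR)
  next
    case False
    then obtain a where a: "y = a *\<^sub>R x" using True by blast
    show thesis
    proof (rule that)
      fix t :: real assume t: "0 \<le> t" "t \<le> 1 / (\<bar>a\<bar> + 1)"
      have "\<bar>t * a\<bar> \<le> 1 / (\<bar>a\<bar> + 1) * (\<bar>a\<bar> + 1)"
        unfolding abs_mult using t by (intro mult_mono) auto
      also have "\<dots> = 1" by (simp add: add_nonneg_eq_0_iff)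
      finally have "\<bar>t * a\<bar> \<le> 1" .
      have "N (x + t *\<^sub>R y) = N ((1 + t * a) *\<^sub>R x)" by (simp add: a algebra_simps)
      also have "\<dots> = (1 + t * a) * N x" using \<open>\<bar>t * a\<bar> \<le> 1\<close> by (subst scaleR) auto
      finally show "N (x + t *\<^sub>R y) = N x + t * (a * N x)" by (simp add: algebra_simps)
    qed simp
  qed
next
  case False
  then have indep: "x \<noteq> 0" "\<And>a. y \<noteq> a *\<^sub>R x" by auto
  define q where "q u = N (fst u *\<^sub>R x + snd u *\<^sub>R y)" for u :: "real \<times> real"
  define S where "S = {u. q u \<le> 1}"
  have "polyhedron S"
    unfolding S_def q_def using plane_ball_polytope[OF fin indep] by (rule polytope_imp_polyhedron)
  then obtain H where H: "finite H" "S = \<Inter>H" "\<forall>h\<in>H. \<exists>a b. a \<noteq> 0 \<and> h = {u. a \<bullet> u \<le> b}"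
    unfolding polyhedron_def by blast
  then obtain a b where ab: "\<And>h. h \<in> H \<Longrightarrow> a h \<noteq> 0" "\<And>h. h \<in> H \<Longrightarrow> h = {u. a h \<bullet> u \<le> b h}"
    by metis
  have mem: "q u \<le> 1 \<longleftrightarrow> (\<forall>h\<in>H. a h \<bullet> u \<le> b h)" for u
    using H(2) ab(2) unfolding S_def by blast
  have q_scale: "q (r *\<^sub>R u) = \<bar>r\<bar> * q u" for r u
    unfolding q_def using scaleR[of r "fst u *\<^sub>R x + snd u *\<^sub>R y"] by (simp add: algebra_simps)
  have bpos: "0 < b h" if h: "h \<in> H" for h
  proof -
    have "0 \<le> b h" using mem[of 0] h by (simp add: q_def)
    have qn: "0 \<le> q (a h)" by (simp add: q_def)
    have "q ((1 / (q (a h) + 1)) *\<^sub>R a h) \<le> 1" using qn by (simp add: q_scale)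
    then have "a h \<bullet> ((1 / (q (a h) + 1)) *\<^sub>R a h) \<le> b h" using mem h by blast
    moreover have "0 < a h \<bullet> ((1 / (q (a h) + 1)) *\<^sub>R a h)"
      using ab(1)[OF h] qn by (simp add: zero_less_divide_iff)
    ultimately show ?thesis by linarith
  qed
  have qpos: "0 < q u" if "u \<noteq> 0" for u
    unfolding q_def pos_iff using independent_pair_combination[OF indep, of "fst u" "snd u"] that
    by (auto simp: prod_eq_iff)
  have le: "a h \<bullet> u \<le> b h * q u" if "h \<in> H" "u \<noteq> 0" for h u
  proof -
    have "q ((1 / q u) *\<^sub>R u) \<le> 1" using qpos[OF that(2)] by (simp add: q_scale)
    then have "a h \<bullet> ((1 / q u) *\<^sub>R u) \<le> b h" using mem that by blast
    then show ?thesis using qpos[OF that(2)] by (simp add: field_simps)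
  qed
  \<comment> \<open>If every constraint were slack at \<open>u\<close>, the finitely many slacks
    would leave room for a radius \<open>r\<close> below \<open>q u\<close>, although
    \<open>q\<close> is the gauge of \<open>S\<close>.\<close>
  have attained: "\<exists>h\<in>H. a h \<bullet> u = b h * q u" if "u \<noteq> 0" for u
  proof (rule ccontr)
    assume "\<not> ?thesis"
    then have lt: "a h \<bullet> u < b h * q u" if "h \<in> H" for h
      using le[OF that \<open>u \<noteq> 0\<close>] that by force
    have "\<exists>r<q u. 0 < r \<and> (\<forall>h\<in>H. a h \<bullet> u \<le> b h * r)"
    proof -
      have "\<forall>\<^sub>F r in at_left (q u). \<forall>h\<in>H. a h \<bullet> u \<le> b h * r"
      proof (rule eventually_ball_finite[OF H(1)], rule ballI)
        fix h assume h: "h \<in> H"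
        have "((\<lambda>r. b h * r) \<longlongrightarrow> b h * q u) (at_left (q u))"
          by (intro tendsto_intros)
        then have "\<forall>\<^sub>F r in at_left (q u). a h \<bullet> u < b h * r"
          using lt[OF h] order_tendstoD(1) by blast
        then show "\<forall>\<^sub>F r in at_left (q u). a h \<bullet> u \<le> b h * r"
          by (rule eventually_mono) simp
      qed
      moreover have "\<forall>\<^sub>F r in at_left (q u). 0 < r \<and> r < q u"
        using qpos[OF that] eventually_at_left_real[of 0 "q u"] by (auto elim: eventually_mono)
      ultimately have "\<forall>\<^sub>F r in at_left (q u). (\<forall>h\<in>H. a h \<bullet> u \<le> b h * r) \<and> 0 < r \<and> r < q u"
        by (rule eventually_conj)
      then show ?thesis
        using eventually_happens'[OF trivial_limit_at_left_real] by blast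
    qed
    then obtain r where r: "r < q u" "0 < r" "\<And>h. h \<in> H \<Longrightarrow> a h \<bullet> u \<le> b h * r" by blast
    have "q ((1 / r) *\<^sub>R u) \<le> 1" using r mem[of "(1/r) *\<^sub>R u"] by (simp add: field_simps)
    then show False using r by (simp add: q_scale field_simps)
  qed
  define g where "g t = N (x + t *\<^sub>R y)" for t
  have g_q: "g t = q (1, t)" for t by (simp add: g_def q_def)
  define l where "l h t = (a h \<bullet> (1, t)) / b h" for h t
  have l_le: "l h t \<le> g t" if "h \<in> H" for h t
    using le[OF that, of "(1, t)"] bpos[OF that] by (simp add: l_def g_q field_simps zero_prod_def)
  have l_eq: "\<exists>h\<in>H. l h t = g t" for t
    using attained[of "(1, t)"] bpos by (force simp: l_def g_q zero_prod_def field_simps)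
  then obtain h where h: "\<And>t. h t \<in> H" "\<And>t. l (h t) t = g t" by metis
  \<comment> \<open>There are finitely many constraints and infinitely many times
    \<open>1 / Suc n\<close>, so one constraint is active along a sequence of times tending to
    0.\<close>
  have "finite (range (\<lambda>n::nat. h (1 / Suc n)))"
    using H(1) h(1) by (meson finite_subset image_subsetI)
  then have "\<exists>m\<in>UNIV. \<not> finite {n \<in> UNIV. h (1 / Suc n) = h (1 / Suc m)}"
    by (intro pigeonhole_infinite) auto
  then obtain m where m: "infinite {n. h (1 / Suc n) = h (1 / Suc m)}" by auto
  define k where "k = h (1 / Suc m)"
  have k: "k \<in> H" using h by (simp add: k_def)
  have arb: "\<exists>s>0. s < t \<and> l k s = g s" if "0 < t" for t
  proof -
    obtain n0 where n0: "1 / real (Suc n0) < t" by (rule nat_approx_posE[OF \<open>0 < t\<close>])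
    obtain n where n: "n \<ge> n0" "h (1 / Suc n) = k"
      using m unfolding infinite_nat_iff_unbounded_le k_def by blast
    have "1 / real (Suc n) \<le> 1 / real (Suc n0)" using n by (simp add: frac_le)
    then have "1 / real (Suc n) < t" using n0 by linarith
    then show ?thesis using h(2)[of "1 / Suc n"] n by (intro exI[of _ "1 / Suc n"]) auto
  qed
  have l_affine: "l k t = l k 0 + t * (snd (a k) / b k)" for t
    by (simp add: l_def inner_Pair_0 inner_prod_def add_divide_distrib)
  define \<epsilon> where "\<epsilon> = 1 / real (Suc m)"
  have \<epsilon>: "0 < \<epsilon>" "l k \<epsilon> = g \<epsilon>" using h(2) by (auto simp: \<epsilon>_def k_def)
  \<comment> \<open>A convex function that lies above an affine one and meets it at \<open>s\<close>
    and at \<open>\<epsilon>\<close> coincides with it in between.\<close>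
  have eq: "g t = l k t" if "0 < t" "t \<le> \<epsilon>" for t
  proof (cases "t = \<epsilon>")
    case False
    obtain s where s: "0 < s" "s < t" "l k s = g s" using arb[OF \<open>0 < t\<close>] by blast
    have "convex_on UNIV g" using convex_on_line unfolding g_def .
    define u where "u = (t - s) / (\<epsilon> - s)"
    have u: "0 \<le> u" "u \<le> 1" using s that by (auto simp: u_def)
    have t_eq: "t = (1 - u) * s + u * \<epsilon>"
    proof -
      have "u * (\<epsilon> - s) = t - s" using s that by (simp add: u_def)
      then show ?thesis by (simp add: algebra_simps)
    qed
    have "g t \<le> (1 - u) * g s + u * g \<epsilon>"
      using convex_onD[OF \<open>convex_on UNIV g\<close> u, of s \<epsilon>] t_eq by simp
    also have "\<dots> = l k t"
      unfolding s(3)[symmetric] \<epsilon>(2)[symmetric] by (subst (1 2 3) l_affine) (simp add: t_eq algebra_simps flip: add_divide_distrib diff_divide_distrib)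
    finally show ?thesis using l_le[OF k, of t] by linarith
  qed (use \<epsilon> in simp)
  \<comment> \<open>The times of contact are positive, so equality at 0 is obtained by
    continuity.\<close>
  have "g 0 = l k 0"
  proof (rule tendsto_unique)
    show "(g \<longlongrightarrow> g 0) (at_right 0)"
      unfolding g_def by (intro tendsto tendsto_eq_intros) auto
    have "((\<lambda>t. l k 0 + t * (snd (a k) / b k)) \<longlongrightarrow> l k 0 + 0 * (snd (a k) / b k)) (at_right 0)"
      by (intro tendsto_intros)
    then have "(l k \<longlongrightarrow> l k 0) (at_right 0)"
      unfolding l_affine[symmetric] by simp
    moreover have "\<forall>\<^sub>F t in at_right 0. l k t = g t"
      using eventually_at_right_real[OF \<epsilon>(1)] by (rule eventually_mono) (auto simp: eq)
    ultimately show "(g \<longlongrightarrow> l k 0) (at_right 0)"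
      by (rule Lim_transform_eventually)
  qed simp
  then have "g t = l k t" if "0 \<le> t" "t \<le> \<epsilon>" for t using eq that by (cases "t = 0") auto
  then have "N (x + t *\<^sub>R y) = N x + t * (snd (a k) / b k)" if "0 \<le> t" "t \<le> \<epsilon>" for t
    using that \<epsilon>(1) l_affine[of t] unfolding g_def by (metis add.right_neutral order_refl less_imp_le scaleR_zero_left)
  then show thesis using that \<epsilon>(1) by blast
qed

end

section \<open>Fonf's countable boundary\<close>

locale separable_polyhedral_norm = equivalent_norm N c C
  for N :: "'a::banach \<Rightarrow> real" and c C +
  fixes dirs :: "nat \<Rightarrow> 'a"
  assumes plane_finite: "finite {p. p extreme_point_of {z \<in> span {x, y}. N z \<le> 1}}"
    and dirs_dense: "closure (range dirs) = UNIV"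
begin

text \<open>The right derivative of \<open>N\<close> at \<open>x\<close> along \<open>y\<close>.
  Since \<open>N\<close> is affine on a short ray, it is a coefficient rather than a limit.\<close>

definition slope :: "'a \<Rightarrow> 'a \<Rightarrow> real" where
  "slope x y = (SOME D. \<exists>\<epsilon>>0. \<forall>t. 0 \<le> t \<longrightarrow> t \<le> \<epsilon> \<longrightarrow> N (x + t *\<^sub>R y) = N x + t * D)"

lemma slope:
  obtains \<epsilon> where "0 < \<epsilon>" "\<And>t. 0 \<le> t \<Longrightarrow> t \<le> \<epsilon> \<Longrightarrow> N (x + t *\<^sub>R y) = N x + t * slope x y"
proof -
  have "\<exists>D. \<exists>\<epsilon>>0. \<forall>t. 0 \<le> t \<longrightarrow> t \<le> \<epsilon> \<longrightarrow> N (x + t *\<^sub>R y) = N x + t * D"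
    using locally_affine_on_rays[OF plane_finite, of x y] by metis
  then have "\<exists>\<epsilon>>0. \<forall>t. 0 \<le> t \<longrightarrow> t \<le> \<epsilon> \<longrightarrow> N (x + t *\<^sub>R y) = N x + t * slope x y"
    unfolding slope_def by (rule someI_ex)
  then show thesis using that by blast
qed

lemma slope_unique:
  assumes "0 < \<epsilon>" "\<And>t. 0 \<le> t \<Longrightarrow> t \<le> \<epsilon> \<Longrightarrow> N (x + t *\<^sub>R y) = N x + t * D"
  shows "slope x y = D"
proof -
  obtain \<delta> where \<delta>: "0 < \<delta>" "\<And>t. 0 \<le> t \<Longrightarrow> t \<le> \<delta> \<Longrightarrow> N (x + t *\<^sub>R y) = N x + t * slope x y"
    using slope by blast
  define t where "t = min \<epsilon> \<delta>"
  have t: "0 < t" "t \<le> \<epsilon>" "t \<le> \<delta>" using \<open>0 < \<epsilon>\<close> \<open>0 < \<delta>\<close> by (auto simp: t_def)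
  then have "N x + t * D = N x + t * slope x y"
    using assms(2)[of t] \<delta>(2)[of t] by simp
  then show ?thesis using t by simp
qed

text \<open>Difference quotients of a convex function increase with \<open>t\<close>, and for small
  \<open>t\<close> they equal the slope.\<close>

lemma slope_le_difference_quotient:
  assumes "0 < t"
  shows "t * slope x y \<le> N (x + t *\<^sub>R y) - N x"
proof -
  obtain \<delta> where \<delta>: "0 < \<delta>" "\<And>t. 0 \<le> t \<Longrightarrow> t \<le> \<delta> \<Longrightarrow> N (x + t *\<^sub>R y) = N x + t * slope x y"
    using slope by blast
  define s where "s = min t \<delta>"
  define u where "u = s / t"
  have s: "0 < s" "s \<le> t" "s \<le> \<delta>" using assms \<delta>(1) by (auto simp: s_def)
  have u: "0 < u" "u \<le> 1" and ut: "u * t = s" using s assms by (auto simp: u_def)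
  have "x + s *\<^sub>R y = (1 - u) *\<^sub>R x + u *\<^sub>R (x + t *\<^sub>R y)" by (simp add: algebra_simps flip: ut)
  then have "N (x + s *\<^sub>R y) \<le> (1 - u) * N x + u * N (x + t *\<^sub>R y)"
    using convex_combination[of u x "x + t *\<^sub>R y"] u by simp
  then have "u * (t * slope x y) \<le> u * (N (x + t *\<^sub>R y) - N x)"
    using \<delta>(2)[of s] s by (simp add: algebra_simps flip: ut)
  then show ?thesis using u by simp
qed

lemma slope_le: "slope x y \<le> N y"
  using slope_le_difference_quotient[of 1 x y] triangle[of x y] by simp

lemma slope_subadditive: "slope x (y + z) \<le> slope x y + slope x z"
proof -
  obtain a where a: "0 < a" "\<And>t. 0 \<le> t \<Longrightarrow> t \<le> a \<Longrightarrow> N (x + t *\<^sub>R (y + z)) = N x + t * slope x (y + z)"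
    using slope by blast
  obtain b where b: "0 < b" "\<And>t. 0 \<le> t \<Longrightarrow> t \<le> b \<Longrightarrow> N (x + t *\<^sub>R y) = N x + t * slope x y"
    using slope by blast
  obtain d where d: "0 < d" "\<And>t. 0 \<le> t \<Longrightarrow> t \<le> d \<Longrightarrow> N (x + t *\<^sub>R z) = N x + t * slope x z"
    using slope by blast
  \<comment> \<open>Half of the common length is taken because \<open>x + t (y + z)\<close> is the
    midpoint of \<open>x + 2t y\<close> and \<open>x + 2t z\<close>.\<close>
  define t where "t = min a (min b d) / 2"
  have t: "0 < t" "t \<le> a" "2 * t \<le> b" "2 * t \<le> d" using a(1) b(1) d(1) by (auto simp: t_def)
  have "x + t *\<^sub>R (y + z) = (1 - 1/2) *\<^sub>R (x + (2 * t) *\<^sub>R y) + (1/2) *\<^sub>R (x + (2 * t) *\<^sub>R z)"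
    by (simp add: algebra_simps) (simp flip: scaleR_add_left)
  then have "N (x + t *\<^sub>R (y + z)) \<le> (1 - 1/2) * N (x + (2 * t) *\<^sub>R y) + 1/2 * N (x + (2 * t) *\<^sub>R z)"
    using convex_combination[of "1/2" "x + (2 * t) *\<^sub>R y" "x + (2 * t) *\<^sub>R z"] by simp
  moreover have "N (x + t *\<^sub>R (y + z)) = N x + t * slope x (y + z)"
    "N (x + (2 * t) *\<^sub>R y) = N x + 2 * (t * slope x y)"
    "N (x + (2 * t) *\<^sub>R z) = N x + 2 * (t * slope x z)"
    using a(2)[of t] b(2)[of "2 * t"] d(2)[of "2 * t"] t by simp_all
  moreover have "p \<le> q + r" if "a \<le> (1 - 1/2) * b + 1/2 * d" "a = n + p" "b = n + 2 * q" "d = n + 2 * r"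
    for a b d n p q r :: real
    using that by (simp add: field_simps)
  ultimately have "t * slope x (y + z) \<le> t * slope x y + t * slope x z"
    by blast
  then have "t * slope x (y + z) \<le> t * (slope x y + slope x z)"
    by (simp add: distrib_left)
  then show ?thesis using t by simp
qed

lemma slope_zero [simp]: "slope x 0 = 0"
  by (rule slope_unique[of 1]) auto

lemma slope_self: "slope x x = N x"
proof (rule slope_unique[of 1])
  fix t :: real assume "0 \<le> t"
  have "N (x + t *\<^sub>R x) = N ((1 + t) *\<^sub>R x)" by (simp add: algebra_simps)
  also have "\<dots> = (1 + t) * N x" using \<open>0 \<le> t\<close> by (subst scaleR) simp
  finally show "N (x + t *\<^sub>R x) = N x + t * N x" by (simp add: algebra_simps)
qed simp

lemma slope_scale_nonneg:
  assumes "0 \<le> r"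
  shows "slope x (r *\<^sub>R y) = r * slope x y"
proof (cases "r = 0")
  case False
  obtain \<delta> where \<delta>: "0 < \<delta>" "\<And>t. 0 \<le> t \<Longrightarrow> t \<le> \<delta> \<Longrightarrow> N (x + t *\<^sub>R y) = N x + t * slope x y"
    using slope by blast
  show ?thesis
  proof (rule slope_unique[of "\<delta> / r"])
    show "0 < \<delta> / r" using \<delta>(1) assms False by simp
    fix t assume "0 \<le> t" "t \<le> \<delta> / r"
    then show "N (x + t *\<^sub>R (r *\<^sub>R y)) = N x + t * (r * slope x y)"
      using \<delta>(2)[of "t * r"] assms False by (simp add: field_simps)
  qed
qed simp

text \<open>The points of Gateaux differentiability: a sublinear slope that is odd in the direction
  is linear.\<close>

definition smooth_points :: "'a set" where
  "smooth_points = {x. \<forall>y. slope x y + slope x (- y) = 0}"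

text \<open>Mazur's density theorem. For one direction, the points at which some second difference
  is small compared with \<open>t\<close> form an open set. It is dense because a short step along
  an affine ray leads to a point where \<open>N\<close> is affine on both sides. Baire intersects
  these sets over a dense sequence of directions.\<close>

lemma smooth_points_dense: "closure smooth_points = UNIV"
proof -
  define A where "A d n = (\<Union>t\<in>{0<..}. {x. N (x + t *\<^sub>R d) + N (x - t *\<^sub>R d) - 2 * N x < t / real (Suc n)})"
    for d and n :: nat
  define G where "G i = A (dirs (fst (prod_decode i))) (snd (prod_decode i))" for i
  have open_A: "open (A d n)" for d n
    unfolding A_def by (intro open_UN ballI open_Collect_less continuous_intros)
  have dense_A: "closure (A d n) = UNIV" for d n
  proof -
    have "\<exists>y\<in>A d n. dist y x < e" if "0 < e" for x e
    proof -
      obtain \<delta> where \<delta>: "0 < \<delta>" "\<And>t. 0 \<le> t \<Longrightarrow> t \<le> \<delta> \<Longrightarrow> N (x + t *\<^sub>R d) = N x + t * slope x d"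
        using slope by blast
      \<comment> \<open>The bound \<open>\<delta> / 2\<close> keeps \<open>x + 2s d\<close> on the
        affine piece, so the second difference at \<open>x + s d\<close> vanishes; the other bound
        keeps the step shorter than \<open>e\<close>.\<close>
      define s where "s = min (\<delta> / 2) (e / (norm d + 1) / 2)"
      have nd: "0 < norm d + 1" using norm_ge_zero[of d] by linarith
      have s: "0 < s" "2 * s \<le> \<delta>" "s \<le> e / (norm d + 1) / 2" using \<delta>(1) that nd by (auto simp: s_def)
      have "s * norm d \<le> s * (norm d + 1)" using s by simp
      also have "\<dots> \<le> (e / (norm d + 1) / 2) * (norm d + 1)" using s nd by (intro mult_right_mono) auto
      also have "\<dots> = e / 2" using nd by (simp add: field_simps)
      finally have "s * norm d < e" using that by linarith
      moreover have "x + s *\<^sub>R d \<in> A d n"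
      proof -
        have e1: "x + s *\<^sub>R d + s *\<^sub>R d = x + (2 * s) *\<^sub>R d" by (simp add: add.assoc flip: scaleR_add_left)
        have e2: "N (x + s *\<^sub>R d + s *\<^sub>R d) = N x + 2 * s * slope x d"
          unfolding e1 using \<delta>(2)[of "2 * s"] s by simp
        have e3: "N (x + s *\<^sub>R d) = N x + s * slope x d" using \<delta>(2)[of s] s by simp
        have "N (x + s *\<^sub>R d + s *\<^sub>R d) + N (x + s *\<^sub>R d - s *\<^sub>R d) - 2 * N (x + s *\<^sub>R d) = 0"
          unfolding e2 e3 by simp
        then show ?thesis unfolding A_def using s by (auto intro!: bexI[of _ s])
      qed
      ultimately show ?thesis using s by (intro bexI[of _ "x + s *\<^sub>R d"]) (auto simp: dist_norm)
    qed
    then show ?thesis by (auto simp: closure_approachable)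
  qed
  have "(\<Inter>i. G i) \<subseteq> smooth_points"
  proof
    fix x assume x: "x \<in> (\<Inter>i. G i)"
    have xA: "x \<in> A (dirs k) n" for k n
    proof -
      have "x \<in> G (prod_encode (k, n))" using x by blast
      then show ?thesis by (simp add: G_def)
    qed
    have nonneg_sum: "0 \<le> slope x y + slope x (- y)" for y
      using slope_subadditive[of x y "- y"] by simp
    have *: "slope x (dirs k) + slope x (- dirs k) \<le> 0" for k
    proof (rule field_le_epsilon)
      fix e :: real assume "0 < e"
      then obtain n where n: "1 / real (Suc n) < e" by (rule nat_approx_posE)
      obtain t where t: "0 < t" "N (x + t *\<^sub>R dirs k) + N (x - t *\<^sub>R dirs k) - 2 * N x < t / real (Suc n)"
        using xA[of k n] by (auto simp: A_def)
      have "t * (slope x (dirs k) + slope x (- dirs k)) < t * (1 / real (Suc n))"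
        using slope_le_difference_quotient[OF t(1), of x "dirs k"]
          slope_le_difference_quotient[OF t(1), of x "- dirs k"] t(2) by (simp add: distrib_left)
      then have "slope x (dirs k) + slope x (- dirs k) < 1 / real (Suc n)" using t(1) by (simp only: mult_less_cancel_left_pos)
      then show "slope x (dirs k) + slope x (- dirs k) \<le> 0 + e" using n by linarith
    qed
    \<comment> \<open>Slopes are subadditive and dominated by \<open>N\<close>, so replacing
      \<open>y\<close> by a nearby \<open>dirs k\<close> costs at most twice
      \<open>N (y - dirs k)\<close>.\<close>
    have "slope x y + slope x (- y) \<le> 0" for y
    proof (rule field_le_epsilon)
      fix e :: real assume "0 < e"
      then have "0 < e / (2 * C)" using C_pos by simp
      then obtain k where k: "dist (dirs k) y < e / (2 * C)"
        using dirs_dense by (metis UNIV_I closure_approachable rangeE)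
      have "2 * N (y - dirs k) \<le> 2 * (C * norm (y - dirs k))" using upper by simp
      also have "\<dots> < e" using k C_pos by (simp add: dist_norm norm_minus_commute field_simps)
      finally have "2 * N (y - dirs k) < e" .
      moreover have "slope x y \<le> slope x (dirs k) + N (y - dirs k)"
        using slope_subadditive[of x "dirs k" "y - dirs k"] slope_le[of x "y - dirs k"] by simp
      moreover have "slope x (- y) \<le> slope x (- dirs k) + N (y - dirs k)"
        using slope_subadditive[of x "- dirs k" "dirs k - y"] slope_le[of x "dirs k - y"]
        by (simp add: minus_commute)
      ultimately show "slope x y + slope x (- y) \<le> 0 + e" using *[of k] by linarith
    qed
    then show "x \<in> smooth_points"
      using nonneg_sum unfolding smooth_points_def by (auto intro: antisym)
  qed
  moreover have "closure (\<Inter>i. G i) = UNIV"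
    by (rule baire_dense) (auto simp: G_def open_A dense_A)
  ultimately show ?thesis using closure_mono by blast
qed

lemma linear_slope:
  assumes "x \<in> smooth_points"
  shows "linear (slope x)"
proof (rule linearI)
  have neg: "slope x (- y) = - slope x y" for y
    using assms by (simp add: smooth_points_def eq_neg_iff_add_eq_0 add.commute)
  show "slope x (y + z) = slope x y + slope x z" for y z
    using slope_subadditive[of x y z] slope_subadditive[of x "y + z" "- z"] neg by simp
  show "slope x (r *\<^sub>R y) = r *\<^sub>R slope x y" for r y
  proof (cases "0 \<le> r")
    case False
    then show ?thesis using slope_scale_nonneg[of "- r" x y] neg[of "r *\<^sub>R y"] by simp
  qed (simp add: slope_scale_nonneg)
qed

lemma bounded_linear_dominated:
  assumes "linear f" "\<And>x. \<bar>f x\<bar> \<le> N x"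
  shows "bounded_linear (f :: 'a \<Rightarrow> real)"
proof (rule bounded_linear_intro[of _ C])
  show "norm (f x) \<le> norm x * C" for x
    using order_trans[OF assms(2) upper, of x] by (simp add: mult.commute)
qed (simp_all add: linear_add[OF assms(1)] linear_scale[OF assms(1)])

text \<open>Along each direction \<open>N\<close> agrees with \<open>slope x\<close> for a positive
  length that depends on the direction. Baire makes the length uniform on a ball of directions about
  some \<open>y0\<close>, and averaging with the single direction \<open>- y0\<close> recentres that
  ball at 0.\<close>

lemma smooth_point_interior:
  assumes "x \<in> smooth_points"
  obtains \<rho> where "0 < \<rho>" "\<And>z. z \<in> ball x \<rho> \<Longrightarrow> N z = slope x z"
proof -
  note lin = linear_slope[OF assms]
  have neg: "slope x (- y) = - slope x y" for y
    using lin by (rule linear_neg)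
  have "\<bar>slope x y\<bar> \<le> N y" for y
    using slope_le[of x y] slope_le[of x "- y"] neg[of y] by simp
  then have "bounded_linear (slope x)"
    by (rule bounded_linear_dominated[OF lin])
  then have cont: "continuous_on S g \<Longrightarrow> continuous_on S (\<lambda>y. slope x (g y))" for S and g :: "'a \<Rightarrow> 'a"
    by (rule bounded_linear.continuous_on)
  define A where "A n = (\<Inter>t\<in>{0..1 / real (Suc n)}. {y. N (x + t *\<^sub>R y) = slope x (x + t *\<^sub>R y)})" for n
  have closed: "closed (A n)" for n
    unfolding A_def by (intro closed_INT ballI closed_Collect_eq continuous_intros cont)
  have cover: "\<exists>n. y \<in> A n" for y
  proof -
    obtain \<delta> where \<delta>: "0 < \<delta>" "\<And>t. 0 \<le> t \<Longrightarrow> t \<le> \<delta> \<Longrightarrow> N (x + t *\<^sub>R y) = N x + t * slope x y"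
      using slope by blast
    obtain n where n: "1 / real (Suc n) < \<delta>" using \<delta>(1) by (rule nat_approx_posE)
    have "y \<in> A n"
      using \<delta>(2) n by (auto simp: A_def linear_add[OF lin] linear_scale[OF lin] slope_self)
    then show ?thesis ..
  qed
  then have "(\<Union>n. A n) = UNIV" by blast
  with closed obtain n where "interior (A n) \<noteq> {}" by (rule baire_closed_cover)
  then obtain y0 \<rho> where \<rho>: "0 < \<rho>" "ball y0 \<rho> \<subseteq> A n"
    by (auto simp: mem_interior)
  obtain m where m: "- y0 \<in> A m" using cover by blast
  define s where "s = min (1 / real (Suc n)) (1 / real (Suc m))"
  have s: "0 < s" "s \<le> 1 / real (Suc n)" "s \<le> 1 / real (Suc m)" by (auto simp: s_def)
  show thesis
  proof (rule that)
    show "0 < s * \<rho> / 2" using s \<rho> by simp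
    fix z assume z: "z \<in> ball x (s * \<rho> / 2)"
    \<comment> \<open>The factor 2 compensates for the midpoint in \<open>zz\<close>, where
      \<open>y0\<close> cancels.\<close>
    define b where "b = (2 / s) *\<^sub>R (z - x)"
    have zb: "z = x + (s / 2) *\<^sub>R b" using s by (simp add: b_def)
    have "norm b = (2 / s) * dist x z" using s by (simp add: b_def dist_norm norm_minus_commute)
    also have "\<dots> < (2 / s) * (s * \<rho> / 2)" using z s by (intro mult_strict_left_mono) auto
    also have "\<dots> = \<rho>" using s by simp
    finally have "norm b < \<rho>" .
    then have "y0 + b \<in> A n" using \<rho>(2) by (auto simp: dist_norm)
    then have 1: "N (x + s *\<^sub>R (y0 + b)) = slope x (x + s *\<^sub>R (y0 + b))"
      using s by (auto simp: A_def)
    have 2: "N (x + s *\<^sub>R (- y0)) = slope x (x + s *\<^sub>R (- y0))"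
      using m s unfolding A_def by force
    have zz: "z = (1 - 1/2) *\<^sub>R (x + s *\<^sub>R (y0 + b)) + (1/2) *\<^sub>R (x + s *\<^sub>R (- y0))"
      by (simp add: zb algebra_simps) (simp flip: scaleR_add_left)
    have "N z \<le> (1 - 1/2) * N (x + s *\<^sub>R (y0 + b)) + 1/2 * N (x + s *\<^sub>R (- y0))"
      unfolding zz by (rule convex_combination) auto
    also have "\<dots> = slope x z"
      unfolding 1 2 by (subst zz) (simp only: linear_add[OF lin] linear_scale[OF lin] real_scaleR_def)
    finally show "N z = slope x z" using slope_le[of x z] by simp
  qed
qed

definition agrees_near :: "('a \<Rightarrow> real) \<Rightarrow> 'a \<Rightarrow> bool" where
  "agrees_near f x \<longleftrightarrow> linear f \<and> (\<exists>\<rho>>0. \<forall>z\<in>ball x \<rho>. N z = f z)"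

text \<open>Each member supports the unit ball along a piece that is relatively open in its
  boundary; together they form Fonf's boundary.\<close>

definition faces :: "('a \<Rightarrow> real) set" where
  "faces = {f. \<exists>x. agrees_near f x}"

lemma agrees_near_ball:
  assumes "agrees_near f x"
  obtains \<rho> where "0 < \<rho>" "\<And>v. dist v x < \<rho> \<Longrightarrow> agrees_near f v"
proof -
  obtain \<rho> where \<rho>: "linear f" "0 < \<rho>" "\<forall>z\<in>ball x \<rho>. N z = f z"
    using assms by (auto simp: agrees_near_def)
  have "agrees_near f v" if v: "dist v x < \<rho>" for v
    unfolding agrees_near_def
  proof (intro conjI exI ballI)
    show "0 < \<rho> - dist v x" using v by simp
    fix z assume "z \<in> ball v (\<rho> - dist v x)"
    then have "dist x z < \<rho>"
      using dist_triangle[of x z v] by (simp add: dist_commute)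
    then show "N z = f z" using \<rho>(3) by simp
  qed fact
  then show thesis using that \<rho>(2) by blast
qed

lemma agrees_near_ray:
  assumes "agrees_near f x"
  obtains \<epsilon> where "0 < \<epsilon>" "\<And>t. \<bar>t\<bar> \<le> \<epsilon> \<Longrightarrow> N (x + t *\<^sub>R y) = f x + t * f y"
proof -
  obtain \<rho> where \<rho>: "linear f" "0 < \<rho>" "\<And>z. z \<in> ball x \<rho> \<Longrightarrow> N z = f z"
    using assms by (auto simp: agrees_near_def)
  have nd: "0 < norm y + 1" using norm_ge_zero[of y] by linarith
  show thesis
  proof (rule that)
    show "0 < \<rho> / (norm y + 1) / 2" using \<rho> nd by simp
    fix t assume t: "\<bar>t\<bar> \<le> \<rho> / (norm y + 1) / 2"
    have "\<bar>t\<bar> * norm y \<le> \<bar>t\<bar> * (norm y + 1)" by (intro mult_left_mono) auto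
    also have "\<dots> \<le> (\<rho> / (norm y + 1) / 2) * (norm y + 1)" using t nd by (intro mult_right_mono) auto
    also have "\<dots> = \<rho> / 2" using nd by (simp add: field_simps)
    finally have "x + t *\<^sub>R y \<in> ball x \<rho>" using \<rho>(2) by (simp add: dist_norm)
    then show "N (x + t *\<^sub>R y) = f x + t * f y"
      using \<rho> by (simp add: linear_add linear_scale)
  qed
qed

text \<open>Near \<open>x\<close> the functional is the norm, so the triangle inequality bounds its
  increment in any direction.\<close>

lemma faces_dominated:
  assumes "f \<in> faces"
  shows "\<bar>f z\<bar> \<le> N z"
proof -
  obtain x where x: "agrees_near f x" using assms by (auto simp: faces_def)
  then have lin: "linear f" by (simp add: agrees_near_def)
  have "f y \<le> N y" for y
  proof -
    obtain \<epsilon> where \<epsilon>: "0 < \<epsilon>" "\<And>t. \<bar>t\<bar> \<le> \<epsilon> \<Longrightarrow> N (x + t *\<^sub>R y) = f x + t * f y"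
      using agrees_near_ray[OF x] by blast
    have "\<epsilon> * f y \<le> \<epsilon> * N y"
      using \<epsilon>(2)[of \<epsilon>] \<epsilon>(2)[of 0] triangle[of x "\<epsilon> *\<^sub>R y"] \<epsilon>(1) by (simp add: scaleR)
    then show ?thesis using \<epsilon>(1) by simp
  qed
  from this[of z] this[of "- z"] show ?thesis by (simp add: linear_neg[OF lin])
qed

text \<open>Agreement with \<open>N\<close> near a single point determines a linear functional, and
  the open set of such points contains a term of the dense sequence.\<close>

lemma countable_faces: "countable faces"
proof -
  have ex: "\<exists>k. agrees_near f (dirs k)" if f: "f \<in> faces" for f
  proof -
    obtain x where "agrees_near f x" using f by (auto simp: faces_def)
    then obtain \<rho> where \<rho>: "0 < \<rho>" "\<And>v. dist v x < \<rho> \<Longrightarrow> agrees_near f v"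
      using agrees_near_ball by blast
    obtain k where "dist (dirs k) x < \<rho>"
      using dirs_dense \<rho>(1) by (metis UNIV_I closure_approachable rangeE)
    then show ?thesis using \<rho>(2) by blast
  qed
  have eq: "f = g" if f: "agrees_near f x" and g: "agrees_near g x" for f g x
  proof
    fix y
    obtain a where a: "0 < a" "\<And>t. \<bar>t\<bar> \<le> a \<Longrightarrow> N (x + t *\<^sub>R y) = f x + t * f y"
      using agrees_near_ray[OF f] by blast
    obtain b where b: "0 < b" "\<And>t. \<bar>t\<bar> \<le> b \<Longrightarrow> N (x + t *\<^sub>R y) = g x + t * g y"
      using agrees_near_ray[OF g] by blast
    have "f x = g x" using a(2)[of 0] b(2)[of 0] a(1) b(1) by simp
    define t where "t = min a b"
    have t: "0 < t" "t \<le> a" "t \<le> b" using a(1) b(1) by (auto simp: t_def)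
    then have "f x + t * f y = g x + t * g y"
      using a(2)[of t] b(2)[of t] by simp
    then show "f y = g y" using t \<open>f x = g x\<close> by simp
  qed
  define k where "k f = (SOME k. agrees_near f (dirs k))" for f
  have "agrees_near f (dirs (k f))" if "f \<in> faces" for f
    unfolding k_def using ex[OF that] by (rule someI_ex)
  then have "inj_on k faces"
    by (intro inj_onI) (metis eq)
  then show ?thesis by (rule countableI')
qed

text \<open>The points near which \<open>N\<close> is linear form a dense open set \<open>U\<close>.
  For a generic direction \<open>y\<close> the ray from \<open>x\<close> meets \<open>U\<close> at
  arbitrarily small times, hence while \<open>N\<close> is still affine along it. The functional
  found there matches the affine function on an interval, and therefore also at time 0.\<close>

lemma faces_boundary: "\<exists>f\<in>faces. f x = N x"
proof -
  define U where "U = {u. \<exists>f. agrees_near f u}"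
  have "open U"
    unfolding open_dist
  proof
    fix u assume "u \<in> U"
    then obtain f where "agrees_near f u" by (auto simp: U_def)
    then obtain \<rho> where "0 < \<rho>" "\<And>v. dist v u < \<rho> \<Longrightarrow> agrees_near f v"
      using agrees_near_ball by blast
    then show "\<exists>e>0. \<forall>v. dist v u < e \<longrightarrow> v \<in> U" by (auto simp: U_def)
  qed
  have "smooth_points \<subseteq> U"
  proof
    fix u assume u: "u \<in> smooth_points"
    then obtain \<rho> where "0 < \<rho>" "\<And>z. z \<in> ball u \<rho> \<Longrightarrow> N z = slope u z"
      using smooth_point_interior by blast
    then show "u \<in> U" unfolding U_def agrees_near_def using linear_slope[OF u] by blast
  qed
  then have dense_U: "closure U = UNIV" using smooth_points_dense closure_mono by blast
  \<comment> \<open>The directions whose ray from \<open>x\<close> meets \<open>U\<close> before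
    time \<open>1 / Suc n\<close>.\<close>
  define G where "G n = (\<Union>s\<in>{0<..<1 / real (Suc n)}. (\<lambda>y. x + s *\<^sub>R y) -` U)" for n
  have "open (G n)" for n
    unfolding G_def by (intro open_UN ballI open_vimage \<open>open U\<close> continuous_intros)
  moreover have "closure (G n) = UNIV" for n
  proof -
    have "\<exists>y'\<in>G n. dist y' y < e" if "0 < e" for y e
    proof -
      define s where "s = 1 / real (Suc (Suc n))"
      have s: "0 < s" "s < 1 / real (Suc n)" by (simp_all add: s_def field_simps)
      obtain u where u: "u \<in> U" "dist u (x + s *\<^sub>R y) < s * e"
        using dense_U \<open>0 < e\<close> s(1) by (metis UNIV_I closure_approachable mult_pos_pos)
      define y' where "y' = (1 / s) *\<^sub>R (u - x)"
      have "x + s *\<^sub>R y' = u" using s by (simp add: y'_def)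
      then have "y' \<in> G n" using s u(1) by (auto simp: G_def)
      moreover have "dist u (x + s *\<^sub>R y) = s * dist y' y"
      proof -
        have "u - (x + s *\<^sub>R y) = s *\<^sub>R (y' - y)" using \<open>x + s *\<^sub>R y' = u\<close> by (auto simp: algebra_simps)
        then show ?thesis using s by (simp add: dist_norm)
      qed
      ultimately show ?thesis using u(2) s by (intro bexI[of _ y']) auto
    qed
    then show ?thesis by (auto simp: closure_approachable)
  qed
  ultimately have "closure (\<Inter>n. G n) = UNIV" by (rule baire_dense)
  then have "(\<Inter>n. G n) \<noteq> {}" by auto
  then obtain y where y: "\<And>n. y \<in> G n" by blast
  obtain \<delta> where \<delta>: "0 < \<delta>" "\<And>t. 0 \<le> t \<Longrightarrow> t \<le> \<delta> \<Longrightarrow> N (x + t *\<^sub>R y) = N x + t * slope x y"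
    using slope by blast
  obtain n where n: "1 / real (Suc n) < \<delta>" using \<delta>(1) by (rule nat_approx_posE)
  obtain s where s: "0 < s" "s < \<delta>" "x + s *\<^sub>R y \<in> U" using y[of n] n by (auto simp: G_def)
  then obtain f where f: "agrees_near f (x + s *\<^sub>R y)" by (auto simp: U_def)
  then have lin: "linear f" by (simp add: agrees_near_def)
  obtain \<epsilon> where \<epsilon>: "0 < \<epsilon>"
    "\<And>t. \<bar>t\<bar> \<le> \<epsilon> \<Longrightarrow> N (x + s *\<^sub>R y + t *\<^sub>R y) = f (x + s *\<^sub>R y) + t * f y"
    using agrees_near_ray[OF f] by blast
  define t where "t = min \<epsilon> (\<delta> - s)"
  have t: "0 < t" "\<bar>t\<bar> \<le> \<epsilon>" "s + t \<le> \<delta>" using \<epsilon>(1) s by (auto simp: t_def)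
  \<comment> \<open>Agreement at the times \<open>s\<close> and \<open>s + t\<close> gives equal
    slopes, and then equal values at time 0.\<close>
  have 1: "f x + s * f y = N x + s * slope x y"
    using \<epsilon>(2)[of 0] \<epsilon>(1) \<delta>(2)[of s] s by (simp add: linear_add[OF lin] linear_scale[OF lin])
  have "f x + s * f y + t * f y = N (x + s *\<^sub>R y + t *\<^sub>R y)"
    using \<epsilon>(2)[OF t(2)] by (simp add: linear_add[OF lin] linear_scale[OF lin])
  also have "\<dots> = N (x + (s + t) *\<^sub>R y)" by (simp add: scaleR_add_left add.assoc)
  also have "\<dots> = N x + (s + t) * slope x y" using \<delta>(2)[of "s + t"] s t by simp
  finally have "f x + s * f y + t * f y = N x + (s + t) * slope x y" .
  with 1 have "t * f y = t * slope x y" by (simp add: algebra_simps)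
  then have "f y = slope x y" using t by simp
  with 1 have "f x = N x" by simp
  then show ?thesis using f by (auto simp: faces_def)
qed

end

lemma separable_space_dense_sequence:
  assumes "separable_space (euclidean :: 'a::topological_space topology)"
  obtains d :: "nat \<Rightarrow> 'a::topological_space" where "closure (range d) = UNIV"
proof -
  obtain D :: "'a set" where D: "countable D" "closure D = UNIV"
    using assms by (auto simp: separable_space_def)
  then have "D \<noteq> {}" by auto
  then have "range (from_nat_into D) = D" using D(1) by (rule range_from_nat_into)
  then show thesis using that[of "from_nat_into D"] D(2) by simp
qed

lemma separable_polyhedral_countable_boundary:
  assumes sep: "separable_space (euclidean :: 'a::banach topology)"
    and iso: "iso_polyhedral (UNIV :: 'a set)"
  obtains N :: "'a::banach \<Rightarrow> real" and c C h
  where "equivalent_norm N c C" "\<And>n :: nat. linear (h n)" "\<And>n x. \<bar>h n x\<bar> \<le> N x" "\<And>x. \<exists>n. h n x = N x"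
proof -
  obtain N :: "'a \<Rightarrow> real" and c C where N: "norm_on UNIV N" "0 < c" "0 < C"
    "\<And>z. c * norm z \<le> N z" "\<And>z. N z \<le> C * norm z" and poly: "polyhedral_wrt UNIV N"
    using iso unfolding iso_polyhedral_def by blast
  obtain d :: "nat \<Rightarrow> 'a" where d: "closure (range d) = UNIV"
    using separable_space_dense_sequence[OF sep] by blast
  interpret equivalent_norm N c C
    using N by unfold_locales (auto simp: norm_on_def)
  interpret separable_polyhedral_norm N c C d
  proof
    fix x y :: 'a
    have "\<exists>B. finite B \<and> span {x, y} = span B" by (intro exI[of _ "{x, y}"]) simp
    then show "finite {p. p extreme_point_of {z \<in> span {x, y}. N z \<le> 1}}"
      using poly unfolding polyhedral_wrt_def by (metis subset_UNIV subspace_span)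
  qed (rule d)
  have "faces \<noteq> {}" using faces_boundary by blast
  then have range: "range (from_nat_into faces) = faces" using countable_faces by (rule range_from_nat_into)
  then have mem: "from_nat_into faces n \<in> faces" for n by blast
  show thesis
  proof (rule that)
    show "equivalent_norm N c C" by unfold_locales
    show "linear (from_nat_into faces n)" for n
      using mem[of n] by (auto simp: faces_def agrees_near_def)
    show "\<bar>from_nat_into faces n x\<bar> \<le> N x" for n x
      using mem by (rule faces_dominated)
    show "\<exists>n. from_nat_into faces n x = N x" for x
      using faces_boundary[of x] range by (metis imageE)
  qed
qed

section \<open>A divergent sequence adapted to a countable boundary\<close>

lemma infinite_dimensional_kernel:
  assumes inf: "infinite_dimensional V" and V: "subspace V" and f: "linear (f :: 'a::real_vector \<Rightarrow> real)"
  shows "infinite_dimensional {z \<in> V. f z = 0}"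
  unfolding infinite_dimensional_def
proof
  assume "\<exists>B. finite B \<and> {z \<in> V. f z = 0} \<subseteq> span B"
  then obtain B where B: "finite B" "{z \<in> V. f z = 0} \<subseteq> span B" by blast
  have "\<exists>B. finite B \<and> V \<subseteq> span B"
  proof (cases "\<exists>v\<in>V. f v \<noteq> 0")
    case True
    then obtain v where v: "v \<in> V" "f v \<noteq> 0" by blast
    have "z \<in> span (insert v B)" if z: "z \<in> V" for z
    proof -
      have "z - (f z / f v) *\<^sub>R v \<in> {z \<in> V. f z = 0}"
        using z v V by (auto simp: linear_diff[OF f] linear_scale[OF f] subspace_diff subspace_scale)
      then have "z - (f z / f v) *\<^sub>R v \<in> span B" using B(2) by blast
      then show ?thesis by (auto simp: span_breakdown_eq)
    qed
    then show ?thesis using B(1) by (intro exI[of _ "insert v B"]) auto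
  next
    case False
    then show ?thesis using B by blast
  qed
  then show False using inf by (simp add: infinite_dimensional_def)
qed

lemma infinite_dimensional_common_kernel:
  assumes inf: "infinite_dimensional (UNIV :: 'a::real_vector set)"
    and lin: "\<And>n :: nat. linear (h n :: 'a \<Rightarrow> real)"
  shows "\<exists>z. z \<noteq> 0 \<and> (\<forall>m<k. h m z = 0)"
proof -
  have "infinite_dimensional {z. \<forall>m<k. h m z = 0}" for k
  proof (induction k)
    case (Suc k)
    have "subspace {z. \<forall>m<k. h m z = 0}"
      by (auto simp: subspace_def linear_0[OF lin] linear_add[OF lin] linear_scale[OF lin])
    moreover have "{z. \<forall>m<Suc k. h m z = 0} = {z \<in> {z. \<forall>m<k. h m z = 0}. h k z = 0}"
      by (auto simp: less_Suc_eq)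
    ultimately show ?case using infinite_dimensional_kernel[OF Suc _ lin] by simp
  qed (use inf in simp)
  then have "\<not> {z. \<forall>m<k. h m z = 0} \<subseteq> span {}"
    unfolding infinite_dimensional_def by blast
  then show ?thesis by auto
qed

text \<open>Each \<open>h m\<close> annihilates all late even terms and is geometrically small on
  the odd ones, which gives summability. The even terms have norm 1 and the odd ones tend to 0, so
  there is no limit; the odd terms alone have dense span.\<close>

lemma separable_polyhedral_sequence:
  assumes sep: "separable_space (euclidean :: 'a::banach topology)"
    and iso: "iso_polyhedral (UNIV :: 'a set)"
  obtains x :: "nat \<Rightarrow> 'a::banach" and E where "\<not> convergent x" "iso_precisely_norming E"
    "closure (span (range x)) = UNIV" "\<And>f. f \<in> E \<Longrightarrow> summable (\<lambda>n. \<bar>f (x (Suc n) - x n)\<bar>)"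
proof -
  obtain N :: "'a \<Rightarrow> real" and c C h where N: "equivalent_norm N c C"
    and lin: "\<And>n :: nat. linear (h n)" and dom: "\<And>n x. \<bar>h n x\<bar> \<le> N x" and att: "\<And>x. \<exists>n. h n x = N x"
    by (rule separable_polyhedral_countable_boundary[OF sep iso]) (rule that)
  interpret equivalent_norm N c C by (rule N)
  obtain d :: "nat \<Rightarrow> 'a" where d: "closure (range d) = UNIV"
    using separable_space_dense_sequence[OF sep] by blast
  have inf: "infinite_dimensional (UNIV :: 'a set)"
    using iso by (auto simp: iso_polyhedral_def polyhedral_wrt_def)
  have "\<exists>z. norm z = 1 \<and> (\<forall>m<k. h m z = 0)" for k
  proof -
    obtain z where z: "z \<noteq> 0" "\<forall>m<k. h m z = 0"
      using infinite_dimensional_common_kernel[of h, OF inf lin] by blast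
    then show ?thesis
      by (intro exI[of _ "(1 / norm z) *\<^sub>R z"]) (simp add: linear_scale[OF lin])
  qed
  then obtain z where z: "\<And>k. norm (z k) = 1" "\<And>k m. m < k \<Longrightarrow> h m (z k) = 0" by metis
  \<comment> \<open>Dividing by \<open>1 + norm\<close> bounds the odd terms by
    \<open>(1/2) ^ n\<close> whatever the size of the dense vector, including 0.\<close>
  define x where "x n = (if even n then z (n div 2) else ((1/2) ^ n / (1 + norm (d (n div 2)))) *\<^sub>R d (n div 2))" for n
  have pos: "0 < 1 + norm v" for v :: 'a using norm_ge_zero[of v] by linarith
  have norm_odd: "norm (x n) \<le> (1/2) ^ n" if "odd n" for n
  proof -
    have "norm (d (n div 2)) / (1 + norm (d (n div 2))) \<le> 1" using pos[of "d (n div 2)"] by simp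
    then have "(1/2) ^ n * (norm (d (n div 2)) / (1 + norm (d (n div 2)))) \<le> (1/2) ^ n"
      by (intro mult_left_le) auto
    then show ?thesis using that pos[of "d (n div 2)"] by (simp add: x_def)
  qed
  have "\<not> convergent x"
  proof
    assume "convergent x"
    then obtain l where l: "x \<longlonglongrightarrow> l" by (auto simp: convergent_def)
    have "(\<lambda>n. x (2 * n)) \<longlonglongrightarrow> l" "(\<lambda>n. x (Suc (2 * n))) \<longlonglongrightarrow> l"
      using LIMSEQ_subseq_LIMSEQ[OF l, of "\<lambda>n. 2 * n"] LIMSEQ_subseq_LIMSEQ[OF l, of "\<lambda>n. Suc (2 * n)"]
      by (auto simp: strict_mono_def o_def)
    moreover have "(\<lambda>n. x (Suc (2 * n))) \<longlonglongrightarrow> 0"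
    proof (rule Lim_null_comparison)
      show "\<forall>\<^sub>F n in sequentially. norm (x (Suc (2 * n))) \<le> (1/2) ^ Suc (2 * n)"
        by (intro always_eventually allI norm_odd) simp
      show "(\<lambda>n. (1/2::real) ^ Suc (2 * n)) \<longlonglongrightarrow> 0"
        using LIMSEQ_subseq_LIMSEQ[OF LIMSEQ_power_zero[of "1/2::real"], of "\<lambda>n. Suc (2 * n)"]
        by (simp add: strict_mono_def o_def)
    qed
    ultimately have "(\<lambda>n. x (2 * n)) \<longlonglongrightarrow> 0" using LIMSEQ_unique by blast
    then have "(\<lambda>n. norm (x (2 * n))) \<longlonglongrightarrow> 0" by (rule tendsto_norm_zero)
    then show False by (simp add: x_def z LIMSEQ_const_iff)
  qed
  moreover have "iso_precisely_norming (range h)"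
  proof -
    have bdd: "bdd_above ((\<lambda>e. \<bar>e v\<bar>) ` range h)" for v
      by (rule bdd_aboveI[of _ "N v"]) (use dom in auto)
    have sup: "(SUP e\<in>range h. \<bar>e v\<bar>) = N v" for v
    proof (rule antisym)
      show "(SUP e\<in>range h. \<bar>e v\<bar>) \<le> N v" using dom by (intro cSUP_least) auto
      obtain n where "h n v = N v" using att by blast
      then show "N v \<le> (SUP e\<in>range h. \<bar>e v\<bar>)"
        using cSUP_upper[OF rangeI[of h n] bdd, of v] nonneg[of v] by simp
    qed
    define K where "K = max 1 (max C (1 / c))"
    have K: "1 \<le> K" "C \<le> K" "1 / c \<le> K" by (auto simp: K_def)
    show ?thesis
      unfolding iso_precisely_norming_def
    proof (intro exI[of _ K] conjI allI)
      show "range h \<subseteq> dual_ball K"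
      proof
        fix f assume "f \<in> range h"
        then obtain n where f: "f = h n" by blast
        have bound: "norm (f v) \<le> K * norm v" for v
        proof -
          have "\<bar>f v\<bar> \<le> C * norm v" using order_trans[OF dom upper] f by simp
          also have "\<dots> \<le> K * norm v" using K by (simp add: mult_right_mono)
          finally show ?thesis by simp
        qed
        have "bounded_linear f"
          using bound lin[of n] by (intro bounded_linear_intro[of _ K])
            (auto simp: f linear_add linear_scale mult.commute)
        then show "f \<in> dual_ball K"
          using onorm_bound[of K f] bound K by (simp add: dual_ball_def)
      qed
      fix v :: 'a
      have "norm v / K \<le> c * norm v"
      proof -
        have "1 \<le> K * c" using K(3) c_pos by (simp add: field_simps)
        then have "norm v * 1 \<le> norm v * (K * c)" by (intro mult_left_mono) auto
        then show ?thesis using K(1) by (simp add: field_simps)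
      qed
      then show "norm v / K \<le> (SUP e\<in>range h. \<bar>e v\<bar>)" using lower[of v] sup[of v] by linarith
      obtain n where "h n v = N v" using att by blast
      then show "\<exists>e0\<in>range h. \<bar>e0 v\<bar> = (SUP e\<in>range h. \<bar>e v\<bar>)"
        using sup nonneg[of v] by (intro bexI[of _ "h n"]) auto
    qed (fact K(1))
  qed
  moreover have "closure (span (range x)) = UNIV"
  proof -
    have "d k \<in> span (range x)" for k
    proof -
      define r where "r = (1/2) ^ Suc (2 * k) / (1 + norm (d k))"
      have "r \<noteq> 0" using pos[of "d k"] by (simp add: r_def)
      then have "d k = (1 / r) *\<^sub>R x (Suc (2 * k))" by (simp add: x_def r_def)
      then show ?thesis by (metis rangeI span_base span_scale)
    qed
    then have "range d \<subseteq> span (range x)" by blast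
    then show ?thesis using d closure_mono by blast
  qed
  moreover have "summable (\<lambda>n. \<bar>f (x (Suc n) - x n)\<bar>)" if f: "f \<in> range h" for f
  proof -
    obtain m where m: "f = h m" using f by blast
    \<comment> \<open>From \<open>2 * m + 2\<close> on, \<open>n div 2\<close> exceeds
      \<open>m\<close>, so \<open>h m\<close> vanishes on the even terms.\<close>
    have bound: "\<bar>f (x n)\<bar> \<le> C * (1/2) ^ n" if n: "2 * m + 2 \<le> n" for n
    proof (cases "even n")
      case True
      then have "f (x n) = 0" using n z(2)[of m "n div 2"] by (simp add: x_def m)
      then show ?thesis using C_pos by simp
    next
      case False
      have "\<bar>f (x n)\<bar> \<le> C * norm (x n)" using order_trans[OF dom upper] m by simp
      also have "\<dots> \<le> C * (1/2) ^ n" using norm_odd[OF False] C_pos by simp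
      finally show ?thesis .
    qed
    have "summable (\<lambda>n. 2 * C * (1/2::real) ^ n)"
      by (intro summable_mult summable_geometric) simp
    then show ?thesis
    proof (rule summable_comparison_test_ev[rotated])
      show "\<forall>\<^sub>F n in sequentially. norm \<bar>f (x (Suc n) - x n)\<bar> \<le> 2 * C * (1/2) ^ n"
        using eventually_ge_at_top[of "2 * m + 2"]
      proof eventually_elim
        case (elim n)
        have "\<bar>f (x (Suc n) - x n)\<bar> \<le> \<bar>f (x (Suc n))\<bar> + \<bar>f (x n)\<bar>"
          using linear_diff[OF lin] by (simp add: m)
        also have "\<dots> \<le> C * (1/2) ^ Suc n + C * (1/2) ^ n"
          using bound[of n] bound[of "Suc n"] elim by simp
        also have "\<dots> \<le> 2 * C * (1/2) ^ n"
          using C_pos by simp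
        finally show ?case by simp
      qed
    qed
  qed
  ultimately show thesis using that by blast
qed

section \<open>Norming families and Mazur's selection\<close>

text \<open>Bolzano-Weierstrass by induction on the generators. The induction hypothesis makes
  \<open>span B\<close> closed, so a new generator has a positive distance \<open>d\<close> from it,
  and its coefficients are bounded by \<open>M / d\<close>.\<close>

lemma span_finite_bounded_convergent_subsequence:
  fixes B :: "'a::real_normed_vector set"
  assumes "finite B" "\<And>n. s n \<in> span B" "\<And>n. norm (s n) \<le> M"
  shows "\<exists>l\<in>span B. \<exists>r :: nat \<Rightarrow> nat. strict_mono r \<and> (s \<circ> r) \<longlonglongrightarrow> l"
  using assms
proof (induction B arbitrary: s M rule: finite_induct)
  case empty
  then have "s = (\<lambda>n. 0)" by auto
  then show ?case by (intro bexI[of _ 0] exI[of _ id]) (auto simp: strict_mono_def)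
next
  case (insert b B)
  show ?case
  proof (cases "b \<in> span B")
    case True
    then have eq: "span (insert b B) = span B" by (rule span_redundant)
    show ?thesis unfolding eq by (rule insert.IH) (use insert.prems eq in auto)
  next
    case False
    have "closed (span B)"
      unfolding closed_sequential_limits
    proof (intro allI impI, elim conjE)
      fix u l assume u: "\<forall>n. u n \<in> span B" "u \<longlonglongrightarrow> l"
      then have "Bseq u" using convergentI convergent_imp_Bseq by blast
      then obtain M' where "\<And>n. norm (u n) \<le> M'" by (auto simp: Bseq_def)
      then have "\<exists>l'\<in>span B. \<exists>r :: nat \<Rightarrow> nat. strict_mono r \<and> (u \<circ> r) \<longlonglongrightarrow> l'"
        using u(1) by (intro insert.IH) auto
      then obtain l' r where l': "l' \<in> span B" "strict_mono (r :: nat \<Rightarrow> nat)" "(u \<circ> r) \<longlonglongrightarrow> l'" by blast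
      have "l' = l"
        using LIMSEQ_unique[OF l'(3) LIMSEQ_subseq_LIMSEQ[OF u(2) l'(2)]] .
      then show "l \<in> span B" using l' by simp
    qed
    then have "open (- span B)" by (rule open_Compl)
    then obtain d where d: "0 < d" "\<And>w. dist w b < d \<Longrightarrow> w \<notin> span B"
      using False unfolding open_dist by (metis ComplI ComplD)
    have "\<exists>t. s n - t *\<^sub>R b \<in> span B" for n
      using insert.prems(1)[of n] by (simp add: span_breakdown_eq)
    then obtain t where t: "\<And>n. s n - t n *\<^sub>R b \<in> span B" by metis
    have tb: "\<bar>t n\<bar> \<le> M / d" for n
    proof (cases "t n = 0")
      case True
      have "0 \<le> M" using insert.prems(2)[of n] norm_ge_zero order_trans by blast
      then show ?thesis using True d by simp
    next
      case False
      define w where "w = (- (1 / t n)) *\<^sub>R (s n - t n *\<^sub>R b)"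
      have "w \<in> span B" unfolding w_def using t by (rule span_scale)
      then have "d \<le> dist w b" using d(2)[of w] by fastforce
      moreover have "w - b = (- (1 / t n)) *\<^sub>R s n" using False by (simp add: w_def algebra_simps)
      ultimately have "d \<le> norm (s n) / \<bar>t n\<bar>" by (simp add: dist_norm)
      then have "\<bar>t n\<bar> * d \<le> norm (s n)" using False by (simp add: field_simps)
      also have "\<dots> \<le> M" by (rule insert.prems)
      finally show ?thesis using d(1) by (simp add: field_simps)
    qed
    have "t n \<in> cbox (- (M / d)) (M / d)" for n
      using tb[of n] unfolding cbox_interval atLeastAtMost_iff by linarith
    then obtain \<tau> r where r: "strict_mono (r :: nat \<Rightarrow> nat)" "(t \<circ> r) \<longlonglongrightarrow> \<tau>"
      using compact_cbox[of "- (M / d)" "M / d"] unfolding compact_def by metis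
    define w where "w n = s (r n) - t (r n) *\<^sub>R b" for n
    have "norm (w n) \<le> M + M / d * norm b" for n
    proof -
      have "norm (w n) \<le> norm (s (r n)) + \<bar>t (r n)\<bar> * norm b"
        unfolding w_def by (metis norm_scaleR norm_triangle_ineq4)
      also have "\<dots> \<le> M + M / d * norm b"
        by (intro add_mono mult_right_mono insert.prems tb) auto
      finally show ?thesis .
    qed
    moreover have "w n \<in> span B" for n unfolding w_def by (rule t)
    ultimately have "\<exists>l\<in>span B. \<exists>r :: nat \<Rightarrow> nat. strict_mono r \<and> (w \<circ> r) \<longlonglongrightarrow> l"
      by (intro insert.IH) auto
    then obtain l r' where l: "l \<in> span B" "strict_mono (r' :: nat \<Rightarrow> nat)" "(w \<circ> r') \<longlonglongrightarrow> l" by blast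
    have "(\<lambda>n. t (r (r' n))) \<longlonglongrightarrow> \<tau>"
      using LIMSEQ_subseq_LIMSEQ[OF r(2) l(2)] by (simp add: o_def)
    moreover have "(\<lambda>n. w (r' n)) \<longlonglongrightarrow> l" using l(3) by (simp add: o_def)
    ultimately have "(\<lambda>n. t (r (r' n)) *\<^sub>R b + w (r' n)) \<longlonglongrightarrow> \<tau> *\<^sub>R b + l"
      by (intro tendsto_intros)
    then have "(s \<circ> (r \<circ> r')) \<longlonglongrightarrow> \<tau> *\<^sub>R b + l" by (simp add: w_def o_def)
    moreover have "strict_mono (r \<circ> r')" using r(1) l(2) by (rule strict_mono_o)
    moreover have "\<tau> *\<^sub>R b + l \<in> span (insert b B)"
      using l(1) unfolding span_breakdown_eq by (intro exI[of _ \<tau>]) simp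
    ultimately show ?thesis by blast
  qed
qed

text \<open>Attainment is left to later locales, because Mazur's selection is also applied to a
  lifted family on the product with the reals, for which only the norming inequality is
  established.\<close>

locale norming_family =
  fixes E :: "('a::real_normed_vector \<Rightarrow> real) set" and c C :: real
  assumes E_linear: "e \<in> E \<Longrightarrow> linear e"
    and E_bound: "e \<in> E \<Longrightarrow> \<bar>e x\<bar> \<le> C * norm x"
    and E_nonempty: "E \<noteq> {}"
    and c_gt_0: "0 < c"
    and C_gt_0: "0 < C"
    and norming: "c * norm x \<le> (SUP e\<in>E. \<bar>e x\<bar>)"
begin

definition p :: "'a \<Rightarrow> real" where "p x = (SUP e\<in>E. \<bar>e x\<bar>)"

lemma E_le_p: "e \<in> E \<Longrightarrow> \<bar>e x\<bar> \<le> p x"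
  unfolding p_def by (rule cSUP_upper) (auto intro!: bdd_aboveI2[where M = "C * norm x"] E_bound)

lemma p_le: "(\<And>e. e \<in> E \<Longrightarrow> \<bar>e x\<bar> \<le> b) \<Longrightarrow> p x \<le> b"
  unfolding p_def by (rule cSUP_least[OF E_nonempty])

lemma less_p: "b < p x \<Longrightarrow> \<exists>e\<in>E. b < \<bar>e x\<bar>"
  using p_le[of x b] by (meson not_le)

sublocale equivalent_norm p c C
proof
  show "p (x + y) \<le> p x + p y" for x y
  proof (rule p_le)
    fix e assume e: "e \<in> E"
    show "\<bar>e (x + y)\<bar> \<le> p x + p y"
      using E_le_p[OF e, of x] E_le_p[OF e, of y] by (simp add: linear_add[OF E_linear[OF e]])
  qed
  have le: "p (a *\<^sub>R x) \<le> \<bar>a\<bar> * p x" for a x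
  proof (rule p_le)
    fix e assume e: "e \<in> E"
    show "\<bar>e (a *\<^sub>R x)\<bar> \<le> \<bar>a\<bar> * p x"
      using E_le_p[OF e, of x] by (simp add: linear_scale[OF E_linear[OF e]] abs_mult mult_left_mono)
  qed
  have 0: "0 \<le> p x" for x
    unfolding p_def using norming[of x] c_gt_0 by (meson mult_nonneg_nonneg norm_ge_zero order_trans less_imp_le)
  show "p (a *\<^sub>R x) = \<bar>a\<bar> * p x" for a x
  proof (cases "a = 0")
    case True
    then show ?thesis using le[of 0 x] 0[of 0] by simp
  next
    case False
    have "\<bar>a\<bar> * p x \<le> \<bar>a\<bar> * (\<bar>1 / a\<bar> * p (a *\<^sub>R x))"
      using le[of "1 / a" "a *\<^sub>R x"] False by (intro mult_left_mono) auto
    also have "\<dots> = p (a *\<^sub>R x)" using False by simp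
    finally show ?thesis using le[of a x] by simp
  qed
  show "c * norm x \<le> p x" for x unfolding p_def by (rule norming)
  show "p x \<le> C * norm x" for x by (rule p_le) (rule E_bound)
qed (rule c_gt_0 C_gt_0)+

lemma E_tendsto:
  assumes "e \<in> E" "s \<longlonglongrightarrow> l"
  shows "(\<lambda>n. e (s n)) \<longlonglongrightarrow> e l"
proof -
  have "bounded_linear e"
    using E_linear[OF assms(1)] E_bound[OF assms(1)]
    by (intro bounded_linear_intro[of _ C]) (auto simp: linear_add linear_scale mult.commute)
  then show ?thesis using assms(2) by (rule bounded_linear.tendsto)
qed

text \<open>If it failed for all large \<open>n\<close>, normalised vectors of \<open>span B\<close>
  would have a limit \<open>l\<close> of norm 1. A functional \<open>e\<close> with
  \<open>1 / a < \<bar>e l\<bar>\<close> tends to 0 on the added multiples of \<open>v\<close>, so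
  the sums could not all keep norm below \<open>1 / a\<close>.\<close>

lemma mazur_step:
  assumes B: "finite B" and null: "\<And>e. e \<in> E \<Longrightarrow> (\<lambda>n. e (v n)) \<longlonglongrightarrow> 0"
    and \<delta>: "0 < \<delta>" "\<And>n. \<delta> \<le> p (v n)" and a: "1 < a"
  shows "\<exists>n\<ge>m. \<forall>g\<in>span B. \<forall>t. p g \<le> a * p (g + t *\<^sub>R v n)"
proof (rule ccontr)
  assume "\<not> ?thesis"
  then have "\<exists>g t. g \<in> span B \<and> a * p (g + t *\<^sub>R v (n + m)) < p g" for n
    by (meson le_add2 not_le)
  then obtain g t where g: "\<And>n. g n \<in> span B" and lt: "\<And>n. a * p (g n + t n *\<^sub>R v (n + m)) < p (g n)"
    by metis
  have pos: "0 < p (g n)" for n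
  proof -
    have "0 \<le> a * p (g n + t n *\<^sub>R v (n + m))" using a by simp
    then show ?thesis using lt[of n] by linarith
  qed
  define G where "G n = (1 / p (g n)) *\<^sub>R g n" for n
  define T where "T n = t n / p (g n)" for n
  have G1: "p (G n) = 1" for n using pos[of n] by (simp add: G_def scaleR del: eq_0_iff)
  have GT: "p (G n + T n *\<^sub>R v (n + m)) < 1 / a" for n
  proof -
    have "G n + T n *\<^sub>R v (n + m) = (1 / p (g n)) *\<^sub>R (g n + t n *\<^sub>R v (n + m))"
      by (simp add: G_def T_def scaleR_add_right)
    then have "p (G n + T n *\<^sub>R v (n + m)) = p (g n + t n *\<^sub>R v (n + m)) / p (g n)"
      using pos[of n] by (simp add: scaleR del: eq_0_iff)
    then show ?thesis using lt[of n] pos[of n] a by (simp add: field_simps)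
  qed
  have "norm (G n) \<le> 1 / c" for n using lower[of "G n"] G1[of n] c_pos by (simp add: field_simps)
  moreover have "G n \<in> span B" for n unfolding G_def using g by (rule span_scale)
  ultimately obtain l r where l: "strict_mono (r :: nat \<Rightarrow> nat)" "(G \<circ> r) \<longlonglongrightarrow> l"
    using span_finite_bounded_convergent_subsequence[OF B, of G "1 / c"] by blast
  have "(\<lambda>n. p ((G \<circ> r) n)) \<longlonglongrightarrow> p l" using l(2) by (rule tendsto)
  then have "p l = 1" by (simp add: o_def G1 LIMSEQ_const_iff)
  then have "1 / a < p l" using a by simp
  then obtain e where e: "e \<in> E" "1 / a < \<bar>e l\<bar>" using less_p by blast
  note lin = E_linear[OF e(1)]
  \<comment> \<open>The lower bound on \<open>p (v n)\<close> is what keeps these coefficients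
    bounded.\<close>
  have T: "\<bar>T n\<bar> \<le> 2 / \<delta>" for n
  proof -
    have "\<bar>T n\<bar> * \<delta> \<le> \<bar>T n\<bar> * p (v (n + m))" using \<delta> by (intro mult_left_mono) auto
    also have "\<dots> = p (T n *\<^sub>R v (n + m))" by (simp add: scaleR)
    also have "\<dots> \<le> p (G n + T n *\<^sub>R v (n + m)) + p (G n)"
      using diff_triangle[of "G n + T n *\<^sub>R v (n + m)" "G n"] by simp
    also have "\<dots> \<le> 1 / a + 1" using GT[of n] G1[of n] by simp
    also have "\<dots> \<le> 2" using a by simp
    finally show ?thesis using \<delta>(1) by (simp add: field_simps)
  qed
  have "(\<lambda>n. T n * e (v (n + m))) \<longlonglongrightarrow> 0"
  proof (rule Lim_null_comparison)
    show "\<forall>\<^sub>F n in sequentially. norm (T n * e (v (n + m))) \<le> 2 / \<delta> * \<bar>e (v (n + m))\<bar>"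
      unfolding real_norm_def abs_mult by (intro always_eventually allI mult_right_mono T) simp
    have "(\<lambda>n. e (v (n + m))) \<longlonglongrightarrow> 0" using null[OF e(1)] by (rule LIMSEQ_ignore_initial_segment)
    then show "(\<lambda>n. 2 / \<delta> * \<bar>e (v (n + m))\<bar>) \<longlonglongrightarrow> 0"
      by (intro tendsto_mult_right_zero tendsto_rabs_zero)
  qed
  then have "(\<lambda>n. T (r n) * e (v (r n + m))) \<longlonglongrightarrow> 0"
    using LIMSEQ_subseq_LIMSEQ[OF _ l(1)] by (fastforce simp: o_def)
  moreover have "(\<lambda>n. e (G (r n))) \<longlonglongrightarrow> e l" using E_tendsto[OF e(1) l(2)] by (simp add: o_def)
  ultimately have "(\<lambda>n. e (G (r n)) + T (r n) * e (v (r n + m))) \<longlonglongrightarrow> e l + 0"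
    by (intro tendsto_add)
  then have "(\<lambda>n. \<bar>e (G (r n) + T (r n) *\<^sub>R v (r n + m))\<bar>) \<longlonglongrightarrow> \<bar>e l\<bar>"
    by (intro tendsto_rabs) (simp add: linear_add[OF lin] linear_scale[OF lin])
  then have "\<bar>e l\<bar> \<le> 1 / a"
  proof (rule LIMSEQ_le_const2)
    show "\<exists>N. \<forall>n\<ge>N. \<bar>e (G (r n) + T (r n) *\<^sub>R v (r n + m))\<bar> \<le> 1 / a"
      using E_le_p[OF e(1)] GT by (meson less_imp_le order_trans)
  qed
  then show False using e by simp
qed

text \<open>Mazur's construction of a basic sequence, started at a prescribed \<open>w\<close>: the
  partial-sum projections have norm at most 2.\<close>

lemma mazur_selection:
  assumes null: "\<And>e. e \<in> E \<Longrightarrow> (\<lambda>n. e (v n)) \<longlonglongrightarrow> 0"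
    and \<delta>: "0 < \<delta>" "\<And>n. \<delta> \<le> p (v n)"
  shows "\<exists>r :: nat \<Rightarrow> nat. strict_mono r \<and> (\<forall>s b k l. k \<le> l \<longrightarrow>
    p (s *\<^sub>R w + (\<Sum>i<k. b i *\<^sub>R v (r i))) \<le> 2 * p (s *\<^sub>R w + (\<Sum>i<l. b i *\<^sub>R v (r i))))"
proof -
  \<comment> \<open>The allowances \<open>q (Suc k) / q k\<close> exceed 1, and their products
    telescope to at most 2.\<close>
  define q :: "nat \<Rightarrow> real" where "q k = 2 - (1/2) ^ k" for k
  have q: "1 \<le> q k" "q k \<le> 2" "q k < q (Suc k)" for k
    using power_le_one[of "1/2::real" k] by (auto simp: q_def)
  have q_gt: "1 < q (Suc k) / q k" for k using q(1)[of k] q(3)[of k] by (simp add: field_simps)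
  \<comment> \<open>The state pairs the finite set of vectors already used with the index just
    chosen; the vector of that index joins the set in the next step.\<close>
  define P where "P k x \<longleftrightarrow> finite (fst x) \<and> w \<in> fst x \<and>
    (\<forall>g\<in>span (fst x). \<forall>t. p g \<le> q (Suc k) / q k * p (g + t *\<^sub>R v (snd x)))" for k and x :: "'a set \<times> nat"
  define Q where "Q x y \<longleftrightarrow> fst y = insert (v (snd x)) (fst x) \<and> snd x < snd y" for x y :: "'a set \<times> nat"
  have "\<exists>f. \<forall>n. P n (f n) \<and> Q (f n) (f (Suc n))"
  proof (rule dependent_nat_choice[where P = P and Q = "\<lambda>_. Q"])
    obtain n where "\<forall>g\<in>span {w}. \<forall>t. p g \<le> q (Suc 0) / q 0 * p (g + t *\<^sub>R v n)"
      using mazur_step[of "{w}" v \<delta>, OF _ null \<delta> q_gt[of 0], of 0] by auto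
    then have "P 0 ({w}, n)" by (simp add: P_def)
    then show "\<exists>x. P 0 x" by blast
    fix x k assume "P k x"
    then have fin: "finite (insert (v (snd x)) (fst x))" by (simp add: P_def)
    obtain n where n: "Suc (snd x) \<le> n"
      "\<forall>g\<in>span (insert (v (snd x)) (fst x)). \<forall>t. p g \<le> q (Suc (Suc k)) / q (Suc k) * p (g + t *\<^sub>R v n)"
      using mazur_step[of _ v \<delta>, OF fin null \<delta> q_gt[of "Suc k"], of "Suc (snd x)"] by blast
    then have "P (Suc k) (insert (v (snd x)) (fst x), n)"
      using \<open>P k x\<close> by (simp add: P_def)
    moreover have "Q x (insert (v (snd x)) (fst x), n)" using n by (simp add: Q_def)
    ultimately show "\<exists>y. P (Suc k) y \<and> Q x y" by blast
  qed
  then obtain f where f: "\<And>n. P n (f n)" "\<And>n. Q (f n) (f (Suc n))" by blast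
  define r where "r n = snd (f n)" for n
  have "strict_mono r"
    using f(2) by (intro strict_monoI_Suc) (simp add: r_def Q_def)
  have mem: "v (r i) \<in> fst (f k)" if "i < k" for i k
    using that
  proof (induction k)
    case (Suc k)
    then show ?case using f(2)[of k] by (cases "i = k") (auto simp: Q_def r_def)
  qed simp
  have "p (s *\<^sub>R w + (\<Sum>i<k. b i *\<^sub>R v (r i))) \<le> q l / q k * p (s *\<^sub>R w + (\<Sum>i<l. b i *\<^sub>R v (r i)))"
    if "k \<le> l" for s b k l
    using that
  proof (induction l rule: dec_induct)
    case base
    then show ?case using q(1)[of k] by simp
  next
    case (step l)
    have "s *\<^sub>R w + (\<Sum>i<l. b i *\<^sub>R v (r i)) \<in> span (fst (f l))"
      using f(1)[of l] mem by (intro span_add span_scale span_sum span_base) (auto simp: P_def)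
    then have "p (s *\<^sub>R w + (\<Sum>i<l. b i *\<^sub>R v (r i))) \<le>
        q (Suc l) / q l * p (s *\<^sub>R w + (\<Sum>i<l. b i *\<^sub>R v (r i)) + b l *\<^sub>R v (r l))"
      using f(1)[of l] by (simp add: P_def r_def)
    then have "q l / q k * p (s *\<^sub>R w + (\<Sum>i<l. b i *\<^sub>R v (r i))) \<le>
        q l / q k * (q (Suc l) / q l * p (s *\<^sub>R w + (\<Sum>i<l. b i *\<^sub>R v (r i)) + b l *\<^sub>R v (r l)))"
      using q(1)[of l] q(1)[of k] by (intro mult_left_mono) auto
    also have "\<dots> = q (Suc l) / q k * p (s *\<^sub>R w + (\<Sum>i<Suc l. b i *\<^sub>R v (r i)))"
      using q(1)[of l] by (simp add: add.assoc)
    finally show ?case using step.IH by linarith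
  qed
  moreover have "q l / q k \<le> 2" for k l
    using q(1)[of k] q(2)[of l] by (simp add: field_simps)
  ultimately have "p (s *\<^sub>R w + (\<Sum>i<k. b i *\<^sub>R v (r i))) \<le> 2 * p (s *\<^sub>R w + (\<Sum>i<l. b i *\<^sub>R v (r i)))"
    if "k \<le> l" for s b k l
    using that by (meson mult_right_mono nonneg order_trans)
  then show ?thesis using \<open>strict_mono r\<close> by blast
qed

end

section \<open>Extension of bounded functionals to the closure of a subspace\<close>

lemma subspace_closure:
  fixes S :: "'a::real_normed_vector set"
  assumes S: "subspace S"
  shows "subspace (closure S)"
  unfolding subspace_def
proof (intro conjI ballI allI)
  show "0 \<in> closure S" using subspace_0[OF S] closure_subset by blast
next
  fix x y assume "x \<in> closure S" "y \<in> closure S"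
  then obtain s t where "\<And>n. s n \<in> S" "s \<longlonglongrightarrow> x" "\<And>n. t n \<in> S" "t \<longlonglongrightarrow> y"
    unfolding closure_sequential by metis
  then have "(\<lambda>n. s n + t n) \<longlonglongrightarrow> x + y" "\<And>n. s n + t n \<in> S"
    using S by (auto intro: tendsto_add subspace_add)
  then show "x + y \<in> closure S" unfolding closure_sequential by (intro exI[of _ "\<lambda>n. s n + t n"]) simp
next
  fix a :: real and x assume "x \<in> closure S"
  then obtain s where "\<And>n. s n \<in> S" "s \<longlonglongrightarrow> x" unfolding closure_sequential by metis
  then have "(\<lambda>n. a *\<^sub>R s n) \<longlonglongrightarrow> a *\<^sub>R x" "\<And>n. a *\<^sub>R s n \<in> S"
    using S by (auto intro: tendsto_scaleR[OF tendsto_const] subspace_scale)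
  then show "a *\<^sub>R x \<in> closure S" unfolding closure_sequential by (intro exI[of _ "\<lambda>n. a *\<^sub>R s n"]) simp
qed

text \<open>Coordinates are first defined on a linear span, and uniform continuity carries them to
  the closed span, where the new norm is needed.\<close>

lemma bounded_functional_extends_to_closure:
  fixes f :: "'a::real_normed_vector \<Rightarrow> real"
  assumes S: "subspace S"
    and add: "\<And>x y. x \<in> S \<Longrightarrow> y \<in> S \<Longrightarrow> f (x + y) = f x + f y"
    and scale: "\<And>a x. x \<in> S \<Longrightarrow> f (a *\<^sub>R x) = a * f x"
    and bound: "\<And>x. x \<in> S \<Longrightarrow> \<bar>f x\<bar> \<le> K * norm x"
  shows "\<exists>g. (\<forall>x\<in>S. g x = f x) \<and> (\<forall>x\<in>closure S. \<forall>y\<in>closure S. g (x + y) = g x + g y) \<and>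
    (\<forall>a. \<forall>x\<in>closure S. g (a *\<^sub>R x) = a * g x) \<and> (\<forall>x\<in>closure S. \<bar>g x\<bar> \<le> K * norm x)"
proof -
  have diff: "f x - f y = f (x - y)" if "x \<in> S" "y \<in> S" for x y
    using add[of "x - y" y] that S by (simp add: subspace_diff)
  have "uniformly_continuous_on S f"
    unfolding uniformly_continuous_on_def
  proof (intro allI impI)
    fix e :: real assume "0 < e"
    show "\<exists>d>0. \<forall>x\<in>S. \<forall>y\<in>S. dist y x < d \<longrightarrow> dist (f y) (f x) < e"
    proof (intro exI[of _ "e / (\<bar>K\<bar> + 1)"] conjI ballI impI)
      show "0 < e / (\<bar>K\<bar> + 1)" using \<open>0 < e\<close> by simp
      fix x y assume xy: "x \<in> S" "y \<in> S" "dist y x < e / (\<bar>K\<bar> + 1)"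
      have "dist (f y) (f x) = \<bar>f (y - x)\<bar>" using diff xy by (simp add: dist_real_def)
      also have "\<dots> \<le> K * norm (y - x)" using xy S by (intro bound) (simp add: subspace_diff)
      also have "\<dots> \<le> (\<bar>K\<bar> + 1) * norm (y - x)" by (intro mult_right_mono) auto
      also have "\<dots> < e" using xy(3) by (simp add: dist_norm field_simps)
      finally show "dist (f y) (f x) < e" .
    qed
  qed
  then obtain g where g: "uniformly_continuous_on (closure S) g" "\<And>x. x \<in> S \<Longrightarrow> f x = g x"
    by (rule uniformly_continuous_on_extension_on_closure) blast
  have cont: "continuous_on (closure S) g" using g(1) by (rule uniformly_continuous_imp_continuous)
  have lim: "(\<lambda>n. f (s n)) \<longlonglongrightarrow> g x" if "\<And>n. s n \<in> S" "s \<longlonglongrightarrow> x" "x \<in> closure S" for s x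
  proof -
    have "(\<lambda>n. g (s n)) \<longlonglongrightarrow> g x"
      using cont that closure_subset[of S] unfolding continuous_on_sequentially by (auto simp: o_def)
    then show ?thesis using g(2) that(1) by simp
  qed
  have cl: "subspace (closure S)" using S by (rule subspace_closure)
  have "g (x + y) = g x + g y" if x: "x \<in> closure S" and y: "y \<in> closure S" for x y
  proof -
    obtain s t where s: "\<And>n. s n \<in> S" "s \<longlonglongrightarrow> x" and t: "\<And>n. t n \<in> S" "t \<longlonglongrightarrow> y"
      using x y unfolding closure_sequential by metis
    have "(\<lambda>n. f (s n + t n)) \<longlonglongrightarrow> g (x + y)"
      using s t x y S cl by (intro lim tendsto_add) (auto simp: subspace_add)
    then have "(\<lambda>n. f (s n) + f (t n)) \<longlonglongrightarrow> g (x + y)" using add s t by simp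
    moreover have "(\<lambda>n. f (s n) + f (t n)) \<longlonglongrightarrow> g x + g y"
      by (intro tendsto_add lim s t x y)
    ultimately show ?thesis by (rule LIMSEQ_unique)
  qed
  moreover have "g (a *\<^sub>R x) = a * g x" if x: "x \<in> closure S" for a x
  proof -
    obtain s where s: "\<And>n. s n \<in> S" "s \<longlonglongrightarrow> x" using x unfolding closure_sequential by metis
    have "(\<lambda>n. f (a *\<^sub>R s n)) \<longlonglongrightarrow> g (a *\<^sub>R x)"
      using s x S cl by (intro lim tendsto_scaleR tendsto_const) (auto simp: subspace_scale)
    then have "(\<lambda>n. a * f (s n)) \<longlonglongrightarrow> g (a *\<^sub>R x)" using scale s by simp
    moreover have "(\<lambda>n. a * f (s n)) \<longlonglongrightarrow> a * g x"
      by (intro tendsto_mult tendsto_const lim s x)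
    ultimately show ?thesis by (rule LIMSEQ_unique)
  qed
  moreover have "\<bar>g x\<bar> \<le> K * norm x" if x: "x \<in> closure S" for x
  proof -
    obtain s where s: "\<And>n. s n \<in> S" "s \<longlonglongrightarrow> x" using x unfolding closure_sequential by metis
    show ?thesis
    proof (rule LIMSEQ_le)
      show "(\<lambda>n. \<bar>f (s n)\<bar>) \<longlonglongrightarrow> \<bar>g x\<bar>" by (intro tendsto_rabs lim s x)
      show "(\<lambda>n. K * norm (s n)) \<longlonglongrightarrow> K * norm x" by (intro tendsto_intros s)
      show "\<exists>N. \<forall>n\<ge>N. \<bar>f (s n)\<bar> \<le> K * norm (s n)" using bound s by blast
    qed
  qed
  ultimately show ?thesis using g(2) by (intro exI[of _ g]) auto
qed

section \<open>Polyhedral renorming\<close>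

text \<open>An extreme point is determined by the functionals of modulus one at it and their signs.\<close>

lemma finite_extreme_points_of_finite_max:
  fixes \<psi> :: "'i \<Rightarrow> 'a::real_vector \<Rightarrow> real"
  assumes F: "subspace F" and A: "finite A"
    and add: "\<And>i x y. x \<in> F \<Longrightarrow> y \<in> F \<Longrightarrow> \<psi> i (x + y) = \<psi> i x + \<psi> i y"
    and scale: "\<And>i r x. x \<in> F \<Longrightarrow> \<psi> i (r *\<^sub>R x) = r * \<psi> i x"
    and ball: "\<And>x. x \<in> F \<Longrightarrow> N x \<le> 1 \<longleftrightarrow> (\<forall>i\<in>A. \<bar>\<psi> i x\<bar> \<le> 1)"
  shows "finite {p. p extreme_point_of {x \<in> F. N x \<le> (1::real)}}"
proof -
  define sgn' where "sgn' p i = (if i \<in> A \<and> \<bar>\<psi> i p\<bar> = 1 then \<psi> i p else 0)" for p i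
  have "finite {f. \<forall>i. (i \<in> A \<longrightarrow> f i \<in> {- 1, 0, 1::real}) \<and> (i \<notin> A \<longrightarrow> f i = 0)}"
    by (rule finite_set_of_finite_funs[OF A]) auto
  then have "finite (sgn' ` {p. p extreme_point_of {x \<in> F. N x \<le> 1}})"
    by (rule rev_finite_subset) (auto simp: sgn'_def)
  moreover have "inj_on sgn' {p. p extreme_point_of {x \<in> F. N x \<le> 1}}"
  proof (rule inj_onI, rule ccontr, simp)
    fix p q assume p: "p extreme_point_of {x \<in> F. N x \<le> 1}" and q: "q extreme_point_of {x \<in> F. N x \<le> 1}"
      and eq: "sgn' p = sgn' q" and "p \<noteq> q"
    have pF: "p \<in> F" "N p \<le> 1" and qF: "q \<in> F" using p q by (auto simp: extreme_point_of_def)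
    define d where "d = p - q"
    have dF: "d \<in> F" unfolding d_def using pF(1) qF F by (intro subspace_diff)
    have pd: "p = q + d" by (simp add: d_def)
    have le1: "\<bar>\<psi> i p\<bar> \<le> 1" if "i \<in> A" for i using ball[OF pF(1)] pF(2) that by blast
    \<comment> \<open>Equal signs make the constraints active at \<open>p\<close> vanish on
      \<open>d\<close>, while the inactive ones leave room. So \<open>p\<close> can be moved both
      ways along \<open>d\<close> inside the ball.\<close>
    have active: "\<psi> i d = 0" if "i \<in> A" "\<bar>\<psi> i p\<bar> = 1" for i
    proof -
      have "sgn' q i = \<psi> i p" using that fun_cong[OF eq, of i] by (simp add: sgn'_def)
      then have "\<psi> i q = \<psi> i p" using that by (auto simp: sgn'_def split: if_splits)
      then show ?thesis using add[OF qF dF, of i] pd by simp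
    qed
    have "\<forall>\<^sub>F t in at_right 0. \<forall>i\<in>A. \<bar>\<psi> i p\<bar> + t * \<bar>\<psi> i d\<bar> \<le> 1"
    proof (rule eventually_ball_finite[OF A], rule ballI)
      fix i assume i: "i \<in> A"
      show "\<forall>\<^sub>F t in at_right 0. \<bar>\<psi> i p\<bar> + t * \<bar>\<psi> i d\<bar> \<le> 1"
      proof (cases "\<bar>\<psi> i p\<bar> = 1")
        case True
        then show ?thesis using active[OF i] by simp
      next
        case False
        then have lt: "\<bar>\<psi> i p\<bar> < 1" using le1[OF i] by simp
        have "((\<lambda>t. \<bar>\<psi> i p\<bar> + t * \<bar>\<psi> i d\<bar>) \<longlongrightarrow> \<bar>\<psi> i p\<bar> + 0 * \<bar>\<psi> i d\<bar>) (at_right 0)"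
          by (intro tendsto_intros)
        then have "\<forall>\<^sub>F t in at_right 0. \<bar>\<psi> i p\<bar> + t * \<bar>\<psi> i d\<bar> < 1"
          using lt by (intro order_tendstoD(2)) auto
        then show ?thesis by (rule eventually_mono) simp
      qed
    qed
    moreover have "\<forall>\<^sub>F t::real in at_right 0. 0 < t" by (rule eventually_at_right_less)
    ultimately have "\<forall>\<^sub>F t in at_right 0. (\<forall>i\<in>A. \<bar>\<psi> i p\<bar> + t * \<bar>\<psi> i d\<bar> \<le> 1) \<and> 0 < t"
      by (rule eventually_conj)
    then obtain t where t: "\<And>i. i \<in> A \<Longrightarrow> \<bar>\<psi> i p\<bar> + t * \<bar>\<psi> i d\<bar> \<le> 1" "0 < t"
      using eventually_happens'[OF trivial_limit_at_right_real] by blast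
    have in_ball: "p + r *\<^sub>R d \<in> {x \<in> F. N x \<le> 1}" if r: "\<bar>r\<bar> = t" for r
    proof -
      have rF: "r *\<^sub>R d \<in> F" using F dF by (rule subspace_scale)
      have F': "p + r *\<^sub>R d \<in> F" using F pF(1) rF by (rule subspace_add)
      have "\<bar>\<psi> i (p + r *\<^sub>R d)\<bar> \<le> 1" if i: "i \<in> A" for i
      proof -
        have "\<bar>\<psi> i (p + r *\<^sub>R d)\<bar> = \<bar>\<psi> i p + r * \<psi> i d\<bar>" using add[OF pF(1) rF] scale[OF dF] by simp
        also have "\<dots> \<le> \<bar>\<psi> i p\<bar> + t * \<bar>\<psi> i d\<bar>"
          using abs_triangle_ineq[of "\<psi> i p" "r * \<psi> i d"] r by (simp add: abs_mult)
        finally show ?thesis using t(1)[OF i] by linarith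
      qed
      then show ?thesis using ball[OF F'] F' by blast
    qed
    have "p \<in> open_segment (p + (- t) *\<^sub>R d) (p + t *\<^sub>R d)"
      unfolding in_segment
    proof (intro conjI exI[of _ "1/2"])
      have "d \<noteq> 0" using \<open>p \<noteq> q\<close> by (simp add: d_def)
      then have "(- t) *\<^sub>R d \<noteq> t *\<^sub>R d" using t(2) unfolding scaleR_cancel_right by simp
      then show "p + (- t) *\<^sub>R d \<noteq> p + t *\<^sub>R d" by (simp only: add_left_cancel not_False_eq_True)
      show "p = (1 - 1 / 2) *\<^sub>R (p + (- t) *\<^sub>R d) + (1 / 2) *\<^sub>R (p + t *\<^sub>R d)"
      proof -
        have "(1 - 1 / 2) *\<^sub>R u + (1 / 2) *\<^sub>R v = (1 / 2 :: real) *\<^sub>R (u + v)" for u v :: 'a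
          by (simp add: scaleR_add_right)
        moreover have "(p + (- t) *\<^sub>R d) + (p + t *\<^sub>R d) = 2 *\<^sub>R p" by (simp add: scaleR_2)
        ultimately show ?thesis by simp
      qed
    qed auto
    moreover have "p \<notin> open_segment (p + (- t) *\<^sub>R d) (p + t *\<^sub>R d)"
      using p in_ball[of t] in_ball[of "- t"] t(2) unfolding extreme_point_of_def by auto
    ultimately show False by blast
  qed
  ultimately show ?thesis by (rule finite_imageD)
qed

text \<open>The gain from rounding: coordinatewise convergence becomes eventual equality in each
  coordinate.\<close>

lemma integer_multiples_eventually_const:
  assumes grid: "\<And>n. \<exists>j::int. x n = of_int j * \<eta>" and lim: "x \<longlonglongrightarrow> l" and \<eta>: "0 < (\<eta>::real)"
  shows "\<forall>\<^sub>F n in sequentially. x n = l"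
proof -
  obtain J where J: "\<And>n. J \<le> n \<Longrightarrow> \<bar>x n - l\<bar> < \<eta> / 2"
    using LIMSEQ_D[OF lim, of "\<eta> / 2"] \<eta> by auto
  have const: "x n = x J" if "J \<le> n" for n
  proof -
    obtain i j where ij: "x n = of_int i * \<eta>" "x J = of_int j * \<eta>" using grid by metis
    have "\<bar>x n - x J\<bar> < \<eta>" using J[OF that] J[of J] by linarith
    then have "\<bar>of_int (i - j)\<bar> * \<eta> < 1 * \<eta>" using ij \<eta> by (simp add: abs_mult flip: left_diff_distrib)
    then have "\<bar>of_int (i - j) :: real\<bar> < 1" using \<eta> by simp
    then have "i = j" by linarith
    then show ?thesis using ij by simp
  qed
  then have "\<forall>\<^sub>F n in sequentially. x n = x J" unfolding eventually_sequentially by blast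
  moreover from this have "x \<longlonglongrightarrow> x J" by (rule tendsto_eventually)
  then have "l = x J" using lim LIMSEQ_unique by blast
  ultimately show ?thesis by simp
qed

text \<open>Fatou's lemma for series: balls of l1 are closed under coordinatewise limits.\<close>

lemma summable_suminf_le_of_pointwise_limit:
  fixes f :: "nat \<Rightarrow> nat \<Rightarrow> real"
  assumes lim: "\<And>k. (\<lambda>j. f j k) \<longlonglongrightarrow> g k"
    and f: "\<And>j. summable (\<lambda>k. \<bar>f j k\<bar>)" "\<And>j. (\<Sum>k. \<bar>f j k\<bar>) \<le> B"
  shows "summable (\<lambda>k. \<bar>g k\<bar>)" "(\<Sum>k. \<bar>g k\<bar>) \<le> B"
proof -
  have part: "(\<Sum>k<n. \<bar>g k\<bar>) \<le> B" for n
  proof (rule LIMSEQ_le_const2)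
    show "(\<lambda>j. \<Sum>k<n. \<bar>f j k\<bar>) \<longlonglongrightarrow> (\<Sum>k<n. \<bar>g k\<bar>)"
      by (intro tendsto_sum tendsto_rabs lim)
    show "\<exists>N. \<forall>j\<ge>N. (\<Sum>k<n. \<bar>f j k\<bar>) \<le> B"
      using sum_le_suminf[OF f(1), of "{..<n}"] f(2) by (meson abs_ge_zero finite_lessThan order_trans)
  qed
  show s: "summable (\<lambda>k. \<bar>g k\<bar>)"
    by (rule summableI_nonneg_bounded[of _ B]) (use part in auto)
  show "(\<Sum>k. \<bar>g k\<bar>) \<le> B" using suminf_le_const[OF s part] .
qed

section \<open>Functionals as l1 sequences acting on null coordinates\<close>

definition truncate :: "nat \<Rightarrow> (nat \<Rightarrow> real) \<Rightarrow> nat \<Rightarrow> real" where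
  "truncate m g k = (if k < m then g k else 0)"

text \<open>The coordinates map \<open>Z\<close> boundedly into c0, and each functional of
  \<open>E\<close> acts on \<open>Z\<close> through the l1 sequence of its values on
  \<open>y\<close>. This allows functionals to be rounded and truncated inside l1.\<close>

locale boundary_coordinates = norming_family E c C
  for E :: "('a::real_normed_vector \<Rightarrow> real) set" and c C +
  fixes y :: "nat \<Rightarrow> 'a" and Z :: "'a set" and a :: "nat \<Rightarrow> 'a \<Rightarrow> real" and L :: real
  assumes attained: "\<exists>e\<in>E. \<bar>e x\<bar> = p x"
    and Z: "subspace Z"
    and a_add: "u \<in> Z \<Longrightarrow> v \<in> Z \<Longrightarrow> a k (u + v) = a k u + a k v"
    and a_scale: "u \<in> Z \<Longrightarrow> a k (r *\<^sub>R u) = r * a k u"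
    and L: "1 \<le> L"
    and a_bound: "z \<in> Z \<Longrightarrow> \<bar>a k z\<bar> \<le> L * p z"
    and a_null: "z \<in> Z \<Longrightarrow> (\<lambda>k. a k z) \<longlonglongrightarrow> 0"
    and E_summable: "e \<in> E \<Longrightarrow> summable (\<lambda>k. \<bar>e (y k)\<bar>)"
    and E_expand: "e \<in> E \<Longrightarrow> z \<in> Z \<Longrightarrow> (\<Sum>k. e (y k) * a k z) = e z"
begin

definition ev :: "(nat \<Rightarrow> real) \<Rightarrow> 'a \<Rightarrow> real" where
  "ev h z = (\<Sum>k. h k * a k z)"

abbreviation mass :: "(nat \<Rightarrow> real) \<Rightarrow> real" where
  "mass h \<equiv> (\<Sum>k. \<bar>h k\<bar>)"

lemma mass_nonneg: "summable (\<lambda>k. \<bar>h k\<bar>) \<Longrightarrow> 0 \<le> mass h"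
  by (simp add: suminf_nonneg)

lemma ev_summable:
  assumes "summable (\<lambda>k. \<bar>h k\<bar>)" "z \<in> Z"
  shows "summable (\<lambda>k. h k * a k z)"
proof (rule summable_comparison_test'[of "\<lambda>k. L * p z * \<bar>h k\<bar>" 0])
  show "summable (\<lambda>k. L * p z * \<bar>h k\<bar>)" using assms(1) by (rule summable_mult)
  show "norm (h k * a k z) \<le> L * p z * \<bar>h k\<bar>" for k
    using mult_right_mono[OF a_bound[OF assms(2), of k], of "\<bar>h k\<bar>"] by (simp add: abs_mult mult.commute)
qed

lemma abs_ev_le:
  assumes h: "summable (\<lambda>k. \<bar>h k\<bar>)" and z: "z \<in> Z" and s: "\<And>k. h k \<noteq> 0 \<Longrightarrow> \<bar>a k z\<bar> \<le> s"
  shows "\<bar>ev h z\<bar> \<le> s * mass h"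
proof -
  have le: "\<bar>h k * a k z\<bar> \<le> s * \<bar>h k\<bar>" for k
    using mult_right_mono[OF s[of k], of "\<bar>h k\<bar>"] by (cases "h k = 0") (auto simp: abs_mult mult.commute)
  have "summable (\<lambda>k. s * \<bar>h k\<bar>)" using h by (rule summable_mult)
  then have "summable (\<lambda>k. \<bar>h k * a k z\<bar>)"
    by (rule summable_comparison_test'[of _ 0]) (use le in simp)
  then have "\<bar>ev h z\<bar> \<le> (\<Sum>k. \<bar>h k * a k z\<bar>)" unfolding ev_def by (rule summable_rabs)
  also have "\<dots> \<le> (\<Sum>k. s * \<bar>h k\<bar>)" by (intro suminf_le le) fact+
  also have "\<dots> = s * mass h" using h by (rule suminf_mult)
  finally show ?thesis .
qed

lemma abs_ev_le_p:
  assumes "summable (\<lambda>k. \<bar>h k\<bar>)" "z \<in> Z"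
  shows "\<bar>ev h z\<bar> \<le> L * p z * mass h"
  by (rule abs_ev_le[OF assms a_bound[OF assms(2)]])

lemma ev_add_coeffs:
  assumes "summable (\<lambda>k. \<bar>g k\<bar>)" "summable (\<lambda>k. \<bar>h k\<bar>)" "z \<in> Z"
  shows "ev (\<lambda>k. g k + h k) z = ev g z + ev h z"
  unfolding ev_def using suminf_add[OF ev_summable[OF assms(1,3)] ev_summable[OF assms(2,3)]]
  by (simp add: distrib_right)

lemma ev_diff_coeffs:
  assumes "summable (\<lambda>k. \<bar>g k\<bar>)" "summable (\<lambda>k. \<bar>h k\<bar>)" "z \<in> Z"
  shows "ev (\<lambda>k. g k - h k) z = ev g z - ev h z"
  unfolding ev_def using suminf_diff[OF ev_summable[OF assms(1,3)] ev_summable[OF assms(2,3)]]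
  by (simp add: left_diff_distrib)

lemma ev_add:
  assumes "summable (\<lambda>k. \<bar>h k\<bar>)" "u \<in> Z" "v \<in> Z"
  shows "ev h (u + v) = ev h u + ev h v"
  unfolding ev_def using suminf_add[OF ev_summable[OF assms(1,2)] ev_summable[OF assms(1,3)]] assms
  by (simp add: a_add distrib_left)

lemma ev_scale:
  assumes "summable (\<lambda>k. \<bar>h k\<bar>)" "u \<in> Z"
  shows "ev h (r *\<^sub>R u) = r * ev h u"
  unfolding ev_def using suminf_mult[OF ev_summable[OF assms], of r] assms(2)
  by (simp add: a_scale mult.left_commute)

lemma summable_diff_abs:
  assumes "summable (\<lambda>k. \<bar>g k\<bar>)" "summable (\<lambda>k. \<bar>h k\<bar>)"
  shows "summable (\<lambda>k. \<bar>g k - h k :: real\<bar>)" "mass (\<lambda>k. g k - h k) \<le> mass g + mass h"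
proof -
  have s: "summable (\<lambda>k. \<bar>g k\<bar> + \<bar>h k\<bar>)" using assms by (rule summable_add)
  show 1: "summable (\<lambda>k. \<bar>g k - h k\<bar>)"
    by (rule summable_comparison_test'[OF s, of 0]) (simp add: abs_triangle_ineq4)
  have "mass (\<lambda>k. g k - h k) \<le> (\<Sum>k. \<bar>g k\<bar> + \<bar>h k\<bar>)"
    by (intro suminf_le 1 s abs_triangle_ineq4)
  also have "\<dots> = mass g + mass h" using suminf_add[OF assms] by simp
  finally show "mass (\<lambda>k. g k - h k) \<le> mass g + mass h" .
qed

text \<open>Bounded coordinatewise convergence in l1 is weak-star convergence against c0: a finite
  block converges, and the tail meets only small coordinates of \<open>z\<close>.\<close>

lemma ev_tendsto:
  assumes lim: "\<And>k. (\<lambda>j. f j k) \<longlonglongrightarrow> g k"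
    and f: "\<And>j. summable (\<lambda>k. \<bar>f j k\<bar>)" "\<And>j. mass (f j) \<le> B" and z: "z \<in> Z"
  shows "(\<lambda>j. ev (f j) z) \<longlonglongrightarrow> ev g z"
proof (rule LIMSEQ_I)
  fix \<epsilon> :: real assume \<epsilon>: "0 < \<epsilon>"
  note g = summable_suminf_le_of_pointwise_limit[OF lim f]
  have B: "0 \<le> B" using mass_nonneg[OF f(1)] f(2) by (meson order_trans)
  \<comment> \<open>The difference of \<open>f j\<close> and \<open>g\<close> has mass at most
    \<open>2 * B\<close>, so a tail meeting coordinates below \<open>s\<close> contributes less than
    half of \<open>\<epsilon>\<close>; the summand 1 covers \<open>B = 0\<close>.\<close>
  define s where "s = \<epsilon> / (4 * (B + 1))"
  have s: "0 < s" using \<epsilon> B by (simp add: s_def)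
  have sB: "s * (2 * B) < \<epsilon> / 2"
  proof -
    have "s * (2 * B) < s * (2 * (B + 1))" using s by simp
    also have "\<dots> = \<epsilon> / 2" using B by (simp add: s_def field_simps)
    finally show ?thesis .
  qed
  obtain m where m: "\<And>k. m \<le> k \<Longrightarrow> \<bar>a k z\<bar> < s"
    using LIMSEQ_D[OF a_null[OF z] s] by auto
  have fin: "(\<lambda>j. \<Sum>k<m. f j k * a k z) \<longlonglongrightarrow> (\<Sum>k<m. g k * a k z)"
    by (intro tendsto_intros lim)
  then obtain J where J: "\<And>j. J \<le> j \<Longrightarrow> \<bar>(\<Sum>k<m. f j k * a k z) - (\<Sum>k<m. g k * a k z)\<bar> < \<epsilon> / 2"
    using LIMSEQ_D[OF fin, of "\<epsilon> / 2"] \<epsilon> by auto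
  have "\<bar>ev (f j) z - ev g z\<bar> < \<epsilon>" if j: "J \<le> j" for j
  proof -
    define d where "d k = f j k - g k" for k
    have d: "summable (\<lambda>k. \<bar>d k\<bar>)" "mass d \<le> 2 * B"
      using summable_diff_abs[OF f(1) g(1), of j] f(2)[of j] g(2) unfolding d_def by linarith+
    define d1 where "d1 = truncate m d"
    define d2 where "d2 k = d k - d1 k" for k
    have le2: "\<bar>d2 k\<bar> \<le> \<bar>d k\<bar>" for k by (simp add: d2_def d1_def truncate_def)
    have s2: "summable (\<lambda>k. \<bar>d2 k\<bar>)"
      by (rule summable_comparison_test'[OF d(1), of 0]) (simp add: le2)
    have "mass d2 \<le> 2 * B" using suminf_le[OF le2 s2 d(1)] d(2) by linarith
    have s1: "summable (\<lambda>k. \<bar>d1 k\<bar>)"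
      by (rule summable_finite[of "{..<m}"]) (auto simp: d1_def truncate_def)
    have "ev d1 z = (\<Sum>k<m. d k * a k z)"
      unfolding ev_def by (subst suminf_finite[of "{..<m}"]) (auto simp: d1_def truncate_def)
    then have 1: "\<bar>ev d1 z\<bar> < \<epsilon> / 2"
      using J[OF j] by (simp add: d_def left_diff_distrib sum_subtractf)
    have "\<bar>ev d2 z\<bar> \<le> s * mass d2"
    proof (rule abs_ev_le[OF s2 z])
      fix k assume "d2 k \<noteq> 0"
      then have "m \<le> k" by (auto simp: d2_def d1_def truncate_def split: if_splits)
      then show "\<bar>a k z\<bar> \<le> s" using m by (simp add: less_imp_le)
    qed
    also have "\<dots> \<le> s * (2 * B)" using \<open>mass d2 \<le> 2 * B\<close> s by (intro mult_left_mono) auto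
    finally have 2: "\<bar>ev d2 z\<bar> < \<epsilon> / 2" using sB by linarith
    have "d = (\<lambda>k. d1 k + d2 k)" by (simp add: d2_def)
    then have "ev d z = ev d1 z + ev d2 z" using ev_add_coeffs[OF s1 s2 z] by simp
    moreover have "ev d z = ev (f j) z - ev g z" unfolding d_def by (rule ev_diff_coeffs[OF f(1) g(1) z])
    ultimately show ?thesis using 1 2 by linarith
  qed
  then show "\<exists>no. \<forall>n\<ge>no. norm (ev (f n) z - ev g z) < \<epsilon>" by auto
qed

end

section \<open>The weighted norm\<close>

context boundary_coordinates
begin

definition \<theta> :: "nat \<Rightarrow> real" where "\<theta> n = (1/2) ^ n"
text \<open>Coordinates are bounded by \<open>L * p z\<close>, so a change of mass
  \<open>\<delta> n\<close> moves the value at \<open>z\<close> by at most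
  \<open>\<theta> n / 8\<close> times \<open>p z\<close>. Rounding and truncating each cost this
  once, a quarter of \<open>\<theta> n\<close> together. The steps \<open>mesh n k\<close> sum to
  \<open>\<delta> n\<close>.\<close>

definition \<delta> :: "nat \<Rightarrow> real" where "\<delta> n = \<theta> n / (8 * L)"
definition mesh :: "nat \<Rightarrow> nat \<Rightarrow> real" where "mesh n k = \<delta> n * (1/2) ^ Suc k"

definition level :: "nat \<Rightarrow> (nat \<Rightarrow> real) set" where
  "level n = {f. summable (\<lambda>k. \<bar>f k\<bar>) \<and> mass f \<le> real n \<and> (\<forall>z\<in>Z. \<bar>ev f z\<bar> \<le> p z)}"

text \<open>Closeness to some element of the level is required instead of a chosen rounding of each
  one; this property survives coordinatewise limits.\<close>

definition grid :: "nat \<Rightarrow> (nat \<Rightarrow> real) set" where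
  "grid n = {g. (\<forall>k. \<exists>j::int. g k = of_int j * mesh n k) \<and> (\<exists>f\<in>level n. \<forall>k. \<bar>g k - f k\<bar> \<le> mesh n k)}"

text \<open>Finite supports leave finitely many candidates once level and support are
  bounded.\<close>

definition finite_grid :: "nat \<Rightarrow> (nat \<Rightarrow> real) set" where
  "finite_grid n = {truncate m g | m g. g \<in> grid n \<and> mass (\<lambda>k. g k - truncate m g k) \<le> \<delta> n}"

text \<open>Masses in \<open>finite_grid n\<close> are at most \<open>n + 1\<close>, so there the
  weight lies between \<open>1 + \<theta> n\<close> and \<open>1 + 2 * \<theta> n\<close>. Each unit
  of mass removed earns \<open>\<theta> n / (n + 1)\<close>.\<close>

definition weight :: "nat \<Rightarrow> (nat \<Rightarrow> real) \<Rightarrow> real" where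
  "weight n h = 1 + \<theta> n * (2 - mass h / (real n + 1))"

definition index :: "(nat \<times> (nat \<Rightarrow> real)) set" where
  "index = (SIGMA n:UNIV. finite_grid n)"

definition val :: "nat \<times> (nat \<Rightarrow> real) \<Rightarrow> 'a \<Rightarrow> real" where
  "val i z = weight (fst i) (snd i) * \<bar>ev (snd i) z\<bar>"

definition q :: "'a \<Rightarrow> real" where "q z = (SUP i\<in>index. val i z)"

lemma \<theta>: "0 < \<theta> n" "\<theta> n \<le> 1" by (simp_all add: \<theta>_def power_le_one)

lemma \<delta>: "0 < \<delta> n" "\<delta> n \<le> 1" "L * \<delta> n = \<theta> n / 8"
proof -
  show "0 < \<delta> n" "L * \<delta> n = \<theta> n / 8" using \<theta>[of n] L by (auto simp: \<delta>_def)
  show "\<delta> n \<le> 1" using \<theta>[of n] L by (simp add: \<delta>_def)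
qed

lemma mesh_pos: "0 < mesh n k" using \<delta> by (simp add: mesh_def)

lemma mesh_sums: "mesh n sums \<delta> n"
  unfolding mesh_def using sums_mult[OF power_half_series, of "\<delta> n"] by simp

lemma truncate_summable: "summable (\<lambda>k. \<bar>truncate m g k\<bar>)"
  by (rule summable_finite[of "{..<m}"]) (auto simp: truncate_def)

lemma near_level:
  assumes "f \<in> level n" "\<And>k. \<bar>g k - f k\<bar> \<le> mesh n k"
  shows "summable (\<lambda>k. \<bar>g k - f k\<bar>)" "mass (\<lambda>k. g k - f k) \<le> \<delta> n"
    "summable (\<lambda>k. \<bar>g k\<bar>)" "mass g \<le> real n + \<delta> n"
    "z \<in> Z \<Longrightarrow> \<bar>ev g z - ev f z\<bar> \<le> \<theta> n / 8 * p z"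
proof -
  have f: "summable (\<lambda>k. \<bar>f k\<bar>)" "mass f \<le> real n" using assms(1) by (auto simp: level_def)
  note mesh = sums_summable[OF mesh_sums, of n] sums_unique[OF mesh_sums, of n]
  show d: "summable (\<lambda>k. \<bar>g k - f k\<bar>)"
    by (rule summable_comparison_test'[OF mesh(1), of 0]) (use assms(2) in simp)
  show md: "mass (\<lambda>k. g k - f k) \<le> \<delta> n"
    unfolding mesh(2) by (intro suminf_le assms d mesh)
  have gs: "summable (\<lambda>k. \<bar>g k - f k\<bar> + \<bar>f k\<bar>)" using d f(1) by (rule summable_add)
  show g: "summable (\<lambda>k. \<bar>g k\<bar>)"
    by (rule summable_comparison_test'[OF gs, of 0]) simp
  have "mass g \<le> (\<Sum>k. \<bar>g k - f k\<bar> + \<bar>f k\<bar>)" by (intro suminf_le g gs) simp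
  also have "\<dots> = mass (\<lambda>k. g k - f k) + mass f" using suminf_add[OF d f(1)] by simp
  finally show "mass g \<le> real n + \<delta> n" using md f(2) by linarith
  assume z: "z \<in> Z"
  have "\<bar>ev g z - ev f z\<bar> = \<bar>ev (\<lambda>k. g k - f k) z\<bar>" using ev_diff_coeffs[OF g f(1) z] by simp
  also have "\<dots> \<le> L * p z * mass (\<lambda>k. g k - f k)" using d z by (rule abs_ev_le_p)
  also have "\<dots> \<le> L * p z * \<delta> n" using md L by (intro mult_left_mono) auto
  also have "\<dots> = \<theta> n / 8 * p z" using \<delta>(3)[of n] by (simp add: mult.commute mult.left_commute)
  finally show "\<bar>ev g z - ev f z\<bar> \<le> \<theta> n / 8 * p z" .
qed

lemma grid_summable: "g \<in> grid n \<Longrightarrow> summable (\<lambda>k. \<bar>g k\<bar>)"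
  unfolding grid_def using near_level(3) by blast

lemma truncate_mass_le:
  assumes "summable (\<lambda>k. \<bar>g k\<bar>)"
  shows "mass (truncate m g) \<le> mass g"
  by (intro suminf_le truncate_summable assms) (simp add: truncate_def)

lemma tail_summable:
  assumes "summable (\<lambda>k. \<bar>g k\<bar>)"
  shows "summable (\<lambda>k. \<bar>g k - truncate m g k\<bar>)"
  by (rule summable_comparison_test'[OF assms, of 0]) (simp add: truncate_def)

lemma tail_tendsto_0:
  assumes "summable (\<lambda>k. \<bar>g k\<bar>)"
  shows "(\<lambda>m. mass (\<lambda>k. g k - truncate m g k)) \<longlonglongrightarrow> 0"
proof -
  have "mass (\<lambda>k. g k - truncate m g k) = mass g - (\<Sum>k<m. \<bar>g k\<bar>)" for m
  proof -
    have "mass (\<lambda>k. g k - truncate m g k) = (\<Sum>k. \<bar>g (k + m)\<bar>) + (\<Sum>k<m. \<bar>g k - truncate m g k\<bar>)"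
      using suminf_split_initial_segment[OF tail_summable[OF assms, of m], of m] by (simp add: truncate_def)
    also have "\<dots> = (\<Sum>k. \<bar>g (k + m)\<bar>)" by (simp add: truncate_def)
    finally show ?thesis using suminf_split_initial_segment[OF assms, of m] by simp
  qed
  moreover have "(\<lambda>m. mass g - (\<Sum>k<m. \<bar>g k\<bar>)) \<longlonglongrightarrow> mass g - mass g"
    by (intro tendsto_diff tendsto_const summable_LIMSEQ assms)
  ultimately show ?thesis by simp
qed

lemma finite_grid_props:
  assumes "h \<in> finite_grid n"
  shows "summable (\<lambda>k. \<bar>h k\<bar>)" "mass h \<le> real n + 1" "z \<in> Z \<Longrightarrow> \<bar>ev h z\<bar> \<le> (1 + \<theta> n / 4) * p z"
proof -
  obtain m g where g: "h = truncate m g" "g \<in> grid n" "mass (\<lambda>k. g k - truncate m g k) \<le> \<delta> n"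
    using assms unfolding finite_grid_def by blast
  obtain f where f: "f \<in> level n" "\<And>k. \<bar>g k - f k\<bar> \<le> mesh n k" using g(2) unfolding grid_def by blast
  note gf = near_level[OF f]
  show h: "summable (\<lambda>k. \<bar>h k\<bar>)" unfolding g(1) by (rule truncate_summable)
  show "mass h \<le> real n + 1"
    using truncate_mass_le[OF gf(3), of m] gf(4) \<delta>(2)[of n] by (simp add: g(1))
  assume z: "z \<in> Z"
  have t: "summable (\<lambda>k. \<bar>g k - h k\<bar>)" unfolding g(1) by (rule tail_summable[OF gf(3)])
  have "\<bar>ev g z - ev h z\<bar> = \<bar>ev (\<lambda>k. g k - h k) z\<bar>" using ev_diff_coeffs[OF gf(3) h z] by simp
  also have "\<dots> \<le> L * p z * mass (\<lambda>k. g k - h k)" using t z by (rule abs_ev_le_p)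
  also have "\<dots> \<le> L * p z * \<delta> n" using g(3) L by (intro mult_left_mono) (auto simp: g(1))
  also have "\<dots> = \<theta> n / 8 * p z" using \<delta>(3)[of n] by (simp add: mult.commute mult.left_commute)
  finally have "\<bar>ev g z - ev h z\<bar> \<le> \<theta> n / 8 * p z" .
  moreover have "\<bar>ev f z\<bar> \<le> p z" using f(1) z by (simp add: level_def)
  ultimately have "\<bar>ev h z\<bar> \<le> \<theta> n / 8 * p z + (\<theta> n / 8 * p z + p z)"
    using gf(5)[OF z] by linarith
  then show "\<bar>ev h z\<bar> \<le> (1 + \<theta> n / 4) * p z" by (simp add: algebra_simps)
qed

lemma weight_bounds:
  assumes "h \<in> finite_grid n"
  shows "1 + \<theta> n \<le> weight n h" "weight n h \<le> 1 + 2 * \<theta> n" "weight n h \<le> 3"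
proof -
  have m: "0 \<le> mass h / (real n + 1)" "mass h / (real n + 1) \<le> 1"
    using finite_grid_props(1,2)[OF assms] mass_nonneg by auto
  have "\<theta> n * 1 \<le> \<theta> n * (2 - mass h / (real n + 1))"
    using m \<theta>(1)[of n] by (intro mult_left_mono) auto
  then show "1 + \<theta> n \<le> weight n h" by (simp add: weight_def)
  have "\<theta> n * (2 - mass h / (real n + 1)) \<le> \<theta> n * 2"
    using m \<theta>(1)[of n] by (intro mult_left_mono) auto
  then show "weight n h \<le> 1 + 2 * \<theta> n" by (simp add: weight_def)
  then show "weight n h \<le> 3" using \<theta>(2)[of n] by linarith
qed

lemma val_nonneg: "i \<in> index \<Longrightarrow> 0 \<le> val i z"
  unfolding val_def index_def using weight_bounds(1)[of "snd i" "fst i"] \<theta>(1)[of "fst i"]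
  by (intro mult_nonneg_nonneg) auto

text \<open>The weight is at most \<open>1 + 2 * \<theta> n\<close> and the rounded functional
  exceeds \<open>p\<close> by a factor of at most \<open>1 + \<theta> n / 4\<close>. The excess of
  level \<open>n\<close> over the old norm thus tends to 0.\<close>

lemma val_le:
  assumes i: "i \<in> index" and z: "z \<in> Z"
  shows "val i z \<le> (1 + 3 * \<theta> (fst i)) * p z"
proof -
  define t where "t = \<theta> (fst i)"
  have t: "0 < t" "t \<le> 1" using \<theta> by (auto simp: t_def)
  have h: "snd i \<in> finite_grid (fst i)" using i by (auto simp: index_def)
  have "val i z \<le> (1 + 2 * t) * ((1 + t / 4) * p z)"
    unfolding val_def t_def using weight_bounds[OF h] finite_grid_props(3)[OF h z] \<theta>(1)[of "fst i"]
    by (intro mult_mono) auto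
  also have "\<dots> = (1 + 9/4 * t + t * t / 2) * p z" by (simp add: field_simps)
  also have "\<dots> \<le> (1 + 3 * t) * p z"
  proof (intro mult_right_mono nonneg)
    have "t * t \<le> t * 1" using t by (intro mult_left_mono) auto
    then show "1 + 9/4 * t + t * t / 2 \<le> 1 + 3 * t" using t by linarith
  qed
  finally show ?thesis by (simp add: t_def)
qed

lemma val_le_4p:
  assumes "i \<in> index" "z \<in> Z"
  shows "val i z \<le> 4 * p z"
proof -
  have "(1 + 3 * \<theta> (fst i)) * p z \<le> 4 * p z" using \<theta>(2)[of "fst i"] by (intro mult_right_mono) auto
  then show ?thesis using val_le[OF assms] by linarith
qed

lemma zero_in_index: "(0, \<lambda>_. 0) \<in> index"
proof -
  have "(\<lambda>_. 0) \<in> level 0" by (simp add: level_def ev_def)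
  then have "(\<lambda>_. 0) \<in> grid 0"
    unfolding grid_def using mesh_pos[of 0] by (auto intro!: exI[of _ 0] bexI[of _ "\<lambda>_. 0"] simp: less_imp_le)
  then have "truncate 0 (\<lambda>_. 0) \<in> finite_grid 0"
    unfolding finite_grid_def using \<delta>(1)[of 0] by (auto simp: truncate_def intro!: exI[of _ 0] exI[of _ "\<lambda>_. 0"])
  moreover have "truncate 0 (\<lambda>_. 0) = (\<lambda>_. 0)" by (simp add: truncate_def fun_eq_iff)
  ultimately show ?thesis by (simp add: index_def)
qed

lemma val_le_q: "i \<in> index \<Longrightarrow> z \<in> Z \<Longrightarrow> val i z \<le> q z"
  unfolding q_def by (rule cSUP_upper) (auto intro!: bdd_aboveI2[where M = "4 * p z"] val_le_4p)

lemma q_le: "(\<And>i. i \<in> index \<Longrightarrow> val i z \<le> b) \<Longrightarrow> q z \<le> b"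
  unfolding q_def using zero_in_index by (intro cSUP_least) auto

lemma q_le_4p: "z \<in> Z \<Longrightarrow> q z \<le> 4 * p z"
  by (rule q_le) (rule val_le_4p)

text \<open>A functional attaining \<open>p z\<close> has finite mass, so it belongs to some level
  \<open>n\<close>. Rounding and truncating lose a quarter of \<open>\<theta> n\<close>, whereas the
  weight gains at least \<open>\<theta> n\<close>, and
  \<open>(1 + \<theta> n) (1 - \<theta> n / 4)\<close> exceeds 1. The strictness later bounds the
  levels that matter.\<close>

lemma exists_val_gt_p:
  assumes z: "z \<in> Z" "z \<noteq> 0"
  shows "\<exists>i\<in>index. p z < val i z"
proof -
  have pz: "0 < p z" using z(2) by (simp add: pos_iff)
  obtain e where e: "e \<in> E" "\<bar>e z\<bar> = p z" using attained by blast
  define f where "f k = e (y k)" for k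
  have fs: "summable (\<lambda>k. \<bar>f k\<bar>)" unfolding f_def by (rule E_summable[OF e(1)])
  have ev_f: "ev f u = e u" if "u \<in> Z" for u
    unfolding ev_def f_def by (rule E_expand[OF e(1) that])
  obtain n where n: "mass f \<le> real n" using real_arch_simple by blast
  have f: "f \<in> level n" using fs n ev_f E_le_p[OF e(1)] by (auto simp: level_def)
  define g where "g k = of_int \<lfloor>f k / mesh n k\<rfloor> * mesh n k" for k
  have near: "\<bar>g k - f k\<bar> \<le> mesh n k" for k
  proof -
    have "g k - f k = (of_int \<lfloor>f k / mesh n k\<rfloor> - f k / mesh n k) * mesh n k"
      using mesh_pos[of n k] by (simp add: g_def left_diff_distrib)
    moreover have "\<bar>of_int \<lfloor>f k / mesh n k\<rfloor> - f k / mesh n k\<bar> \<le> 1" by linarith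
    ultimately show ?thesis
      using mult_right_mono[of "\<bar>of_int \<lfloor>f k / mesh n k\<rfloor> - f k / mesh n k\<bar>" 1 "mesh n k"] mesh_pos[of n k]
      by (simp add: abs_mult)
  qed
  note gf = near_level[OF f near]
  have g: "g \<in> grid n" unfolding grid_def using f near by (auto simp: g_def)
  obtain m where m: "mass (\<lambda>k. g k - truncate m g k) \<le> \<delta> n"
    using order_tendstoD(2)[OF tail_tendsto_0[OF gf(3)] \<delta>(1)[of n]]
    unfolding eventually_sequentially by (meson less_imp_le order_refl)
  define h where "h = truncate m g"
  have h: "h \<in> finite_grid n" unfolding finite_grid_def h_def using g m by blast
  have hs: "summable (\<lambda>k. \<bar>h k\<bar>)" by (rule finite_grid_props(1)[OF h])
  have "\<bar>ev g z - ev h z\<bar> = \<bar>ev (\<lambda>k. g k - h k) z\<bar>" using ev_diff_coeffs[OF gf(3) hs z(1)] by simp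
  also have "\<dots> \<le> L * p z * mass (\<lambda>k. g k - h k)"
    unfolding h_def by (rule abs_ev_le_p[OF tail_summable[OF gf(3)] z(1)])
  also have "\<dots> \<le> L * p z * \<delta> n" using m L by (intro mult_left_mono) (auto simp: h_def)
  also have "\<dots> = \<theta> n / 8 * p z" using \<delta>(3)[of n] by (simp add: mult.commute mult.left_commute)
  finally have "\<bar>ev g z - ev h z\<bar> \<le> \<theta> n / 8 * p z" .
  then have "p z - 2 * (\<theta> n / 8 * p z) \<le> \<bar>ev h z\<bar>"
    using gf(5)[OF z(1)] ev_f[OF z(1)] e(2) by linarith
  then have ge: "(1 - \<theta> n / 4) * p z \<le> \<bar>ev h z\<bar>" by (simp add: algebra_simps)
  have "1 < (1 + \<theta> n) * (1 - \<theta> n / 4)"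
  proof -
    have "\<theta> n * \<theta> n \<le> \<theta> n * 1" using \<theta>[of n] by (intro mult_left_mono) auto
    then show ?thesis using \<theta>(1)[of n] by (simp add: algebra_simps)
  qed
  then have "1 * p z < (1 + \<theta> n) * (1 - \<theta> n / 4) * p z" using pz by (rule mult_strict_right_mono)
  also have "\<dots> = (1 + \<theta> n) * ((1 - \<theta> n / 4) * p z)" by simp
  also have "\<dots> \<le> weight n h * \<bar>ev h z\<bar>"
    using weight_bounds(1)[OF h] ge \<theta>[of n] by (intro mult_mono) auto
  finally show ?thesis using h by (intro bexI[of _ "(n, h)"]) (auto simp: val_def index_def)
qed

lemma p_le_q:
  assumes "z \<in> Z"
  shows "p z \<le> q z"
proof (cases "z = 0")
  case True
  then show ?thesis using val_le_q[OF zero_in_index assms] val_nonneg[OF zero_in_index, of z] by simp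
next
  case False
  then obtain i where i: "i \<in> index" "p z < val i z" using exists_val_gt_p[OF assms] by blast
  then show ?thesis using val_le_q[OF i(1) assms] by linarith
qed

lemma p_less_q:
  assumes "z \<in> Z" "z \<noteq> 0"
  shows "p z < q z"
proof -
  obtain i where i: "i \<in> index" "p z < val i z" using exists_val_gt_p[OF assms] by blast
  then show ?thesis using val_le_q[OF i(1) assms(1)] by linarith
qed

lemma index_summable: "i \<in> index \<Longrightarrow> summable (\<lambda>k. \<bar>snd i k\<bar>)"
  using finite_grid_props(1) by (auto simp: index_def)

lemma val_add: 
  assumes "i \<in> index" "u \<in> Z" "v \<in> Z"
  shows "val i (u + v) \<le> val i u + val i v"
proof -
  have "0 \<le> weight (fst i) (snd i)"
    using weight_bounds(1)[of "snd i" "fst i"] \<theta>(1)[of "fst i"] assms(1) by (auto simp: index_def)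
  then show ?thesis
    using mult_left_mono[OF abs_triangle_ineq, of "weight (fst i) (snd i)" "ev (snd i) u" "ev (snd i) v"]
      ev_add[OF index_summable[OF assms(1)] assms(2,3)]
    by (simp add: val_def distrib_left)
qed

lemma val_scale:
  assumes "i \<in> index" "u \<in> Z"
  shows "val i (r *\<^sub>R u) = \<bar>r\<bar> * val i u"
  using ev_scale[OF index_summable[OF assms(1)] assms(2)] by (simp add: val_def abs_mult)

lemma q_add:
  assumes "u \<in> Z" "v \<in> Z"
  shows "q (u + v) \<le> q u + q v"
proof (rule q_le)
  fix i assume i: "i \<in> index"
  show "val i (u + v) \<le> q u + q v"
    using val_add[OF i assms] val_le_q[OF i assms(1)] val_le_q[OF i assms(2)] by linarith
qed

lemma q_nonneg: "z \<in> Z \<Longrightarrow> 0 \<le> q z"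
  using p_le_q[of z] nonneg[of z] by linarith

lemma q_scale:
  assumes "u \<in> Z"
  shows "q (r *\<^sub>R u) = \<bar>r\<bar> * q u"
proof (rule antisym)
  have le: "q (r *\<^sub>R u) \<le> \<bar>r\<bar> * q u" if "u \<in> Z" for r u
    by (rule q_le) (simp add: val_scale that mult_left_mono val_le_q)
  show "q (r *\<^sub>R u) \<le> \<bar>r\<bar> * q u" using le assms .
  show "\<bar>r\<bar> * q u \<le> q (r *\<^sub>R u)"
  proof (cases "r = 0")
    case True
    then show ?thesis using q_nonneg[of 0] subspace_0[OF Z] by simp
  next
    case False
    have "r *\<^sub>R u \<in> Z" using assms Z by (simp add: subspace_scale)
    then have "q u \<le> q (r *\<^sub>R u) / \<bar>r\<bar>" using le[of "r *\<^sub>R u" "1 / r"] False by simp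
    then show ?thesis using False by (simp add: field_simps)
  qed
qed

lemma norm_on_q: "norm_on Z q"
  unfolding norm_on_def
proof (intro conjI ballI allI)
  fix x assume x: "x \<in> Z"
  show "0 \<le> q x" using x by (rule q_nonneg)
  show "q x = 0 \<longleftrightarrow> x = 0" using p_le_q[OF x] q_le_4p[OF x] by (auto simp: antisym)
      (metis eq_0_iff nonneg antisym)
qed (auto simp: q_add q_scale)

end

section \<open>Finitely many functionals decide the norm on a finite-dimensional subspace\<close>

context boundary_coordinates
begin

text \<open>Rounded sequences and their witnesses are followed together: the witnesses stay in the
  level by Fatou and weak-star continuity, and the rounded entries stay on the grid because they are
  eventually constant.\<close>

lemma grid_limit:
  assumes g: "\<And>j k. \<exists>i::int. g j k = of_int i * mesh n k" "\<And>k. (\<lambda>j. g j k) \<longlonglongrightarrow> \<gamma> k"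
    and f: "\<And>j. f j \<in> level n" "\<And>k. (\<lambda>j. f j k) \<longlonglongrightarrow> \<phi> k"
    and near: "\<And>j k. \<bar>g j k - f j k\<bar> \<le> mesh n k"
  shows "\<gamma> \<in> grid n"
proof -
  have f': "summable (\<lambda>k. \<bar>f j k\<bar>)" "mass (f j) \<le> real n" for j
    using f(1)[of j] by (auto simp: level_def)
  have "\<bar>ev \<phi> z\<bar> \<le> p z" if z: "z \<in> Z" for z
  proof (rule LIMSEQ_le_const2)
    show "(\<lambda>j. \<bar>ev (f j) z\<bar>) \<longlonglongrightarrow> \<bar>ev \<phi> z\<bar>"
      by (intro tendsto_rabs ev_tendsto[OF f(2) f' z])
    show "\<exists>N. \<forall>j\<ge>N. \<bar>ev (f j) z\<bar> \<le> p z" using f(1) z by (auto simp: level_def)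
  qed
  then have "\<phi> \<in> level n"
    using summable_suminf_le_of_pointwise_limit[OF f(2) f'] by (simp add: level_def)
  moreover have "\<bar>\<gamma> k - \<phi> k\<bar> \<le> mesh n k" for k
  proof (rule LIMSEQ_le_const2)
    show "(\<lambda>j. \<bar>g j k - f j k\<bar>) \<longlonglongrightarrow> \<bar>\<gamma> k - \<phi> k\<bar>" by (intro tendsto_intros g f)
    show "\<exists>N. \<forall>j\<ge>N. \<bar>g j k - f j k\<bar> \<le> mesh n k" using near by blast
  qed
  moreover have "\<exists>i::int. \<gamma> k = of_int i * mesh n k" for k
  proof -
    have "\<forall>\<^sub>F j in sequentially. g j k = \<gamma> k"
      by (rule integer_multiples_eventually_const[OF g(1) g(2) mesh_pos])
    then obtain j where "g j k = \<gamma> k" using eventually_happens'[OF sequentially_bot] by blast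
    then show ?thesis using g(1)[of j k] by simp
  qed
  ultimately show ?thesis unfolding grid_def by blast
qed

text \<open>A finite exhaustion of \<open>index\<close>, by level and by support.\<close>

definition box :: "nat \<Rightarrow> (nat \<times> (nat \<Rightarrow> real)) set" where
  "box j = {i \<in> index. fst i \<le> j \<and> (\<forall>k\<ge>j. snd i k = 0)}"

lemma box_mono: "i \<le> j \<Longrightarrow> box i \<subseteq> box j"
  by (auto simp: box_def)

lemma zero_in_box: "(0, \<lambda>_. 0) \<in> box j"
  using zero_in_index by (simp add: box_def)

lemma finite_grid_integer_multiple:
  assumes "h \<in> finite_grid n"
  shows "\<exists>i::int. h k = of_int i * mesh n k"
proof -
  obtain m g where g: "h = truncate m g" "g \<in> grid n" using assms by (auto simp: finite_grid_def)
  then obtain i :: int where "g k = of_int i * mesh n k" by (auto simp: grid_def)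
  moreover have "0 = of_int 0 * mesh n k" by simp
  ultimately show ?thesis unfolding g(1) truncate_def by metis
qed

lemma abs_le_mass:
  assumes "summable (\<lambda>k. \<bar>h k\<bar>)"
  shows "\<bar>h k\<bar> \<le> mass h"
  using sum_le_suminf[OF assms, of "{k}"] by simp

lemma finite_box: "finite (box j)"
proof -
  define V where "V n k = (\<lambda>i::int. of_int i * mesh n k) ` {- \<lceil>(real n + 1) / mesh n k\<rceil> .. \<lceil>(real n + 1) / mesh n k\<rceil>}" for n k
  define S where "S n = {h. \<forall>k. (k \<in> {..<j} \<longrightarrow> h k \<in> (\<Union>k<j. V n k)) \<and> (k \<notin> {..<j} \<longrightarrow> h k = (0::real))}" for n
  have "finite (S n)" for n
    unfolding S_def by (rule finite_set_of_finite_funs) (auto simp: V_def)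
  moreover have "box j \<subseteq> (SIGMA n:{..j}. S n)"
  proof
    fix i assume i: "i \<in> box j"
    obtain n h where nh: "i = (n, h)" by force
    have h: "h \<in> finite_grid n" "n \<le> j" "\<And>k. j \<le> k \<Longrightarrow> h k = 0"
      using i by (auto simp: box_def index_def nh)
    have "h k \<in> V n k" for k
    proof -
      obtain s :: int where s: "h k = of_int s * mesh n k" using finite_grid_integer_multiple[OF h(1)] by blast
      have "\<bar>h k\<bar> \<le> real n + 1"
        using abs_le_mass[OF finite_grid_props(1)[OF h(1)]] finite_grid_props(2)[OF h(1)] by (rule order_trans)
      then have "\<bar>of_int s :: real\<bar> \<le> (real n + 1) / mesh n k"
        using mesh_pos[of n k] by (simp add: s abs_mult field_simps)
      then have "\<bar>s\<bar> \<le> \<lceil>(real n + 1) / mesh n k\<rceil>" by linarith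
      then show ?thesis unfolding V_def s by (intro imageI) (auto simp: abs_le_iff)
    qed
    then show "i \<in> (SIGMA n:{..j}. S n)" using h by (auto simp: nh S_def)
  qed
  ultimately show ?thesis by (meson finite_SigmaI finite_atMost finite_subset)
qed

text \<open>Here \<open>\<tau>\<close> is the mass cut off, \<open>t\<close> the slope of the
  weight, and \<open>w'\<close>, \<open>x'\<close> belong to the sequence before the cut. As weights
  are at most 3, a product of at least 1/2 forces \<open>1 / 6 \<le> x'\<close>, so the gain in
  weight is worth at least \<open>t \<tau> / 6\<close>. The loss is at most
  \<open>3 \<kappa> \<tau>\<close>, which for \<open>\<kappa> = t / 18\<close> is the same
  amount.\<close>

lemma weighted_tail_estimate:
  fixes w x x' \<tau> \<kappa> t :: real
  assumes "w \<le> 3" "0 \<le> \<tau>" "0 \<le> t" "\<kappa> = t / 18" "w' = w - t * \<tau>" "0 \<le> w'" "x' \<le> x + \<kappa> * \<tau>"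
    "1 / 2 \<le> w' * x'"
  shows "w' * x' \<le> w * x"
proof -
  have "0 \<le> x'"
  proof (rule ccontr)
    assume "\<not> 0 \<le> x'"
    then have "w' * x' \<le> 0" using assms(6) by (simp add: mult_nonneg_nonpos)
    then show False using assms(8) by simp
  qed
  have "w' \<le> 3" using assms(1,2,3,5) mult_nonneg_nonneg[of t \<tau>] by linarith
  then have "w' * x' \<le> 3 * x'" using \<open>0 \<le> x'\<close> by (rule mult_right_mono)
  then have x6: "1 / 6 \<le> x'" using assms(8) by linarith
  have "0 \<le> w" using assms(2,3,5,6) mult_nonneg_nonneg[of t \<tau>] by linarith
  have "w * (\<kappa> * \<tau>) \<le> 3 * (\<kappa> * \<tau>)" using assms(1,2,3,4) by (intro mult_right_mono) auto
  also have "\<dots> = t * \<tau> * (1 / 6)" by (simp add: assms(4))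
  also have "\<dots> \<le> t * \<tau> * x'" using x6 assms(2,3) by (intro mult_left_mono) auto
  finally have 1: "w * (\<kappa> * \<tau>) \<le> t * \<tau> * x'" .
  have "w' * x' = w * x' - t * \<tau> * x'" by (simp add: assms(5) left_diff_distrib)
  also have "\<dots> \<le> w * (x + \<kappa> * \<tau>) - t * \<tau> * x'"
    using assms(7) \<open>0 \<le> w\<close> by (intro diff_right_mono mult_left_mono) auto
  also have "\<dots> \<le> w * x" using 1 by (simp add: distrib_left)
  finally show ?thesis .
qed

text \<open>Cutting off a tail lowers the mass and so raises the weight by an amount proportional to the
  mass removed, whereas the value at a vector with small late coordinates changes by much less.\<close>

lemma box_not_beaten:
  assumes z: "\<And>j. z j \<in> Z" "l \<in> Z" "z \<longlonglongrightarrow> l"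
    and h: "\<And>j. h j = truncate (m j) (g j)" "\<And>j. h j \<in> finite_grid n"
    and g: "\<And>j k. \<exists>i::int. g j k = of_int i * mesh n k" "\<And>k. (\<lambda>j. g j k) \<longlonglongrightarrow> \<gamma> k" "\<gamma> \<in> grid n"
    and big: "\<And>j. 1 \<le> j \<Longrightarrow> 1 / 2 \<le> val (n, h j) (z j)"
    and beats: "\<And>j i. i \<in> box j \<Longrightarrow> val i (z j) < val (n, h j) (z j)"
  shows False
proof -
  \<comment> \<open>The weight changes by \<open>t\<close> per unit of mass.\<close>
  define t where "t = \<theta> n / (real n + 1)"
  define \<kappa> where "\<kappa> = t / 18"
  have t: "0 < t" using \<theta>(1)[of n] by (simp add: t_def)
  then have \<kappa>: "0 < \<kappa>" by (simp add: \<kappa>_def)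
  have \<gamma>s: "summable (\<lambda>k. \<bar>\<gamma> k\<bar>)" using g(3) by (rule grid_summable)
  have "\<forall>\<^sub>F M in sequentially. mass (\<lambda>k. \<gamma> k - truncate M \<gamma> k) < \<delta> n"
    by (rule order_tendstoD(2)[OF tail_tendsto_0[OF \<gamma>s] \<delta>(1)])
  moreover obtain M0 where M0: "\<And>k. M0 \<le> k \<Longrightarrow> \<bar>a k l\<bar> < \<kappa> / 2"
    using LIMSEQ_D[OF a_null[OF z(2)], of "\<kappa> / 2"] \<kappa> by auto
  \<comment> \<open>The cut \<open>M\<close> depends on the limits alone: beyond it
    \<open>\<gamma>\<close> has little enough mass for \<open>truncate M \<gamma>\<close> to lie in
    the finite grid, and the coordinates of \<open>l\<close> are below
    \<open>\<kappa> / 2\<close>.\<close>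
  ultimately obtain M where M: "mass (\<lambda>k. \<gamma> k - truncate M \<gamma> k) \<le> \<delta> n" "M0 \<le> M"
    unfolding eventually_sequentially by (meson less_imp_le nle_le)
  have "(\<lambda>j. p (z j - l)) \<longlonglongrightarrow> p (l - l)" by (intro tendsto tendsto_diff z tendsto_const)
  then have "\<forall>\<^sub>F j in sequentially. p (z j - l) < \<kappa> / (2 * L)"
    using \<kappa> L by (intro order_tendstoD(2)) auto
  moreover have "\<forall>\<^sub>F j in sequentially. \<forall>k\<in>{..<M}. g j k = \<gamma> k"
    using integer_multiples_eventually_const[OF g(1) g(2) mesh_pos] by (intro eventually_ball_finite) auto
  moreover have "\<forall>\<^sub>F j in sequentially. max 1 (max M n) \<le> j" by (rule eventually_ge_at_top)
  ultimately have "\<forall>\<^sub>F j in sequentially. p (z j - l) < \<kappa> / (2 * L) \<and> (\<forall>k\<in>{..<M}. g j k = \<gamma> k) \<and> max 1 (max M n) \<le> j"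
    by (intro eventually_conj)
  then have "\<exists>j. p (z j - l) < \<kappa> / (2 * L) \<and> (\<forall>k\<in>{..<M}. g j k = \<gamma> k) \<and> max 1 (max M n) \<le> j"
    by (rule eventually_happens'[OF sequentially_bot])
  then obtain j where j: "p (z j - l) < \<kappa> / (2 * L)" "\<And>k. k < M \<Longrightarrow> g j k = \<gamma> k" "1 \<le> j" "M \<le> j" "n \<le> j"
    by auto
  have a_small: "\<bar>a k (z j)\<bar> \<le> \<kappa>" if "M \<le> k" for k
  proof -
    have d: "z j - l \<in> Z" using Z z by (simp add: subspace_diff)
    have "a k (z j) = a k l + a k (z j - l)" using a_add[OF z(2) d, of k] by simp
    moreover have "\<bar>a k (z j - l)\<bar> \<le> \<kappa> / 2"
    proof -
      have "L * p (z j - l) \<le> L * (\<kappa> / (2 * L))" using j(1) L by (intro mult_left_mono) auto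
      also have "\<dots> = \<kappa> / 2" using L by simp
      finally show ?thesis using a_bound[OF d, of k] by linarith
    qed
    ultimately show ?thesis using M0[of k] M(2) that by linarith
  qed
  \<comment> \<open>The competitor. It lies in \<open>box j\<close> because \<open>j\<close> is at
    least \<open>M\<close> and \<open>n\<close>, and it agrees with \<open>h j\<close> below
    \<open>M\<close> once \<open>M < m j\<close> is known.\<close>
  define h0 where "h0 = truncate M \<gamma>"
  have h0: "h0 \<in> finite_grid n" unfolding finite_grid_def h0_def using g(3) M(1) by blast
  then have h0_box: "(n, h0) \<in> box j"
    using j by (simp add: box_def index_def h0_def truncate_def)
  have hj_index: "(n, h j) \<in> index" using h(2) by (simp add: index_def)
  \<comment> \<open>Supported below \<open>M\<close>, the sequence \<open>h j\<close> would lie in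
    \<open>box j\<close> and have to beat itself.\<close>
  have "M < m j"
  proof (rule ccontr)
    assume "\<not> M < m j"
    then have "(n, h j) \<in> box j" using hj_index j by (simp add: box_def h(1) truncate_def)
    then show False using beats[of "(n, h j)" j] by simp
  qed
  define d where "d k = h j k - h0 k" for k
  have d0: "d k = 0" if "k < M" for k
    using that \<open>M < m j\<close> j(2)[OF that] by (simp add: d_def h(1) h0_def truncate_def)
  have h0_late: "h0 k = 0" if "M \<le> k" for k using that by (simp add: h0_def truncate_def)
  have hs: "summable (\<lambda>k. \<bar>h j k\<bar>)" "summable (\<lambda>k. \<bar>h0 k\<bar>)"
    using finite_grid_props(1) h(2) h0 by blast+
  have ds: "summable (\<lambda>k. \<bar>d k\<bar>)" unfolding d_def by (rule summable_diff_abs(1)[OF hs])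
  \<comment> \<open>\<open>d\<close> is exactly the part of \<open>h j\<close> that is cut off, so
    the masses add.\<close>
  have split: "\<bar>h j k\<bar> = \<bar>h0 k\<bar> + \<bar>d k\<bar>" for k
    using d0[of k] h0_late[of k] by (cases "k < M") (auto simp: d_def)
  have mass: "mass (h j) = mass h0 + mass d"
    unfolding split by (rule suminf_add[OF hs(2) ds, symmetric])
  have "\<bar>ev d (z j)\<bar> \<le> \<kappa> * mass d"
  proof (rule abs_ev_le[OF ds z(1)])
    fix k assume "d k \<noteq> 0"
    then show "\<bar>a k (z j)\<bar> \<le> \<kappa>" using d0[of k] a_small[of k] by (meson not_le)
  qed
  moreover have "ev d (z j) = ev (h j) (z j) - ev h0 (z j)"
    unfolding d_def by (rule ev_diff_coeffs[OF hs z(1)])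
  ultimately have ev_le: "\<bar>ev (h j) (z j)\<bar> \<le> \<bar>ev h0 (z j)\<bar> + \<kappa> * mass d" by linarith
  have "weight n (h j) * \<bar>ev (h j) (z j)\<bar> \<le> weight n h0 * \<bar>ev h0 (z j)\<bar>"
  proof (rule weighted_tail_estimate)
    show "weight n h0 \<le> 3" by (rule weight_bounds(3)[OF h0])
    show "0 \<le> mass d" by (rule mass_nonneg[OF ds])
    show "0 \<le> t" using t by simp
    show "\<kappa> = t / 18" by (rule \<kappa>_def)
    show "weight n (h j) = weight n h0 - t * mass d"
      by (simp add: weight_def mass t_def algebra_simps add_divide_distrib)
    show "0 \<le> weight n (h j)" using weight_bounds(1)[OF h(2)[of j]] \<theta>(1)[of n] by linarith
    show "1 / 2 \<le> weight n (h j) * \<bar>ev (h j) (z j)\<bar>" using big[OF j(3)] by (simp add: val_def)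
  qed (rule ev_le)
  then have "val (n, h j) (z j) \<le> val (n, h0) (z j)" by (simp add: val_def)
  then show False using beats[OF h0_box] by simp
qed

lemma less_q: "b < q z \<Longrightarrow> \<exists>i\<in>index. b < val i z"
  using q_le[of z b] by (meson not_le)

lemma q_tendsto:
  assumes "\<And>j. z j \<in> Z" "l \<in> Z" "z \<longlonglongrightarrow> l"
  shows "(\<lambda>j. q (z j)) \<longlonglongrightarrow> q l"
proof -
  have rev: "\<bar>q u - q v\<bar> \<le> 4 * p (u - v)" if "u \<in> Z" "v \<in> Z" for u v
  proof -
    have d: "u - v \<in> Z" "v - u \<in> Z" using that Z by (auto simp: subspace_diff)
    have "q u \<le> q v + q (u - v)" "q v \<le> q u + q (v - u)"
      using q_add[OF that(2) d(1)] q_add[OF that(1) d(2)] by simp_all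
    then show ?thesis using q_le_4p[OF d(1)] q_le_4p[OF d(2)] minus_commute[of u v] by linarith
  qed
  have "(\<lambda>j. q (z j) - q l) \<longlonglongrightarrow> 0"
  proof (rule Lim_null_comparison)
    show "\<forall>\<^sub>F j in sequentially. norm (q (z j) - q l) \<le> 4 * p (z j - l)"
      using rev assms by (intro always_eventually allI) simp
    have "(\<lambda>j. 4 * p (z j - l)) \<longlonglongrightarrow> 4 * p (l - l)"
      by (intro tendsto_mult tendsto tendsto_diff assms tendsto_const)
    then show "(\<lambda>j. 4 * p (z j - l)) \<longlonglongrightarrow> 0" by simp
  qed
  then show ?thesis by (rule LIM_zero_cancel)
qed

text \<open>Otherwise every \<open>box j\<close> is beaten at some point of norm 1, by an index that
  can be taken almost optimal there. The points cluster at some \<open>l\<close>. Since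
  \<open>p l < q l\<close>, high levels cannot be almost optimal nearby, so infinitely many of these
  indices share one level, and a coordinatewise limit leads to
  \<open>box_not_beaten\<close>.\<close>

lemma finitely_many_dominate:
  assumes B: "finite B" and F: "span B \<subseteq> Z"
  shows "\<exists>j. \<forall>z\<in>span B. \<forall>i\<in>index. \<exists>i'\<in>box j. val i z \<le> val i' z"
proof (rule ccontr)
  assume neg: "\<not> ?thesis"
  have "\<exists>z i. z \<in> span B \<and> p z = 1 \<and> i \<in> index \<and> q z - 1 / real (Suc j) < val i z
    \<and> (\<forall>i'\<in>box j. val i' z < val i z)" for j
  proof -
    obtain z i where z: "z \<in> span B" and i: "i \<in> index" "\<And>i'. i' \<in> box j \<Longrightarrow> val i' z < val i z"
      using neg by (meson not_le)
    have zZ: "z \<in> Z" using z F by blast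
    have "0 < val i z"
      using i(2)[OF zero_in_box] val_nonneg[OF zero_in_index, of z] by linarith
    then have "0 < p z" using val_le_4p[OF i(1) zZ] by linarith
    define u where "u = (1 / p z) *\<^sub>R z"
    have u: "u \<in> span B" unfolding u_def using z by (rule span_scale)
    have pu: "p u = 1" using \<open>0 < p z\<close> by (simp add: u_def scaleR del: eq_0_iff)
    have ui: "val i' u < val i u" if "i' \<in> box j" for i'
    proof -
      have "i' \<in> index" using that by (simp add: box_def)
      then show ?thesis
        using i(2)[OF that] val_scale[OF _ zZ, of i' "1 / p z"] val_scale[OF i(1) zZ, of "1 / p z"] \<open>0 < p z\<close>
        by (simp add: u_def divide_strict_right_mono)
    qed
    \<comment> \<open>If \<open>i\<close> is not almost optimal, an almost optimal \<open>i2\<close>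
      replaces it; it beats \<open>i\<close> and hence the whole box.\<close>
    have "q u - 1 / real (Suc j) < q u" by simp
    then obtain i2 where i2: "i2 \<in> index" "q u - 1 / real (Suc j) < val i2 u" using less_q by blast
    show ?thesis
    proof (cases "val i2 u \<le> val i u")
      case True
      then have "q u - 1 / real (Suc j) < val i u" using i2(2) by linarith
      then show ?thesis using u pu i(1) ui by blast
    next
      case False
      then have "\<forall>i'\<in>box j. val i' u < val i2 u" using ui by (meson le_less_trans less_imp_le not_le order_less_trans)
      then show ?thesis using u pu i2 by blast
    qed
  qed
  then obtain z i where z: "\<And>j. z j \<in> span B" "\<And>j. p (z j) = 1"
    and i: "\<And>j. i j \<in> index" "\<And>j. q (z j) - 1 / real (Suc j) < val (i j) (z j)"
      "\<And>j i'. i' \<in> box j \<Longrightarrow> val i' (z j) < val (i j) (z j)" by metis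
  have zZ: "z j \<in> Z" for j using z(1) F by blast
  have "norm (z j) \<le> 1 / c" for j using lower[of "z j"] z(2)[of j] c_pos by (simp add: field_simps)
  then obtain l r1 where l: "l \<in> span B" and r1: "strict_mono (r1 :: nat \<Rightarrow> nat)" "(z \<circ> r1) \<longlonglongrightarrow> l"
    using span_finite_bounded_convergent_subsequence[OF B, of z "1 / c"] z(1) by blast
  have lZ: "l \<in> Z" using l F by blast
  have "(\<lambda>j. p ((z \<circ> r1) j)) \<longlonglongrightarrow> p l" using r1(2) by (rule tendsto)
  then have pl: "p l = 1" by (simp add: z(2) LIMSEQ_const_iff)
  then have "l \<noteq> 0" by auto
  \<comment> \<open>One third each for three errors: \<open>q\<close> near \<open>l\<close> drops by
    less than \<open>\<epsilon>\<close>, almost optimality costs less than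
    \<open>\<epsilon>\<close>, and levels from \<open>n0\<close> on exceed 1 by less than
    \<open>\<epsilon>\<close>, whereas \<open>q l = 1 + 3 * \<epsilon>\<close>.\<close>
  define \<epsilon> where "\<epsilon> = (q l - 1) / 3"
  have \<epsilon>: "0 < \<epsilon>" using p_less_q[OF lZ \<open>l \<noteq> 0\<close>] pl by (simp add: \<epsilon>_def)
  have "\<forall>\<^sub>F j in sequentially. q l - \<epsilon> < q ((z \<circ> r1) j)"
    using q_tendsto[OF _ lZ r1(2)] zZ \<epsilon> by (intro order_tendstoD(1)) auto
  moreover have "\<forall>\<^sub>F j in sequentially. 1 / real (Suc j) < \<epsilon>"
    by (rule order_tendstoD(2)[OF LIMSEQ_Suc[OF lim_1_over_n] \<epsilon>])
  ultimately have "\<forall>\<^sub>F j in sequentially. q l - \<epsilon> < q ((z \<circ> r1) j) \<and> 1 / real (Suc j) < \<epsilon>"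
    by (rule eventually_conj)
  then obtain J where J: "\<And>j. J \<le> j \<Longrightarrow> q l - \<epsilon> < q (z (r1 j))" "\<And>j. J \<le> j \<Longrightarrow> 1 / real (Suc j) < \<epsilon>"
    unfolding eventually_sequentially by auto
  obtain n0 where n0: "\<theta> n0 < \<epsilon> / 3"
    unfolding \<theta>_def using real_arch_pow_inv[of "\<epsilon> / 3" "1/2"] \<epsilon> by auto
  have lt_n0: "fst (i (r1 (j + J))) < n0" for j
  proof (rule ccontr)
    define k where "k = r1 (j + J)"
    assume "\<not> fst (i (r1 (j + J))) < n0"
    then have "\<theta> (fst (i k)) \<le> \<theta> n0" unfolding \<theta>_def k_def by (intro power_decreasing) auto
    moreover have "val (i k) (z k) \<le> 1 + 3 * \<theta> (fst (i k))" using val_le[OF i(1) zZ, of k k] z(2)[of k] by simp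
    moreover have "1 / real (Suc k) \<le> 1 / real (Suc (j + J))"
      using strict_mono_imp_increasing[OF r1(1), of "j + J"] by (simp add: k_def frac_le)
    moreover have "q l = 1 + 3 * \<epsilon>" unfolding \<epsilon>_def by (simp add: diff_divide_distrib)
    moreover have "q l - \<epsilon> < q (z k)" "1 / real (Suc (j + J)) < \<epsilon>" using J[of "j + J"] by (auto simp: k_def)
    ultimately show False using i(2)[of k] n0 by linarith
  qed
  then have "range (\<lambda>j. fst (i (r1 (j + J)))) \<subseteq> {..<n0}" by auto
  then have "finite (range (\<lambda>j. fst (i (r1 (j + J)))))" by (rule finite_subset) simp
  then have "\<exists>j0\<in>UNIV. \<not> finite {j \<in> UNIV. fst (i (r1 (j + J))) = fst (i (r1 (j0 + J)))}"
    by (intro pigeonhole_infinite) auto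
  then obtain j0 where j0: "infinite {j. fst (i (r1 (j + J))) = fst (i (r1 (j0 + J)))}" by auto
  define n where "n = fst (i (r1 (j0 + J)))"
  have n: "infinite {j. fst (i (r1 (j + J))) = n}" unfolding n_def by (rule j0)
  define r2 where "r2 = enumerate {j. fst (i (r1 (j + J))) = n}"
  have r2: "strict_mono r2" unfolding r2_def using n by (rule strict_mono_enumerate)
  define s where "s j = r1 (r2 j + J)" for j
  have s: "strict_mono s"
    unfolding s_def using r1(1) r2 by (simp add: strict_mono_def)
  have fst_n: "fst (i (s j)) = n" for j
    using enumerate_in_set[OF n, of j] by (simp add: s_def r2_def)
  have zs: "(\<lambda>j. z (s j)) \<longlonglongrightarrow> l"
  proof -
    have "strict_mono (\<lambda>j. r2 j + J)" using r2 by (simp add: strict_mono_def)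
    from LIMSEQ_subseq_LIMSEQ[OF r1(2) this] show ?thesis by (simp add: s_def o_def)
  qed
  have "snd (i (s j)) \<in> finite_grid n" for j
    using i(1)[of "s j"] fst_n[of j] by (auto simp: index_def)
  then have "\<exists>m g f. snd (i (s j)) = truncate m g \<and> (\<forall>k. \<exists>a::int. g k = of_int a * mesh n k) \<and>
      f \<in> level n \<and> (\<forall>k. \<bar>g k - f k\<bar> \<le> mesh n k)" for j
    unfolding finite_grid_def grid_def by blast
  then obtain m g f where h: "\<And>j. snd (i (s j)) = truncate (m j) (g j)"
    and g: "\<And>j k. \<exists>a::int. g j k = of_int a * mesh n k"
    and f: "\<And>j. f j \<in> level n" and near: "\<And>j k. \<bar>g j k - f j k\<bar> \<le> mesh n k" by metis
  \<comment> \<open>Grid sequences are paired with their witnesses so that one diagonal extraction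
    makes both converge.\<close>
  have bdd: "norm (g j k, f j k) \<le> (real n + 1) + real n" for j k
  proof -
    have "\<bar>g j k\<bar> \<le> real n + 1"
      using abs_le_mass[OF near_level(3)[OF f near], of j k] near_level(4)[OF f near, of j] \<delta>(2)[of n] by linarith
    moreover have "\<bar>f j k\<bar> \<le> real n"
      using abs_le_mass[of "f j" k] f[of j] by (auto simp: level_def)
    moreover have "norm (g j k, f j k) \<le> norm (g j k) + norm (f j k)" by (rule norm_Pair_le)
    ultimately show ?thesis by simp
  qed
  have "\<exists>r. strict_mono (r :: nat \<Rightarrow> nat) \<and> (\<forall>k. \<exists>\<gamma>. (\<lambda>j. (g (r j) k, f (r j) k)) \<longlonglongrightarrow> \<gamma>)"
  proof (rule function_convergent_subsequence[of "UNIV :: nat set" "\<lambda>j k. (g j k, f j k)"])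
    fix r :: "nat \<Rightarrow> nat"
    assume "strict_mono r" "\<And>k. k \<in> UNIV \<Longrightarrow> \<exists>\<gamma>. (\<lambda>j. (g (r j) k, f (r j) k)) \<longlonglongrightarrow> \<gamma>"
    then show ?thesis by (intro exI[of _ r]) simp
  qed (use bdd in auto)
  then obtain r3 where r3: "strict_mono (r3 :: nat \<Rightarrow> nat)"
    "\<And>k. \<exists>\<gamma>. (\<lambda>j. (g (r3 j) k, f (r3 j) k)) \<longlonglongrightarrow> \<gamma>" by blast
  then obtain \<Gamma> where \<Gamma>: "\<And>k. (\<lambda>j. (g (r3 j) k, f (r3 j) k)) \<longlonglongrightarrow> \<Gamma> k" by metis
  have g_lim: "(\<lambda>j. g (r3 j) k) \<longlonglongrightarrow> fst (\<Gamma> k)" and f_lim: "(\<lambda>j. f (r3 j) k) \<longlonglongrightarrow> snd (\<Gamma> k)" for k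
    using tendsto_fst[OF \<Gamma>] tendsto_snd[OF \<Gamma>] by simp_all
  have le: "j \<le> s (r3 j)" for j
    using strict_mono_imp_increasing[OF strict_mono_o[OF s r3(1)], of j] by simp
  have i_eq: "i (s (r3 j)) = (n, snd (i (s (r3 j))))" for j
    using fst_n by (metis prod.collapse)
  show False
  proof (rule box_not_beaten)
    show "z (s (r3 j)) \<in> Z" for j by (rule zZ)
    show "(\<lambda>j. z (s (r3 j))) \<longlonglongrightarrow> l" using LIMSEQ_subseq_LIMSEQ[OF zs r3(1)] by (simp add: o_def)
    show "snd (i (s (r3 j))) = truncate (m (r3 j)) (g (r3 j))" for j by (rule h)
    show "snd (i (s (r3 j))) \<in> finite_grid n" for j
      using i(1)[of "s (r3 j)"] fst_n[of "r3 j"] by (auto simp: index_def)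
    show "(\<lambda>k. fst (\<Gamma> k)) \<in> grid n" by (rule grid_limit[OF g g_lim f f_lim near])
    show "1 / 2 \<le> val (n, snd (i (s (r3 j)))) (z (s (r3 j)))" if "1 \<le> j" for j
    proof -
      define k where "k = s (r3 j)"
      have "1 \<le> k" using le[of j] that by (simp add: k_def)
      then have "1 / real (Suc k) \<le> 1 / 2" by (simp add: field_simps)
      then have "1 / 2 \<le> val (i k) (z k)" using i(2)[of k] p_le_q[OF zZ[of k]] z(2)[of k] by linarith
      then show ?thesis using i_eq[of j] by (simp add: k_def)
    qed
    show "val i' (z (s (r3 j))) < val (n, snd (i (s (r3 j)))) (z (s (r3 j)))" if "i' \<in> box j" for j i'
      using i(3)[of i' "s (r3 j)"] box_mono[OF le[of j]] that i_eq[of j] by auto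
  qed (rule lZ g g_lim)+
qed

text \<open>Subsets are allowed because \<open>Z\<close> may contain an auxiliary vector outside the
  closed span of the chosen subsequence.\<close>

lemma iso_polyhedral_of_subset:
  assumes S: "S \<subseteq> Z" and inf: "infinite_dimensional S"
  shows "iso_polyhedral S"
  unfolding iso_polyhedral_def
proof (intro exI[of _ q] conjI)
  show "norm_on S q" using norm_on_q S unfolding norm_on_def by (meson subsetD)
  have "c * norm z \<le> q z \<and> q z \<le> 4 * C * norm z" if "z \<in> S" for z
  proof -
    have z: "z \<in> Z" using that S by blast
    show ?thesis using lower[of z] upper[of z] p_le_q[OF z] q_le_4p[OF z] by simp
  qed
  then show "\<exists>c>0. \<exists>C>0. \<forall>z\<in>S. c * norm z \<le> q z \<and> q z \<le> C * norm z"
    by (rule_tac exI[of _ c], rule_tac conjI[OF c_pos], rule_tac exI[of _ "4 * C"]) (use C_pos in simp)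
  show "polyhedral_wrt S q"
    unfolding polyhedral_wrt_def
  proof (intro conjI allI impI inf, elim conjE exE)
    fix F B assume F: "subspace F" "F \<subseteq> S" and B: "finite B" "F = span B"
    have FZ: "F \<subseteq> Z" using F S by blast
    obtain j where j: "\<And>z i. z \<in> F \<Longrightarrow> i \<in> index \<Longrightarrow> \<exists>i'\<in>box j. val i z \<le> val i' z"
      using finitely_many_dominate[OF B(1)] FZ B(2) by blast
    \<comment> \<open>The value 0 off \<open>index\<close> makes \<open>\<psi> i\<close> linear on
      \<open>F\<close> for every \<open>i\<close>, as the lemma on extreme points asks.\<close>
    define \<psi> where "\<psi> i z = (if i \<in> index then weight (fst i) (snd i) * ev (snd i) z else 0)" for i z
    have box: "i \<in> index" if "i \<in> box j" for i using that by (simp add: box_def)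
    show "finite {p. p extreme_point_of {z \<in> F. q z \<le> 1}}"
    proof (rule finite_extreme_points_of_finite_max[OF F(1) finite_box[of j], of \<psi>])
      show "\<psi> i (x + y) = \<psi> i x + \<psi> i y" if "x \<in> F" "y \<in> F" for i x y
        using ev_add[OF index_summable subsetD[OF FZ that(1)] subsetD[OF FZ that(2)], of i]
        by (auto simp: \<psi>_def distrib_left)
      show "\<psi> i (r *\<^sub>R x) = r * \<psi> i x" if "x \<in> F" for i r x
        using ev_scale[OF index_summable subsetD[OF FZ that], of i r] by (auto simp: \<psi>_def)
      fix x assume x: "x \<in> F"
      then have xZ: "x \<in> Z" using FZ by blast
      have abs_\<psi>: "\<bar>\<psi> i x\<bar> = val i x" if "i \<in> index" for i
      proof -
        have "0 \<le> weight (fst i) (snd i)"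
          using weight_bounds(1)[of "snd i" "fst i"] \<theta>(1)[of "fst i"] that by (auto simp: index_def)
        then show ?thesis using that by (simp add: \<psi>_def val_def abs_mult)
      qed
      show "q x \<le> 1 \<longleftrightarrow> (\<forall>i\<in>box j. \<bar>\<psi> i x\<bar> \<le> 1)"
      proof
        assume "q x \<le> 1"
        then show "\<forall>i\<in>box j. \<bar>\<psi> i x\<bar> \<le> 1" using abs_\<psi> box val_le_q[OF _ xZ] by (metis order_trans)
      next
        assume *: "\<forall>i\<in>box j. \<bar>\<psi> i x\<bar> \<le> 1"
        show "q x \<le> 1"
        proof (rule q_le)
          fix i assume "i \<in> index"
          then obtain i' where i': "i' \<in> box j" "val i x \<le> val i' x" using j x by blast
          have "val i' x \<le> 1" using * i'(1) abs_\<psi>[OF box[OF i'(1)]] by fastforce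
          then show "val i x \<le> 1" using i'(2) by linarith
        qed
      qed
    qed
  qed
qed

end

section \<open>Choice of the subsequence\<close>

lemma span_range_finite_support:
  assumes "z \<in> span (range (y :: nat \<Rightarrow> 'a::real_vector))"
  shows "\<exists>\<alpha> n. (\<forall>i\<ge>n. \<alpha> i = 0) \<and> z = (\<Sum>i<n. \<alpha> i *\<^sub>R y i)"
  using assms
proof (induction rule: span_induct_alt)
  case base
  show ?case by (intro exI[of _ "\<lambda>_. 0"] exI[of _ 0]) simp
next
  case (step r u z)
  then obtain j \<alpha> n where u: "u = y j" and \<alpha>: "\<forall>i\<ge>n. \<alpha> i = 0" "z = (\<Sum>i<n. \<alpha> i *\<^sub>R y i)" by auto
  define N where "N = max n (Suc j)"
  have "z = (\<Sum>i<N. \<alpha> i *\<^sub>R y i)"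
    unfolding \<alpha>(2) by (rule sum.mono_neutral_left) (use \<alpha>(1) in \<open>auto simp: N_def\<close>)
  moreover have "r *\<^sub>R u = (\<Sum>i<N. (if i = j then r else 0) *\<^sub>R y i)"
  proof -
    have "(\<Sum>i<N. (if i = j then r else 0) *\<^sub>R y i) = (\<Sum>i<N. if i = j then r *\<^sub>R y i else 0)"
      by (intro sum.cong) auto
    moreover have "j < N" by (simp add: N_def)
    ultimately show ?thesis by (simp add: u)
  qed
  ultimately have "r *\<^sub>R u + z = (\<Sum>i<N. ((if i = j then r else 0) + \<alpha> i) *\<^sub>R y i)"
    by (simp add: sum.distrib scaleR_add_left)
  then show ?case
    using \<alpha>(1) by (intro exI[of _ "\<lambda>i. (if i = j then r else 0) + \<alpha> i"] exI[of _ N]) (auto simp: N_def)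
qed

section \<open>Sequences with uniformly bounded coefficients\<close>

locale precisely_norming_family = norming_family E c C
  for E :: "('a::banach \<Rightarrow> real) set" and c C +
  assumes attains: "\<exists>e\<in>E. \<bar>e x\<bar> = p x"
begin

text \<open>Uniformly bounded coordinate functionals on the span of \<open>y\<close>. Unlike a basis
  inequality, this controls single coefficients and not partial sums.\<close>

definition dominates_coefficients :: "(nat \<Rightarrow> 'a) \<Rightarrow> real \<Rightarrow> bool" where
  "dominates_coefficients y K \<longleftrightarrow> (\<forall>\<alpha> n k. k < n \<longrightarrow> \<bar>\<alpha> k\<bar> \<le> K * p (\<Sum>i<n. \<alpha> i *\<^sub>R y i))"

lemma dominates_coefficients_unique:
  assumes dom: "dominates_coefficients y K"
    and \<alpha>: "\<forall>i\<ge>n. \<alpha> i = 0" and \<beta>: "\<forall>i\<ge>m. \<beta> i = 0"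
    and eq: "(\<Sum>i<n. \<alpha> i *\<^sub>R y i) = (\<Sum>i<m. \<beta> i *\<^sub>R y i)"
  shows "\<alpha> = \<beta>"
proof
  fix k
  define N where "N = max (Suc k) (max n m)"
  have "(\<Sum>i<n. \<alpha> i *\<^sub>R y i) = (\<Sum>i<N. \<alpha> i *\<^sub>R y i)"
    by (rule sum.mono_neutral_left) (use \<alpha> in \<open>auto simp: N_def\<close>)
  moreover have "(\<Sum>i<m. \<beta> i *\<^sub>R y i) = (\<Sum>i<N. \<beta> i *\<^sub>R y i)"
    by (rule sum.mono_neutral_left) (use \<beta> in \<open>auto simp: N_def\<close>)
  ultimately have 0: "(\<Sum>i<N. (\<alpha> i - \<beta> i) *\<^sub>R y i) = 0"
    using eq by (simp add: scaleR_diff_left sum_subtractf)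
  have "k < N" by (simp add: N_def)
  then have "\<bar>\<alpha> k - \<beta> k\<bar> \<le> K * p (\<Sum>i<N. (\<alpha> i - \<beta> i) *\<^sub>R y i)"
    using dom unfolding dominates_coefficients_def by (elim allE[of _ "\<lambda>i. \<alpha> i - \<beta> i"]) blast
  then show "\<alpha> k = \<beta> k" unfolding 0 by simp
qed

lemma dominates_coefficients_not_finite_dimensional:
  assumes dom: "dominates_coefficients y K" and B: "finite B"
  shows "\<not> range y \<subseteq> span B"
proof
  assume sub: "range y \<subseteq> span B"
  define n where "n = Suc (card B)"
  have zero: "\<alpha> k = 0" if "(\<Sum>i<n. \<alpha> i *\<^sub>R y i) = 0" "k < n" for \<alpha> k
  proof -
    have "\<bar>\<alpha> k\<bar> \<le> K * p (\<Sum>i<n. \<alpha> i *\<^sub>R y i)" using dom that(2) by (simp add: dominates_coefficients_def)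
    then show ?thesis unfolding that(1) by simp
  qed
  have inj: "inj_on y {..<n}"
  proof (rule inj_onI, rule ccontr)
    fix i j assume ij: "i \<in> {..<n}" "j \<in> {..<n}" "y i = y j" "i \<noteq> j"
    define \<alpha> where "\<alpha> k = (if k = i then 1 else if k = j then - 1 else 0 :: real)" for k
    have "(\<Sum>k<n. \<alpha> k *\<^sub>R y k) = (\<Sum>k\<in>{i, j}. \<alpha> k *\<^sub>R y k)"
      by (rule sum.mono_neutral_right) (use ij in \<open>auto simp: \<alpha>_def\<close>)
    also have "\<dots> = 0" using ij by (simp add: \<alpha>_def)
    finally have "\<alpha> i = 0" using zero ij by blast
    then show False by (simp add: \<alpha>_def)
  qed
  have "independent (y ` {..<n})"
  proof (rule independent_if_scalars_zero)
    fix f u assume s: "(\<Sum>v\<in>y ` {..<n}. f v *\<^sub>R v) = 0" and u: "u \<in> y ` {..<n}"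
    have "(\<Sum>i<n. f (y i) *\<^sub>R y i) = 0" using s by (simp add: sum.reindex[OF inj])
    then show "f u = 0" using zero[of "\<lambda>i. f (y i)"] u by auto
  qed simp
  then have "card (y ` {..<n}) \<le> card B"
    using independent_span_bound[OF B, of "y ` {..<n}"] sub by blast
  then show False using card_image[OF inj] by (simp add: n_def)
qed

text \<open>On the linear span coefficients are finitely supported, so they are null and the
  expansion of \<open>e\<close> is a finite sum. Uniform bounds carry both facts to the
  closure.\<close>

lemma iso_polyhedral_of_dominated_coefficients:
  assumes dom: "dominates_coefficients y K" and K: "0 \<le> K"
    and summ: "\<And>e. e \<in> E \<Longrightarrow> summable (\<lambda>k. \<bar>e (y k)\<bar>)"
    and S: "S \<subseteq> closure (span (range y))" and inf: "infinite_dimensional S"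
  shows "iso_polyhedral S"
proof -
  define V where "V = span (range y)"
  have V: "subspace V" by (simp add: V_def)
  have cV: "subspace (closure V)" using V by (rule subspace_closure)
  define rep where "rep z \<alpha> \<longleftrightarrow> (\<exists>n. (\<forall>i\<ge>n. \<alpha> i = 0) \<and> z = (\<Sum>i<n. \<alpha> i *\<^sub>R y i))" for z \<alpha>
  define coef where "coef z = (SOME \<alpha>. rep z \<alpha>)" for z
  have coef: "\<exists>n. (\<forall>i\<ge>n. coef z i = 0) \<and> z = (\<Sum>i<n. coef z i *\<^sub>R y i)" if "z \<in> V" for z
  proof -
    have "\<exists>\<alpha>. rep z \<alpha>" unfolding rep_def using that by (intro span_range_finite_support) (simp add: V_def)
    then have "rep z (coef z)" unfolding coef_def by (rule someI_ex)
    then show ?thesis by (simp add: rep_def)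
  qed
  have coef_eq: "coef z = \<alpha>" if \<alpha>: "\<forall>i\<ge>n. \<alpha> i = 0" "z = (\<Sum>i<n. \<alpha> i *\<^sub>R y i)" for z \<alpha> n
  proof -
    have "z \<in> V" unfolding \<alpha>(2) V_def by (intro span_sum span_scale span_base) auto
    then obtain m where m: "\<forall>i\<ge>m. coef z i = 0" "z = (\<Sum>i<m. coef z i *\<^sub>R y i)" using coef by blast
    show ?thesis using dominates_coefficients_unique[OF dom m(1) \<alpha>(1)] m(2) \<alpha>(2) by simp
  qed
  have common: "\<exists>N. (\<forall>i\<ge>N. coef u i = 0) \<and> u = (\<Sum>i<N. coef u i *\<^sub>R y i) \<and>
      (\<forall>i\<ge>N. coef v i = 0) \<and> v = (\<Sum>i<N. coef v i *\<^sub>R y i)" if "u \<in> V" "v \<in> V" for u v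
  proof -
    obtain n where n: "\<forall>i\<ge>n. coef u i = 0" "u = (\<Sum>i<n. coef u i *\<^sub>R y i)" using coef[OF \<open>u \<in> V\<close>] by blast
    obtain m where m: "\<forall>i\<ge>m. coef v i = 0" "v = (\<Sum>i<m. coef v i *\<^sub>R y i)" using coef[OF \<open>v \<in> V\<close>] by blast
    have "(\<Sum>i<n. coef u i *\<^sub>R y i) = (\<Sum>i<max n m. coef u i *\<^sub>R y i)"
      by (rule sum.mono_neutral_left) (use n(1) in auto)
    moreover have "(\<Sum>i<m. coef v i *\<^sub>R y i) = (\<Sum>i<max n m. coef v i *\<^sub>R y i)"
      by (rule sum.mono_neutral_left) (use m(1) in auto)
    ultimately show ?thesis using n m by (intro exI[of _ "max n m"]) simp
  qed
  have coef_add: "coef (u + v) k = coef u k + coef v k" if "u \<in> V" "v \<in> V" for u v k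
  proof -
    obtain N where N: "\<forall>i\<ge>N. coef u i = 0" "u = (\<Sum>i<N. coef u i *\<^sub>R y i)"
      "\<forall>i\<ge>N. coef v i = 0" "v = (\<Sum>i<N. coef v i *\<^sub>R y i)" using common[OF \<open>u \<in> V\<close> \<open>v \<in> V\<close>] by blast
    have "u + v = (\<Sum>i<N. (coef u i + coef v i) *\<^sub>R y i)"
      unfolding scaleR_add_left sum.distrib using N(2,4) by simp
    moreover have "\<forall>i\<ge>N. coef u i + coef v i = 0" using N(1,3) by simp
    ultimately show ?thesis using coef_eq[of N "\<lambda>i. coef u i + coef v i" "u + v"] by simp
  qed
  have coef_scale: "coef (r *\<^sub>R u) k = r * coef u k" if "u \<in> V" for r u k
  proof -
    obtain n where n: "\<forall>i\<ge>n. coef u i = 0" "u = (\<Sum>i<n. coef u i *\<^sub>R y i)" using coef[OF \<open>u \<in> V\<close>] by blast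
    have "r *\<^sub>R u = r *\<^sub>R (\<Sum>i<n. coef u i *\<^sub>R y i)" using n(2) by simp
    also have "\<dots> = (\<Sum>i<n. (r * coef u i) *\<^sub>R y i)" by (simp add: scaleR_sum_right)
    finally show ?thesis using coef_eq[of n "\<lambda>i. r * coef u i" "r *\<^sub>R u"] n(1) by simp
  qed
  have coef_bound: "\<bar>coef u k\<bar> \<le> K * C * norm u" if "u \<in> V" for u k
  proof -
    obtain n where n: "\<forall>i\<ge>n. coef u i = 0" "u = (\<Sum>i<n. coef u i *\<^sub>R y i)" using coef[OF \<open>u \<in> V\<close>] by blast
    have "\<bar>coef u k\<bar> \<le> K * p u"
    proof (cases "k < n")
      case True
      then have "\<bar>coef u k\<bar> \<le> K * p (\<Sum>i<n. coef u i *\<^sub>R y i)"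
        using dom by (simp add: dominates_coefficients_def)
      then show ?thesis using n(2) by simp
    next
      case False
      then show ?thesis using n(1) K by simp
    qed
    also have "\<dots> \<le> K * (C * norm u)" using upper K by (rule mult_left_mono)
    finally show ?thesis by simp
  qed
  have "\<exists>g. (\<forall>x\<in>V. g x = coef x k) \<and> (\<forall>x\<in>closure V. \<forall>y\<in>closure V. g (x + y) = g x + g y) \<and>
    (\<forall>a. \<forall>x\<in>closure V. g (a *\<^sub>R x) = a * g x) \<and> (\<forall>x\<in>closure V. \<bar>g x\<bar> \<le> K * C * norm x)" for k
    by (rule bounded_functional_extends_to_closure[OF V]) (auto simp: coef_add coef_scale coef_bound)
  then obtain a where a: "\<And>k u. u \<in> V \<Longrightarrow> a k u = coef u k"
    "\<And>k u v. u \<in> closure V \<Longrightarrow> v \<in> closure V \<Longrightarrow> a k (u + v) = a k u + a k v"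
    "\<And>k r u. u \<in> closure V \<Longrightarrow> a k (r *\<^sub>R u) = r * a k u"
    "\<And>k u. u \<in> closure V \<Longrightarrow> \<bar>a k u\<bar> \<le> K * C * norm u" by metis
  have a_diff: "a k (u - v) = a k u - a k v" if "u \<in> closure V" "v \<in> closure V" for k u v
    using a(2)[of "u - v" v k] that cV by (simp add: subspace_diff)
  have V_cl: "u \<in> closure V" if "u \<in> V" for u using that closure_subset by blast
  have KC: "0 \<le> K * C" using K C_pos by simp
  have null: "(\<lambda>k. a k z) \<longlonglongrightarrow> 0" if z: "z \<in> closure V" for z
  proof (rule LIMSEQ_I)
    fix \<epsilon> :: real assume "0 < \<epsilon>"
    then have "0 < \<epsilon> / (K * C + 1)" using KC by simp
    then obtain u where u: "u \<in> V" "dist u z < \<epsilon> / (K * C + 1)" using z closure_approachable by blast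
    obtain n where n: "\<forall>i\<ge>n. coef u i = 0" using coef[OF u(1)] by blast
    have "\<bar>a k z\<bar> < \<epsilon>" if "n \<le> k" for k
    proof -
      have d: "z - u \<in> closure V" using z V_cl[OF u(1)] cV by (simp add: subspace_diff)
      have "a k z = a k (z - u)" using a_diff[OF z V_cl[OF u(1)], of k] a(1)[OF u(1), of k] n that by simp
      then have "\<bar>a k z\<bar> \<le> K * C * norm (z - u)" using a(4)[OF d, of k] by simp
      also have "\<dots> \<le> (K * C + 1) * norm (z - u)" by (intro mult_right_mono) auto
      also have "\<dots> < \<epsilon>" using u(2) KC by (simp add: dist_norm norm_minus_commute field_simps)
      finally show ?thesis .
    qed
    then show "\<exists>no. \<forall>n\<ge>no. norm (a n z - 0) < \<epsilon>" by auto
  qed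
  have mult_summ: "summable (\<lambda>k. \<bar>e (y k)\<bar> * (K * C * norm z))" if "e \<in> E" for e z
    using summ[OF that] by (rule summable_mult2)
  have expand_abs: "summable (\<lambda>k. e (y k) * a k z)" "\<bar>\<Sum>k. e (y k) * a k z\<bar> \<le> (\<Sum>k. \<bar>e (y k)\<bar>) * (K * C * norm z)"
    if e: "e \<in> E" and z: "z \<in> closure V" for e z
  proof -
    have le: "\<bar>e (y k) * a k z\<bar> \<le> \<bar>e (y k)\<bar> * (K * C * norm z)" for k
      unfolding abs_mult by (intro mult_left_mono a z) auto
    have s: "summable (\<lambda>k. \<bar>e (y k) * a k z\<bar>)"
      by (rule summable_comparison_test'[OF mult_summ[OF e, of z], of 0]) (use le in simp)
    then show "summable (\<lambda>k. e (y k) * a k z)" by (rule summable_rabs_cancel)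
    have "\<bar>\<Sum>k. e (y k) * a k z\<bar> \<le> (\<Sum>k. \<bar>e (y k) * a k z\<bar>)" using s by (rule summable_rabs)
    also have "\<dots> \<le> (\<Sum>k. \<bar>e (y k)\<bar> * (K * C * norm z))" by (rule suminf_le[OF le s mult_summ[OF e]])
    also have "\<dots> = (\<Sum>k. \<bar>e (y k)\<bar>) * (K * C * norm z)" by (rule suminf_mult2[OF summ[OF e], symmetric])
    finally show "\<bar>\<Sum>k. e (y k) * a k z\<bar> \<le> (\<Sum>k. \<bar>e (y k)\<bar>) * (K * C * norm z)" .
  qed
  have expand: "(\<Sum>k. e (y k) * a k z) = e z" if e: "e \<in> E" and z: "z \<in> closure V" for e z
  proof -
    note lin = E_linear[OF e]
    \<comment> \<open>\<open>D\<close> bounds the norm of the series functional minus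
      \<open>e\<close>, a functional that vanishes on the dense subspace \<open>V\<close>.\<close>
    define D where "D = (\<Sum>k. \<bar>e (y k)\<bar>) * (K * C) + C"
    have m0: "0 \<le> (\<Sum>k. \<bar>e (y k)\<bar>)" by (simp add: suminf_nonneg summ[OF e])
    have D: "0 < D" unfolding D_def by (rule add_nonneg_pos[OF mult_nonneg_nonneg[OF m0 KC] C_pos])
    have "\<bar>(\<Sum>k. e (y k) * a k z) - e z\<bar> \<le> 0"
    proof (rule field_le_epsilon)
      fix \<epsilon> :: real assume "0 < \<epsilon>"
      then have "0 < \<epsilon> / D" using D by simp
      then obtain u where u: "u \<in> V" "dist u z < \<epsilon> / D" using z closure_approachable by blast
      obtain n where n: "\<forall>i\<ge>n. coef u i = 0" "u = (\<Sum>i<n. coef u i *\<^sub>R y i)" using coef[OF u(1)] by blast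
      have "(\<Sum>k. e (y k) * a k u) = (\<Sum>k<n. e (y k) * a k u)"
        by (rule suminf_finite) (use n(1) a(1)[OF u(1)] in auto)
      also have "\<dots> = e (\<Sum>i<n. coef u i *\<^sub>R y i)"
        by (simp add: linear_sum[OF lin] linear_scale[OF lin] a(1)[OF u(1)] mult.commute)
      finally have eu: "(\<Sum>k. e (y k) * a k u) = e u" using n(2) by simp
      have d: "z - u \<in> closure V" using z V_cl[OF u(1)] cV by (simp add: subspace_diff)
      have "(\<Sum>k. e (y k) * a k (z - u)) = (\<Sum>k. e (y k) * a k z) - (\<Sum>k. e (y k) * a k u)"
        using suminf_diff[OF expand_abs(1)[OF e z] expand_abs(1)[OF e V_cl[OF u(1)]]]
        by (simp add: a_diff[OF z V_cl[OF u(1)]] right_diff_distrib)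
      then have "\<bar>(\<Sum>k. e (y k) * a k z) - e z\<bar> = \<bar>(\<Sum>k. e (y k) * a k (z - u)) - e (z - u)\<bar>"
        using eu by (simp add: linear_diff[OF lin])
      also have "\<dots> \<le> (\<Sum>k. \<bar>e (y k)\<bar>) * (K * C * norm (z - u)) + C * norm (z - u)"
        using expand_abs(2)[OF e d] E_bound[OF e, of "z - u"] by linarith
      also have "\<dots> = D * dist u z" by (simp add: D_def dist_norm norm_minus_commute algebra_simps)
      also have "\<dots> \<le> D * (\<epsilon> / D)" using u(2) D by (intro mult_left_mono) auto
      finally show "\<bar>(\<Sum>k. e (y k) * a k z) - e z\<bar> \<le> 0 + \<epsilon>" using D by simp
    qed
    then show ?thesis by simp
  qed
  interpret boundary_coordinates E c C y "closure V" a "max 1 (K * C / c)"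
  proof
    fix k z assume z: "z \<in> closure V"
    have "\<bar>a k z\<bar> \<le> K * C * norm z" by (rule a(4)[OF z])
    also have "\<dots> \<le> K * C / c * p z"
      using mult_left_mono[OF lower[of z], of "K * C / c"] KC c_pos by simp
    also have "\<dots> \<le> max 1 (K * C / c) * p z" by (intro mult_right_mono) auto
    finally show "\<bar>a k z\<bar> \<le> max 1 (K * C / c) * p z" .
  qed (auto simp: attains cV a(2,3) null summ expand)
  show ?thesis using S inf unfolding V_def[symmetric] by (rule iso_polyhedral_of_subset)
qed

end

section \<open>A limit inside the space, and subsequences summable on the norming set\<close>

context precisely_norming_family
begin

text \<open>Simons' argument: for near-minimal partial sums of a geometric series, the tail of the series carries
  a fixed proportion of the norm of the limit, so a functional attaining that norm cannot tend to 0 on the tail hulls.\<close>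

lemma small_convex_combination:
  assumes bdd: "\<And>n. norm (v n) \<le> M" and null: "\<And>e. e \<in> E \<Longrightarrow> (\<lambda>n. e (v n)) \<longlonglongrightarrow> 0" and d: "0 < d"
  shows "\<exists>u\<in>convex hull (v ` {m..}). p u < d"
proof (rule ccontr)
  assume "\<not> ?thesis"
  then have big: "d \<le> p u" if "u \<in> convex hull (v ` {m..})" for u using that by (meson not_le)
  define D where "D n = closure (convex hull (v ` {m + n..}))" for n
  have D_convex: "convex (D n)" for n unfolding D_def by (intro convex_closure convex_convex_hull)
  have D_closed: "closed (D n)" for n by (simp add: D_def)
  have D_mono: "D k \<subseteq> D n" if "n \<le> k" for n k
    unfolding D_def using that by (intro closure_mono hull_mono image_mono) auto
  have v_mem: "v (m + n) \<in> D n" for n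
    unfolding D_def by (intro subsetD[OF closure_subset] hull_inc) auto
  have D_subset: "D n \<subseteq> T" if "closed T" "convex T" "\<And>i. m + n \<le> i \<Longrightarrow> v i \<in> T" for n T
    unfolding D_def using that by (intro closure_minimal hull_minimal) auto
  have D_norm: "norm u \<le> M" if "u \<in> D n" for u n
    using D_subset[of "cball 0 M" n] bdd that by auto
  have D_big: "d \<le> p u" if "u \<in> D n" for u n
  proof -
    have "u \<in> closure (convex hull (v ` {m..}))" using D_mono[of 0 n] that by (auto simp: D_def)
    then obtain s where s: "\<And>k. s k \<in> convex hull (v ` {m..})" "s \<longlonglongrightarrow> u" unfolding closure_sequential by blast
    have "(\<lambda>k. p (s k)) \<longlonglongrightarrow> p u" by (rule tendsto[OF s(2)])
    then show ?thesis by (rule LIMSEQ_le_const) (use s(1) big in auto)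
  qed
  \<comment> \<open>The slack that the induction in \<open>gap\<close> can afford: half of its bound
    at \<open>n\<close>, minus \<open>\<delta> n\<close>, is its bound at
    \<open>Suc n\<close>.\<close>
  define \<delta> where "\<delta> n = (1/2) ^ Suc n * (d * (1/2) ^ Suc n)" for n
  have \<delta>: "0 < \<delta> n" for n using d by (simp add: \<delta>_def)
  have near: "\<exists>u\<in>D n. \<forall>u'\<in>D n. p (w + (1/2) ^ n *\<^sub>R u) \<le> p (w + (1/2) ^ n *\<^sub>R u') + \<delta> n" for w n
  proof -
    define I where "I = (INF u\<in>D n. p (w + (1/2) ^ n *\<^sub>R u))"
    have bb: "bdd_below ((\<lambda>u. p (w + (1/2) ^ n *\<^sub>R u)) ` D n)" by (rule bdd_belowI2[of _ 0]) simp
    have ne: "D n \<noteq> {}" using v_mem by blast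
    have "I < I + \<delta> n" using \<delta> by simp
    then obtain u where u: "u \<in> D n" "p (w + (1/2) ^ n *\<^sub>R u) < I + \<delta> n"
      unfolding I_def using cINF_less_iff[OF ne bb] by blast
    have "I \<le> p (w + (1/2) ^ n *\<^sub>R u')" if "u' \<in> D n" for u'
      unfolding I_def by (rule cINF_lower[OF bb that])
    then show ?thesis using u by (intro bexI[of _ u]) force+
  qed
  define R where "R w n u \<longleftrightarrow> u \<in> D n \<and> (\<forall>u'\<in>D n. p (w + (1/2) ^ n *\<^sub>R u) \<le> p (w + (1/2) ^ n *\<^sub>R u') + \<delta> n)" for w n u
  define U where "U w n = (SOME u. R w n u)" for w n
  have "\<exists>u. R w n u" for w n using near[of n w] by (auto simp: R_def)
  then have "R w n (U w n)" for w n unfolding U_def by (rule someI_ex)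
  then have U: "\<And>w n. U w n \<in> D n"
    "\<And>w n u'. u' \<in> D n \<Longrightarrow> p (w + (1/2) ^ n *\<^sub>R U w n) \<le> p (w + (1/2) ^ n *\<^sub>R u') + \<delta> n" by (auto simp: R_def)
  \<comment> \<open>Partial sums of a series with weights \<open>(1/2) ^ n\<close>, in which each
    term nearly minimises the norm of the next partial sum over \<open>D n\<close>.\<close>
  define w where "w = rec_nat 0 (\<lambda>n w. w + (1/2) ^ n *\<^sub>R U w n)"
  define u where "u n = U (w n) n" for n
  have w0: "w 0 = 0" and wS: "w (Suc n) = w n + (1/2) ^ n *\<^sub>R u n" for n
    by (simp_all add: w_def u_def)
  have u: "u n \<in> D n" for n using U(1) by (simp add: u_def)
  have w_sum: "w n = (\<Sum>k<n. (1/2) ^ k *\<^sub>R u k)" for n by (induction n) (simp_all add: w0 wS)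
  have "summable (\<lambda>k. (1/2) ^ k *\<^sub>R u k)"
  proof (rule summable_comparison_test'[of "\<lambda>k. M * (1/2) ^ k" 0])
    show "summable (\<lambda>k. M * (1/2::real) ^ k)" by (intro summable_mult summable_geometric) simp
    show "norm ((1/2) ^ k *\<^sub>R u k) \<le> M * (1/2) ^ k" for k
      using mult_right_mono[OF D_norm[OF u], of "(1/2) ^ k" k] by (simp add: mult.commute)
  qed
  then obtain z where z: "w \<longlonglongrightarrow> z" unfolding w_sum using summable_LIMSEQ by blast
  \<comment> \<open>The weights from \<open>n\<close> on add up to \<open>2 / 2 ^ n\<close>, so this
    normalised remainder is an infinite convex combination of the \<open>u k\<close> with
    \<open>k \<ge> n\<close>.\<close>
  define t where "t n = (2 ^ n / 2) *\<^sub>R (z - w n)" for n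
  have t: "t n \<in> D n" for n
  proof -
    \<comment> \<open>The first \<open>j\<close> terms of that combination, with the missing weight
      \<open>(1/2) ^ j\<close> given to an arbitrary point of \<open>D n\<close>.\<close>
    have X: "(2 ^ n / 2) *\<^sub>R (w (n + j) - w n) + (1/2) ^ j *\<^sub>R x \<in> D n" if "x \<in> D n" for j x
      using that
    proof (induction j arbitrary: x)
      case (Suc j)
      have "u (n + j) \<in> D n" using D_mono[of n "n + j"] u by auto
      then have "(1/2) *\<^sub>R u (n + j) + (1/2) *\<^sub>R x \<in> D n"
        using D_convex[of n] Suc.prems by (intro convexD) auto
      note mem = Suc.IH[OF this]
      have c: "2 ^ n / 2 * (1/2) ^ (n + j) = (1/2) ^ j * (1/2 :: real)" by (simp add: power_add power_divide)
      have e: "w (n + Suc j) - w n = (w (n + j) - w n) + (1/2) ^ (n + j) *\<^sub>R u (n + j)" by (simp add: wS)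
      have "(2 ^ n / 2) *\<^sub>R (w (n + Suc j) - w n) + (1/2) ^ Suc j *\<^sub>R x =
          (2 ^ n / 2) *\<^sub>R (w (n + j) - w n) + (1/2) ^ j *\<^sub>R ((1/2) *\<^sub>R u (n + j) + (1/2) *\<^sub>R x)"
        by (simp only: e scaleR_add_right scaleR_scaleR c power_Suc2 add.assoc)
      with mem show ?case by simp
    qed simp
    have "(\<lambda>j. (2 ^ n / 2) *\<^sub>R (w (n + j) - w n) + (1/2) ^ j *\<^sub>R v (m + n))
        \<longlonglongrightarrow> (2 ^ n / 2) *\<^sub>R (z - w n) + 0 *\<^sub>R v (m + n)"
      using LIMSEQ_ignore_initial_segment[OF z, of n]
      by (intro tendsto_intros LIMSEQ_power_zero) (auto simp: add.commute)
    then have "(\<lambda>j. (2 ^ n / 2) *\<^sub>R (w (n + j) - w n) + (1/2) ^ j *\<^sub>R v (m + n)) \<longlonglongrightarrow> t n"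
      by (simp add: t_def)
    with D_closed X[OF v_mem] show ?thesis by (rule closed_sequentially)
  qed
  \<comment> \<open>The competitor \<open>t n\<close> leads to the midpoint of \<open>w n\<close>
    and \<open>z\<close>, so a near-minimal step keeps at least half of the gap to
    \<open>p z\<close>, up to \<open>\<delta> n\<close>.\<close>
  have gap: "(1/2) ^ n * (d + d * (1/2) ^ n) \<le> p z - p (w n)" for n
  proof (induction n)
    case 0
    have "p (t 0) = p z / 2" by (simp add: t_def w0 scaleR)
    then show ?case using D_big[OF t[of 0]] by (simp add: w0)
  next
    case (Suc n)
    have "w n + (1/2) ^ n *\<^sub>R t n = (1 - 1/2) *\<^sub>R w n + (1/2) *\<^sub>R z"
    proof -
      have "(1/2) ^ n *\<^sub>R t n = (1/2) *\<^sub>R (z - w n)" by (simp add: t_def power_divide)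
      then show ?thesis
        by (simp only: scaleR_diff_left scaleR_diff_right scaleR_one add_diff_eq diff_add_eq)
    qed
    then have "p (w n + (1/2) ^ n *\<^sub>R t n) \<le> (1 - 1/2) * p (w n) + 1/2 * p z"
      using convex_combination[of "1/2" "w n" z] by simp
    moreover have "p (w (Suc n)) \<le> p (w n + (1/2) ^ n *\<^sub>R t n) + \<delta> n"
      using U(2)[OF t, of "w n" n] by (simp add: wS u_def)
    ultimately have step: "(p z - p (w n)) / 2 - \<delta> n \<le> p z - p (w (Suc n))" by (simp add: field_simps)
    have "(1/2) ^ Suc n * (d + d * (1/2) ^ Suc n) = (1/2) ^ n * (d + d * (1/2) ^ n) / 2 - \<delta> n"
      by (simp add: \<delta>_def algebra_simps)
    also have "\<dots> \<le> (p z - p (w n)) / 2 - \<delta> n"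
      by (rule diff_right_mono[OF divide_right_mono[OF Suc.IH]]) simp
    also note step
    finally show ?case .
  qed
  obtain e where e: "e \<in> E" "\<bar>e z\<bar> = p z" using attains by blast
  note lin = E_linear[OF e(1)]
  \<comment> \<open>A functional attaining \<open>p z\<close> has at least the size of the gap on
    \<open>z - w n\<close>, and normalising the remainder turns this into
    \<open>d / 2\<close>.\<close>
  have large: "d / 2 \<le> \<bar>e (t n)\<bar>" for n
  proof -
    have "(1/2) ^ n * d \<le> p z - p (w n)"
    proof -
      have "(1/2) ^ n * d \<le> (1/2) ^ n * (d + d * (1/2) ^ n)" using d by (intro mult_left_mono) auto
      then show ?thesis using gap[of n] by linarith
    qed
    also have "\<dots> \<le> \<bar>e z\<bar> - \<bar>e (w n)\<bar>" using e E_le_p[OF e(1), of "w n"] by simp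
    also have "\<dots> \<le> \<bar>e (z - w n)\<bar>" by (simp add: linear_diff[OF lin])
    finally have le: "(1/2) ^ n * d \<le> \<bar>e (z - w n)\<bar>" .
    have "d / 2 = (2 ^ n / 2) * ((1/2) ^ n * d)" by (simp add: power_divide)
    also have "\<dots> \<le> (2 ^ n / 2) * \<bar>e (z - w n)\<bar>" by (rule mult_left_mono[OF le]) simp
    also have "\<dots> = \<bar>e (t n)\<bar>" unfolding t_def linear_scale[OF lin] by (simp add: abs_mult)
    finally show ?thesis .
  qed
  \<comment> \<open>On a late hull the same functional is at most \<open>d / 4\<close>, since it is
    so at the generators.\<close>
  obtain n where n: "\<And>k. n \<le> k \<Longrightarrow> \<bar>e (v k)\<bar> < d / 4"
    using LIMSEQ_D[OF null[OF e(1)], of "d / 4"] d by auto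
  define T where "T = {x. \<bar>e x\<bar> \<le> d / 4}"
  have "D n \<subseteq> T"
  proof (rule D_subset)
    have "bounded_linear e"
      using E_bound[OF e(1)] by (intro bounded_linear_intro[of _ C]) (auto simp: linear_add[OF lin] linear_scale[OF lin] mult.commute)
    then have "continuous_on UNIV e" by (rule linear_continuous_on)
    then show "closed T" unfolding T_def by (intro closed_Collect_le continuous_intros)
    have "T = e -` {- (d / 4)..d / 4}" by (auto simp: T_def abs_le_iff)
    then show "convex T" using convex_linear_vimage[OF lin, of "{- (d / 4)..d / 4}"] by simp
    show "v i \<in> T" if "m + n \<le> i" for i using n[of i] that by (simp add: T_def)
  qed
  then have "\<bar>e (t n)\<bar> \<le> d / 4" using t[of n] by (auto simp: T_def)
  then show False using large[of n] d by linarith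
qed

lemma summable_blocks:
  fixes f :: "nat \<Rightarrow> real"
  assumes f: "summable f" "\<And>n. 0 \<le> f n" and r: "strict_mono r"
  shows "summable (\<lambda>k. \<Sum>j=r k..<r (Suc k). f j)"
proof (rule summableI_nonneg_bounded)
  show "0 \<le> (\<Sum>j=r k..<r (Suc k). f j)" for k by (intro sum_nonneg f)
  have "(\<Sum>k<n. \<Sum>j=r k..<r (Suc k). f j) = (\<Sum>j=r 0..<r n. f j)" for n
  proof (induction n)
    case (Suc n)
    have "r 0 \<le> r n" "r n \<le> r (Suc n)" using r by (simp_all add: strict_mono_less_eq)
    then show ?case using Suc.IH by (simp add: sum.atLeastLessThan_concat)
  qed simp
  also have "(\<Sum>j=r 0..<r n. f j) \<le> suminf f" for n
    using f by (intro sum_le_suminf) auto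
  finally show "(\<Sum>k<n. \<Sum>j=r k..<r (Suc k). f j) \<le> suminf f" for n .
qed

lemma abs_functional_diff_le:
  assumes e: "e \<in> E" and "i \<le> j"
  shows "\<bar>e (x j) - e (x i)\<bar> \<le> (\<Sum>k=i..<j. \<bar>e (x (Suc k) - x k)\<bar>)"
  using \<open>i \<le> j\<close>
proof (induction j rule: dec_induct)
  case (step j)
  have "e (x (Suc j) - x j) = e (x (Suc j)) - e (x j)" by (rule linear_diff[OF E_linear[OF e]])
  then have "\<bar>e (x (Suc j)) - e (x i)\<bar> \<le> \<bar>e (x j) - e (x i)\<bar> + \<bar>e (x (Suc j) - x j)\<bar>" by linarith
  then show ?case using step by simp
qed simp

lemma convergent_functional:
  assumes e: "e \<in> E" and s: "summable (\<lambda>n. \<bar>e (x (Suc n) - x n)\<bar>)"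
  shows "convergent (\<lambda>n. e (x n))"
proof -
  have "summable (\<lambda>n. e (x (Suc n) - x n))" using s by (rule summable_rabs_cancel)
  then have "summable (\<lambda>n. e (x (Suc n)) - e (x n))" by (simp add: linear_diff[OF E_linear[OF e]])
  then have "convergent (\<lambda>n. \<Sum>k<n. e (x (Suc k)) - e (x k))" by (simp add: summable_iff_convergent)
  then have "convergent (\<lambda>n. e (x n) - e (x 0))"
    by (simp add: sum_lessThan_telescope[of "\<lambda>n. e (x n)"])
  then have "convergent (\<lambda>n. (e (x n) - e (x 0)) + e (x 0))" by (intro convergent_add convergent_const)
  then show ?thesis by simp
qed

lemma convex_hull_tail_finite:
  assumes "u \<in> convex hull ((v :: nat \<Rightarrow> 'a) ` {m..})"
  shows "\<exists>R\<ge>m. u \<in> convex hull (v ` {m..R::nat})"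
proof -
  define Q where "Q = (\<Union>R\<in>{m..}. convex hull (v ` {m..R}))"
  have "convex Q"
    unfolding convex_alt
  proof (intro ballI allI impI, elim conjE)
    fix a b :: 'a and t :: real assume "a \<in> Q" "b \<in> Q" and t: "0 \<le> t" "t \<le> 1"
    then obtain R R' where R: "m \<le> R" "a \<in> convex hull (v ` {m..R})" "b \<in> convex hull (v ` {m..R'})"
      by (auto simp: Q_def)
    have "convex hull (v ` {m..R}) \<subseteq> convex hull (v ` {m..max R R'})"
      "convex hull (v ` {m..R'}) \<subseteq> convex hull (v ` {m..max R R'})" by (intro hull_mono image_mono; auto)+
    then have "(1 - t) *\<^sub>R a + t *\<^sub>R b \<in> convex hull (v ` {m..max R R'})"
      using R t by (intro convexD convex_convex_hull) auto
    then show "(1 - t) *\<^sub>R a + t *\<^sub>R b \<in> Q" using R(1) by (auto simp: Q_def intro!: bexI[of _ "max R R'"])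
  qed
  moreover have "v ` {m..} \<subseteq> Q" by (auto simp: Q_def intro!: bexI hull_inc)
  ultimately have "convex hull (v ` {m..}) \<subseteq> Q" by (intro hull_minimal)
  then show ?thesis using assms by (auto simp: Q_def)
qed

text \<open>Each chosen term is compared with a convex combination of terms of its block whose norm
  is below \<open>(1/2) ^ k\<close>. Under \<open>e\<close> the two differ by at most the variation
  of \<open>e\<close> along the block, and disjoint blocks have summable variations.\<close>

lemma summable_subsequence_of_null:
  assumes bdd: "\<And>n. norm (x n - \<xi>) \<le> M" and lim: "\<And>e. e \<in> E \<Longrightarrow> (\<lambda>n. e (x n)) \<longlonglongrightarrow> e \<xi>"
    and summ: "\<And>e. e \<in> E \<Longrightarrow> summable (\<lambda>n. \<bar>e (x (Suc n) - x n)\<bar>)"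
    and freq: "\<And>n. \<exists>m\<ge>n. \<delta> \<le> p (x m - \<xi>)"
  shows "\<exists>r :: nat \<Rightarrow> nat. strict_mono r \<and> (\<forall>k. \<delta> \<le> p (x (r k) - \<xi>)) \<and>
    (\<forall>e\<in>E. summable (\<lambda>k. \<bar>e (x (r k) - \<xi>)\<bar>))"
proof -
  define v where "v n = x n - \<xi>" for n
  have null: "(\<lambda>n. e (v n)) \<longlonglongrightarrow> 0" if "e \<in> E" for e
    using tendsto_diff[OF lim[OF that] tendsto_const, of "e \<xi>"] by (simp add: v_def linear_diff[OF E_linear[OF that]])
  \<comment> \<open>The first component is the chosen index and the second the last one used by the
    small convex combination; the next choice lies beyond it, so the blocks are disjoint.\<close>
  define P where "P k y \<longleftrightarrow> fst y \<le> snd y \<and> \<delta> \<le> p (v (fst y)) \<and> (\<exists>u\<in>convex hull (v ` {fst y..snd y}). p u < (1/2) ^ k)"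
    for k and y :: "nat \<times> nat"
  have ex: "\<exists>y. P k y \<and> n \<le> fst y" for k n
  proof -
    obtain m where m: "n \<le> m" "\<delta> \<le> p (v m)" using freq by (auto simp: v_def)
    have "\<exists>u\<in>convex hull (v ` {m..}). p u < (1/2) ^ k"
      by (rule small_convex_combination[of v M]) (use bdd null in \<open>auto simp: v_def\<close>)
    then obtain u where u: "u \<in> convex hull (v ` {m..})" "p u < (1/2) ^ k" by blast
    obtain R where "m \<le> R" "u \<in> convex hull (v ` {m..R})" using convex_hull_tail_finite[OF u(1)] by blast
    then have "P k (m, R)" using m u by (auto simp: P_def)
    then show ?thesis using m by (intro exI[of _ "(m, R)"]) simp
  qed
  have "\<exists>f. \<forall>n. P n (f n) \<and> Suc (snd (f n)) \<le> fst (f (Suc n))"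
  proof (rule dependent_nat_choice[where P = P and Q = "\<lambda>_ y y'. Suc (snd y) \<le> fst y'"])
    show "\<exists>y. P 0 y" using ex[of 0 0] by blast
    show "\<exists>y'. P (Suc n) y' \<and> Suc (snd y) \<le> fst y'" for y n by (rule ex)
  qed
  then obtain f where f: "\<And>n. P n (f n)" "\<And>n. Suc (snd (f n)) \<le> fst (f (Suc n))" by blast
  define r where "r k = fst (f k)" for k
  have r: "strict_mono r"
  proof (rule strict_monoI_Suc)
    show "r k < r (Suc k)" for k using f(1)[of k] f(2)[of k] by (simp add: r_def P_def)
  qed
  have "summable (\<lambda>k. \<bar>e (v (r k))\<bar>)" if e: "e \<in> E" for e
  proof -
    note lin = E_linear[OF e]
    define g where "g j = \<bar>e (x (Suc j) - x j)\<bar>" for j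
    have "summable (\<lambda>k. (1/2) ^ k + (\<Sum>j=r k..<r (Suc k). g j))"
      by (intro summable_add summable_geometric summable_blocks r) (auto simp: g_def summ[OF e])
    then show ?thesis
    proof (rule summable_comparison_test'[of _ 0])
      fix k
      obtain u where u: "u \<in> convex hull (v ` {r k..snd (f k)})" "p u < (1/2) ^ k"
        using f(1)[of k] by (auto simp: P_def r_def)
      define B where "B = (\<Sum>j=r k..<r (Suc k). g j)"
      have "convex hull (v ` {r k..snd (f k)}) \<subseteq> {y. e (v (r k)) - e y \<in> {- B..B}}"
      proof (rule hull_minimal)
        have "{y. e (v (r k)) - e y \<in> {- B..B}} = e -` {e (v (r k)) - B..e (v (r k)) + B}" by auto
        then show "convex {y. e (v (r k)) - e y \<in> {- B..B}}"
          using convex_linear_vimage[OF lin, of "{e (v (r k)) - B..e (v (r k)) + B}"] by simp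
        show "v ` {r k..snd (f k)} \<subseteq> {y. e (v (r k)) - e y \<in> {- B..B}}"
        proof clarify
          fix i assume i: "i \<in> {r k..snd (f k)}"
          have "\<bar>e (x i) - e (x (r k))\<bar> \<le> (\<Sum>j=r k..<i. g j)"
            unfolding g_def using i by (intro abs_functional_diff_le[OF e]) simp
          also have "\<dots> \<le> B"
            unfolding B_def using i f(2)[of k] by (intro sum_mono2) (auto simp: r_def g_def)
          finally show "e (v (r k)) - e (v i) \<in> {- B..B}"
            by (simp add: v_def linear_diff[OF lin] abs_le_iff)
        qed
      qed
      then have "\<bar>e (v (r k)) - e u\<bar> \<le> B" using u(1) by (auto simp: abs_le_iff)
      then show "norm \<bar>e (v (r k))\<bar> \<le> (1/2) ^ k + (\<Sum>j=r k..<r (Suc k). g j)"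
        using E_le_p[OF e, of u] u(2) unfolding B_def by simp
    qed
  qed
  moreover have "\<delta> \<le> p (v (r k))" for k using f(1)[of k] by (simp add: P_def r_def)
  ultimately show ?thesis using r unfolding v_def by blast
qed

text \<open>Meant for two situations: normalised terms, with \<open>\<xi> = 0\<close>, and
  differences from a limit \<open>\<xi>\<close>. The span hypotheses let \<open>x\<close> and
  \<open>v\<close> replace each other modulo \<open>\<xi>\<close>.\<close>

lemma iso_polyhedral_subsequence_of_summable:
  assumes summ: "\<And>e. e \<in> E \<Longrightarrow> summable (\<lambda>k. \<bar>e (v k)\<bar>)" and \<delta>: "0 < \<delta>" "\<And>k. \<delta> \<le> p (v k)"
    and x: "\<And>k. x k \<in> span {\<xi>, v k}" and v: "\<And>k. v k \<in> span {\<xi>, x k}"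
  shows "\<exists>r :: nat \<Rightarrow> nat. strict_mono r \<and> iso_polyhedral (closure (span (range (x \<circ> r))))"
proof -
  \<comment> \<open>Starting the selection at \<open>\<xi>\<close> puts the terms
    \<open>x (r k)\<close> into the span of \<open>y\<close>; if \<open>\<xi> = 0\<close>, a nonzero
    vector takes its place.\<close>
  define w where "w = (if \<xi> = 0 then v 0 else \<xi>)"
  have "v 0 \<noteq> 0" using \<delta>(1) \<delta>(2)[of 0] by auto
  then have w: "w \<noteq> 0" "\<xi> \<in> span {w}" by (auto simp: w_def span_base span_zero)
  have pw: "0 < p w" using w by (simp add: pos_iff)
  have null: "(\<lambda>k. e (v k)) \<longlonglongrightarrow> 0" if "e \<in> E" for e
    by (rule tendsto_rabs_zero_cancel[OF summable_LIMSEQ_zero[OF summ[OF that]]])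
  obtain r where r: "strict_mono (r :: nat \<Rightarrow> nat)"
    and mz: "\<And>s b k l. k \<le> l \<Longrightarrow> p (s *\<^sub>R w + (\<Sum>i<k. b i *\<^sub>R v (r i))) \<le> 2 * p (s *\<^sub>R w + (\<Sum>i<l. b i *\<^sub>R v (r i)))"
    using mazur_selection[of v \<delta> w, OF null \<delta>] by blast
  define y where "y k = (case k of 0 \<Rightarrow> w | Suc j \<Rightarrow> v (r j))" for k
  \<comment> \<open>Mazur's constant 2 bounds the first coefficient through \<open>p w\<close>. A
    later one is read off the difference of two partial sums, whence 4.\<close>
  define K where "K = 2 / p w + 4 / \<delta>"
  have K: "0 \<le> K" "2 / p w \<le> K" "4 / \<delta> \<le> K" using pw \<delta>(1) by (auto simp: K_def)
  have dom: "dominates_coefficients y K"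
    unfolding dominates_coefficients_def
  proof (intro allI impI)
    fix \<alpha> :: "nat \<Rightarrow> real" and n k :: nat assume "k < n"
    then obtain l where n: "n = Suc l" by (cases n) auto
    define z where "z = (\<Sum>i<n. \<alpha> i *\<^sub>R y i)"
    define S where "S j = \<alpha> 0 *\<^sub>R w + (\<Sum>i<j. \<alpha> (Suc i) *\<^sub>R v (r i))" for j
    have z: "z = S l" unfolding z_def S_def n sum.lessThan_Suc_shift by (simp add: y_def)
    have S: "p (S j) \<le> 2 * p z" if "j \<le> l" for j unfolding z S_def by (rule mz[OF that])
    show "\<bar>\<alpha> k\<bar> \<le> K * p (\<Sum>i<n. \<alpha> i *\<^sub>R y i)"
    proof (cases k)
      case 0
      have "\<bar>\<alpha> 0\<bar> * p w \<le> 2 * p z" using S[of 0] by (simp add: S_def scaleR)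
      then have "\<bar>\<alpha> 0\<bar> \<le> 2 / p w * p z" using pw by (simp add: field_simps)
      also have "\<dots> \<le> K * p z" by (intro mult_right_mono K) simp
      finally show ?thesis by (simp add: 0 z_def)
    next
      case (Suc j)
      then have j: "Suc j \<le> l" using \<open>k < n\<close> n by simp
      have "\<alpha> k *\<^sub>R v (r j) = S (Suc j) - S j" by (simp add: S_def Suc)
      then have "\<bar>\<alpha> k\<bar> * p (v (r j)) \<le> p (S (Suc j)) + p (S j)"
        using diff_triangle[of "S (Suc j)" "S j"] scaleR[of "\<alpha> k" "v (r j)"] by simp
      also have "\<dots> \<le> 4 * p z" using S[OF j] S[of j] j by simp
      finally have "\<bar>\<alpha> k\<bar> * \<delta> \<le> 4 * p z"
        using mult_left_mono[OF \<delta>(2)[of "r j"], of "\<bar>\<alpha> k\<bar>"] by linarith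
      then have "\<bar>\<alpha> k\<bar> \<le> 4 / \<delta> * p z" using \<delta>(1) by (simp add: field_simps)
      also have "\<dots> \<le> K * p z" by (intro mult_right_mono K) simp
      finally show ?thesis by (simp add: z_def)
    qed
  qed
  have "summable (\<lambda>k. \<bar>e (y k)\<bar>)" if "e \<in> E" for e
  proof -
    have "summable ((\<lambda>k. \<bar>e (v k)\<bar>) \<circ> r)"
      using summ[OF that] r by (intro summable_reindex strict_mono_imp_inj_on) auto
    then have "summable (\<lambda>k. \<bar>e (y (Suc k))\<bar>)" by (simp add: y_def o_def)
    then show ?thesis by (simp only: summable_Suc_iff[of "\<lambda>k. \<bar>e (y k)\<bar>"])
  qed
  moreover have "closure (span (range (x \<circ> r))) \<subseteq> closure (span (range y))"
  proof -
    have w_y: "w \<in> span (range y)" using rangeI[of y 0] by (simp add: y_def span_base)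
    then have \<xi>_y: "\<xi> \<in> span (range y)" using w(2) span_mono[of "{w}" "span (range y)"] by (auto simp: span_span)
    have "v (r k) \<in> span (range y)" for k using rangeI[of y "Suc k"] by (simp add: y_def span_base)
    then have "span {\<xi>, v (r k)} \<subseteq> span (range y)" for k using \<xi>_y by (intro span_minimal) auto
    then have "range (x \<circ> r) \<subseteq> span (range y)" using x by fastforce
    then show ?thesis by (intro closure_mono span_minimal) auto
  qed
  moreover have "infinite_dimensional (closure (span (range (x \<circ> r))))"
    unfolding infinite_dimensional_def
  proof
    assume "\<exists>B. finite B \<and> closure (span (range (x \<circ> r))) \<subseteq> span B"
    then obtain B where B: "finite B" "closure (span (range (x \<circ> r))) \<subseteq> span B" by blast
    define B' where "B' = insert w (insert \<xi> B)"
    have "x (r k) \<in> span B" for k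
    proof -
      have "x (r k) \<in> span (range (x \<circ> r))" by (rule span_base) auto
      then show ?thesis using B(2) closure_subset by blast
    qed
    then have "x (r k) \<in> span B'" for k using span_mono[of B B'] by (auto simp: B'_def)
    moreover have \<xi>B: "\<xi> \<in> span B'" by (auto simp: B'_def intro: span_base)
    ultimately have "span {\<xi>, x (r k)} \<subseteq> span B'" for k by (intro span_minimal) auto
    then have "v (r k) \<in> span B'" for k using v by blast
    moreover have "w \<in> span B'" by (auto simp: B'_def intro: span_base)
    ultimately have "y k \<in> span B'" for k by (cases k) (auto simp: y_def)
    then have "range y \<subseteq> span B'" by blast
    then show False
      using dominates_coefficients_not_finite_dimensional[OF dom, of B'] B(1) by (simp add: B'_def)
  qed
  ultimately have "iso_polyhedral (closure (span (range (x \<circ> r))))"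
    by (intro iso_polyhedral_of_dominated_coefficients[OF dom K(1)])
  then show ?thesis using r by blast
qed

end

section \<open>A limit away from the space, unbounded sequences, and the case distinction\<close>

context precisely_norming_family
begin

text \<open>The limit \<open>\<phi>\<close> is adjoined as an extra vector: \<open>lift e\<close>
  evaluates \<open>g + t \<phi>\<close> at \<open>e\<close>, and the positive distance makes the
  lifted family norming on the product. There \<open>(x n, - 1)\<close> stands for
  \<open>x n - \<phi>\<close>, which is null on the family and bounded below, so Mazur's selection
  applies.\<close>

lemma iso_polyhedral_subsequence_of_distant_limit:
  assumes bdd: "\<And>n. norm (x n) \<le> M" and lim: "\<And>e. e \<in> E \<Longrightarrow> (\<lambda>n. e (x n)) \<longlonglongrightarrow> \<phi> e"
    and summ: "\<And>e. e \<in> E \<Longrightarrow> summable (\<lambda>n. \<bar>e (x (Suc n) - x n)\<bar>)"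
    and d: "0 < d" and dist: "\<And>g. \<exists>e\<in>E. d \<le> \<bar>e g - \<phi> e\<bar>"
  shows "\<exists>r :: nat \<Rightarrow> nat. strict_mono r \<and> iso_polyhedral (closure (span (range (x \<circ> r))))"
proof -
  define lift where "lift e u = e (fst u) + snd u * \<phi> e" for e :: "'a \<Rightarrow> real" and u :: "'a \<times> real"
  have M: "0 \<le> M" using bdd[of 0] norm_ge_zero order_trans by blast
  have CM: "0 \<le> C * M" using M C_pos by simp
  have \<phi>: "\<bar>\<phi> e\<bar> \<le> C * M" if e: "e \<in> E" for e
  proof (rule LIMSEQ_le_const2)
    show "(\<lambda>n. \<bar>e (x n)\<bar>) \<longlonglongrightarrow> \<bar>\<phi> e\<bar>" by (intro tendsto_rabs lim e)
    have "\<bar>e (x n)\<bar> \<le> C * M" for n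
      using E_bound[OF e, of "x n"] mult_left_mono[OF bdd[of n], of C] C_pos by linarith
    then show "\<exists>N. \<forall>n\<ge>N. \<bar>e (x n)\<bar> \<le> C * M" by blast
  qed
  \<comment> \<open>The reciprocal of the constant that bounds \<open>norm u\<close> by the supremum
    \<open>S\<close>: the real component contributes \<open>1 / d\<close>, the other one
    \<open>(1 + C * M / d) / c\<close>.\<close>
  define c' where "c' = 1 / ((1 + C * M / d) / c + 1 / d)"
  have c': "0 < (1 + C * M / d) / c + 1 / d"
    using CM d c_pos by (intro add_nonneg_pos divide_nonneg_pos add_nonneg_nonneg) auto
  have lift_bound: "\<bar>lift e u\<bar> \<le> (C + C * M) * norm u" if e: "e \<in> E" for e u
  proof -
    have "\<bar>lift e u\<bar> \<le> \<bar>e (fst u)\<bar> + \<bar>snd u * \<phi> e\<bar>" unfolding lift_def by (rule abs_triangle_ineq)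
    also have "\<dots> \<le> C * norm (fst u) + \<bar>snd u\<bar> * (C * M)"
      unfolding abs_mult by (intro add_mono E_bound e mult_left_mono \<phi>) auto
    also have "\<dots> \<le> C * norm u + norm u * (C * M)"
      using norm_fst_le[of "fst u" "snd u"] norm_snd_le[of "snd u" "fst u"] C_pos CM by (intro add_mono mult_left_mono mult_right_mono) auto
    finally show ?thesis by (simp add: algebra_simps)
  qed
  \<comment> \<open>The distance \<open>d\<close> is tested at \<open>g\<close> divided by
    \<open>- t\<close>, and the result is rescaled by \<open>t\<close>.\<close>
  have far: "\<exists>e\<in>E. d * \<bar>t\<bar> \<le> \<bar>lift e (g, t)\<bar>" for g t
  proof (cases "t = 0")
    case True
    then show ?thesis using E_nonempty by auto
  next
    case False
    obtain e where e: "e \<in> E" "d \<le> \<bar>e ((- (1 / t)) *\<^sub>R g) - \<phi> e\<bar>" using dist by blast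
    have "lift e (g, t) = (- t) * (e ((- (1 / t)) *\<^sub>R g) - \<phi> e)"
      using False by (simp add: lift_def linear_scale[OF E_linear[OF e(1)]] linear_neg[OF E_linear[OF e(1)]] algebra_simps)
    then have "\<bar>lift e (g, t)\<bar> = \<bar>t\<bar> * \<bar>e ((- (1 / t)) *\<^sub>R g) - \<phi> e\<bar>" by (simp only: abs_mult abs_minus_cancel)
    then show ?thesis using e mult_left_mono[OF e(2), of "\<bar>t\<bar>"] by (intro bexI[of _ e]) (auto simp: mult.commute)
  qed
  interpret W: norming_family "lift ` E" c' "C + C * M"
  proof (rule norming_family.intro)
    fix e' assume "e' \<in> lift ` E"
    then obtain e where e: "e \<in> E" "e' = lift e" by blast
    show "linear e'"
      unfolding e(2) by (rule linearI)
        (simp_all add: lift_def linear_add[OF E_linear[OF e(1)]] linear_scale[OF E_linear[OF e(1)]] algebra_simps)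
    show "\<bar>e' u\<bar> \<le> (C + C * M) * norm u" for u unfolding e(2) by (rule lift_bound[OF e(1)])
  next
    show "lift ` E \<noteq> {}" using E_nonempty by simp
    show "0 < c'" using c' by (simp add: c'_def)
    show "0 < C + C * M" using CM C_pos by linarith
    fix u :: "'a \<times> real"
    obtain g t where u: "u = (g, t)" by force
    define S where "S = (SUP e\<in>lift ` E. \<bar>e u\<bar>)"
    have S: "\<bar>lift e u\<bar> \<le> S" if "e \<in> E" for e
      unfolding S_def
    proof (rule cSUP_upper)
      show "bdd_above ((\<lambda>e. \<bar>e u\<bar>) ` lift ` E)"
        by (rule bdd_aboveI[of _ "(C + C * M) * norm u"]) (use lift_bound[of _ u] in blast)
    qed (use that in simp)
    have t: "\<bar>t\<bar> \<le> S / d"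
    proof -
      obtain e where "e \<in> E" "d * \<bar>t\<bar> \<le> \<bar>lift e (g, t)\<bar>" using far by blast
      then have "d * \<bar>t\<bar> \<le> S" using S[of e] u by simp
      then show ?thesis using d by (simp add: field_simps)
    qed
    obtain e where e: "e \<in> E" "\<bar>e g\<bar> = p g" using attains by blast
    have "c * norm g \<le> \<bar>e g\<bar>" using lower[of g] e(2) by simp
    also have "\<dots> \<le> \<bar>lift e u\<bar> + \<bar>t\<bar> * \<bar>\<phi> e\<bar>" by (simp add: lift_def u flip: abs_mult)
    also have "\<dots> \<le> S + S / d * (C * M)"
      using S[OF e(1)] t \<phi>[OF e(1)] by (intro add_mono mult_mono) auto
    also have "\<dots> = (1 + C * M / d) * S" by (simp add: algebra_simps)
    finally have g: "norm g \<le> (1 + C * M / d) * S / c" using c_pos by (simp add: field_simps)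
    have "norm u \<le> norm g + \<bar>t\<bar>" unfolding u using norm_Pair_le[of g t] by simp
    also have "\<dots> \<le> (1 + C * M / d) * S / c + S / d" using g t by linarith
    also have "\<dots> = ((1 + C * M / d) / c + 1 / d) * S" by (simp add: distrib_right)
    finally have "c' * norm u \<le> c' * (((1 + C * M / d) / c + 1 / d) * S)"
      using c' by (intro mult_left_mono) (auto simp: c'_def)
    also have "\<dots> = S" using c' by (simp add: c'_def)
    finally show "c' * norm u \<le> (SUP e\<in>lift ` E. \<bar>e u\<bar>)" by (simp add: S_def)
  qed
  have W_ge: "d * \<bar>t\<bar> \<le> W.p (g, t)" for g t
  proof -
    obtain e where e: "e \<in> E" "d * \<bar>t\<bar> \<le> \<bar>lift e (g, t)\<bar>" using far by blast
    then show ?thesis using W.E_le_p[of "lift e" "(g, t)"] by auto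
  qed
  have W_le: "W.p (z, 0) \<le> p z" for z
    by (rule W.p_le) (auto simp: lift_def E_le_p)
  define v where "v n = (x n, - 1 :: real)" for n
  have v_null: "(\<lambda>n. e' (v n)) \<longlonglongrightarrow> 0" if "e' \<in> lift ` E" for e'
  proof -
    from that obtain e where e: "e \<in> E" "e' = lift e" by blast
    show ?thesis using LIM_zero[OF lim[OF e(1)]] by (simp add: e(2) v_def lift_def)
  qed
  have v_big: "d \<le> W.p (v n)" for n using W_ge[of "- 1" "x n"] by (simp add: v_def)
  obtain r where r: "strict_mono (r :: nat \<Rightarrow> nat)"
    and mz: "\<And>s b k l. k \<le> l \<Longrightarrow> W.p (s *\<^sub>R (0, 1) + (\<Sum>i<k. b i *\<^sub>R v (r i))) \<le> 2 * W.p (s *\<^sub>R (0, 1) + (\<Sum>i<l. b i *\<^sub>R v (r i)))"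
    using W.mazur_selection[of v d "(0, 1)", OF v_null d v_big] by blast
  \<comment> \<open>In the differences \<open>\<phi>\<close> cancels and block variations bound the
    functionals; the first entry keeps every \<open>x (r k)\<close> in the span.\<close>
  define y where "y k = (case k of 0 \<Rightarrow> x (r 0) | Suc j \<Rightarrow> x (r (Suc j)) - x (r j))" for k
  have dom: "dominates_coefficients y (2 / d)"
    unfolding dominates_coefficients_def
  proof (intro allI impI)
    fix \<alpha> :: "nat \<Rightarrow> real" and n k :: nat assume k: "k < n"
    then obtain m where n: "n = Suc m" by (cases n) auto
    define \<beta> where "\<beta> i = (if i < n then \<alpha> i else 0)" for i
    define b where "b i = \<beta> i - \<beta> (Suc i)" for i
    \<comment> \<open>Summation by parts.\<close>
    have abel: "(\<Sum>i<Suc j. \<beta> i *\<^sub>R y i) = (\<Sum>i<j. b i *\<^sub>R x (r i)) + \<beta> j *\<^sub>R x (r j)" for j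
    proof (induction j)
      case (Suc j)
      have "(\<Sum>i<Suc (Suc j). \<beta> i *\<^sub>R y i) = (\<Sum>i<Suc j. \<beta> i *\<^sub>R y i) + \<beta> (Suc j) *\<^sub>R y (Suc j)" by simp
      also have "\<dots> = (\<Sum>i<j. b i *\<^sub>R x (r i)) + \<beta> j *\<^sub>R x (r j) + \<beta> (Suc j) *\<^sub>R (x (r (Suc j)) - x (r j))"
        unfolding Suc.IH by (simp add: y_def)
      also have "\<dots> = (\<Sum>i<Suc j. b i *\<^sub>R x (r i)) + \<beta> (Suc j) *\<^sub>R x (r (Suc j))"
        by (simp add: b_def scaleR_diff_left scaleR_diff_right)
      finally show ?case .
    qed (simp add: y_def)
    define z where "z = (\<Sum>i<n. \<alpha> i *\<^sub>R y i)"
    have "z = (\<Sum>i<Suc m. \<beta> i *\<^sub>R y i)" unfolding z_def n by (intro sum.cong) (auto simp: \<beta>_def n)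
    also have "\<dots> = (\<Sum>i<n. b i *\<^sub>R x (r i))" unfolding abel by (simp add: n b_def \<beta>_def)
    finally have z: "z = (\<Sum>i<n. b i *\<^sub>R x (r i))" .
    have tele: "(\<Sum>i<j. b i) = \<beta> 0 - \<beta> j" for j unfolding b_def by (rule sum_lessThan_telescope')
    \<comment> \<open>The multiple of \<open>(0, 1)\<close> makes the real component of the partial
      sum equal to \<open>\<beta> j\<close>. At \<open>j = k\<close> this is the coefficient to be
      bounded; at \<open>j = n\<close> it is 0 and the other component is \<open>z\<close>.\<close>
    have pair: "\<beta> 0 *\<^sub>R (0, 1) + (\<Sum>i<j. b i *\<^sub>R v (r i)) = (\<Sum>i<j. b i *\<^sub>R x (r i), \<beta> j)" for j
      using tele[of j] by (intro prod_eqI) (simp_all add: v_def fst_sum snd_sum sum_negf)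
    have "d * \<bar>\<alpha> k\<bar> \<le> W.p (\<Sum>i<k. b i *\<^sub>R x (r i), \<beta> k)" using W_ge[of "\<alpha> k"] k by (simp add: \<beta>_def)
    also have "\<dots> \<le> 2 * W.p (\<Sum>i<n. b i *\<^sub>R x (r i), \<beta> n)"
      using mz[of k n "\<beta> 0" b] k unfolding pair by simp
    also have "\<dots> \<le> 2 * p z" using W_le[of z] by (simp add: z \<beta>_def)
    finally show "\<bar>\<alpha> k\<bar> \<le> 2 / d * p (\<Sum>i<n. \<alpha> i *\<^sub>R y i)" using d by (simp add: z_def field_simps)
  qed
  have "summable (\<lambda>k. \<bar>e (y k)\<bar>)" if e: "e \<in> E" for e
  proof -
    have "summable (\<lambda>k. \<Sum>j=r k..<r (Suc k). \<bar>e (x (Suc j) - x j)\<bar>)"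
      by (intro summable_blocks summ e r) simp
    then have "summable (\<lambda>k. \<bar>e (y (Suc k))\<bar>)"
    proof (rule summable_comparison_test'[of _ 0])
      fix k
      have "r k \<le> r (Suc k)" using r by (simp add: strict_mono_less_eq)
      from abs_functional_diff_le[OF e this, of x]
      show "norm \<bar>e (y (Suc k))\<bar> \<le> (\<Sum>j=r k..<r (Suc k). \<bar>e (x (Suc j) - x j)\<bar>)"
        by (simp add: y_def linear_diff[OF E_linear[OF e]])
    qed
    then show ?thesis by (simp only: summable_Suc_iff[of "\<lambda>k. \<bar>e (y k)\<bar>"])
  qed
  moreover have "closure (span (range (x \<circ> r))) \<subseteq> closure (span (range y))"
  proof -
    have "x (r k) \<in> span (range y)" for k
    proof (induction k)
      case 0
      then show ?case using rangeI[of y 0] by (simp add: y_def span_base)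
    next
      case (Suc k)
      have "x (r (Suc k)) = y (Suc k) + x (r k)" by (simp add: y_def)
      then show ?case using Suc.IH by (simp add: span_add span_base)
    qed
    then show ?thesis by (intro closure_mono span_minimal) auto
  qed
  moreover have "infinite_dimensional (closure (span (range (x \<circ> r))))"
    unfolding infinite_dimensional_def
  proof
    assume "\<exists>B. finite B \<and> closure (span (range (x \<circ> r))) \<subseteq> span B"
    then obtain B where B: "finite B" "closure (span (range (x \<circ> r))) \<subseteq> span B" by blast
    have x_mem: "x (r k) \<in> span (range (x \<circ> r))" for k by (rule span_base) auto
    have "y k \<in> span (range (x \<circ> r))" for k
      by (cases k) (simp_all only: y_def nat.case x_mem span_diff)
    then have "range y \<subseteq> span B" using B(2) closure_subset by blast
    then show False using dominates_coefficients_not_finite_dimensional[OF dom B(1)] by blast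
  qed
  ultimately have "iso_polyhedral (closure (span (range (x \<circ> r))))"
    using d by (intro iso_polyhedral_of_dominated_coefficients[OF dom]) auto
  then show ?thesis using r by blast
qed

text \<open>Terms of norm at least \<open>2 ^ k\<close> are selected. Each functional of
  \<open>E\<close> is bounded along \<open>x\<close>, hence geometrically small on the normalised
  terms.\<close>

lemma iso_polyhedral_subsequence_of_unbounded:
  assumes unb: "\<not> (\<exists>M. \<forall>n. norm (x n) \<le> M)"
    and conv: "\<And>e. e \<in> E \<Longrightarrow> convergent (\<lambda>n. e (x n))"
  shows "\<exists>r :: nat \<Rightarrow> nat. strict_mono r \<and> iso_polyhedral (closure (span (range (x \<circ> r))))"
proof -
  have ex: "\<exists>n. 2 ^ k \<le> norm (x n) \<and> N < n" for k N :: nat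
  proof (rule ccontr)
    assume neg: "\<not> ?thesis"
    have "norm (x n) \<le> 2 ^ k + (\<Sum>i\<le>N. norm (x i))" for n
    proof (cases "n \<le> N")
      case True
      then have "norm (x n) \<le> (\<Sum>i\<le>N. norm (x i))" by (intro member_le_sum) auto
      then show ?thesis by (simp add: add_increasing)
    next
      case False
      then have "norm (x n) \<le> 2 ^ k" using neg by (meson less_imp_le not_le)
      moreover have "0 \<le> (\<Sum>i\<le>N. norm (x i))" by (intro sum_nonneg) auto
      ultimately show ?thesis by linarith
    qed
    then show False using unb by blast
  qed
  have "\<exists>r. \<forall>k. 2 ^ k \<le> norm (x (r k)) \<and> r k < r (Suc k)"
  proof (rule dependent_nat_choice[where P = "\<lambda>k n. 2 ^ k \<le> norm (x n)" and Q = "\<lambda>_ n n'. n < n'"])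
    show "\<exists>n. 2 ^ 0 \<le> norm (x n)" using ex[of 0 0] by blast
    show "\<exists>n'. 2 ^ Suc k \<le> norm (x n') \<and> n < n'" for n k by (rule ex)
  qed
  then obtain r where r: "\<And>k. 2 ^ k \<le> norm (x (r k))" "\<And>k. r k < r (Suc k)" by blast
  have mono: "strict_mono r" using r(2) by (rule strict_monoI_Suc)
  have pos: "0 < norm (x (r k))" for k using r(1)[of k] zero_less_power[of "2::real" k] by linarith
  define v where "v k = (1 / norm (x (r k))) *\<^sub>R x (r k)" for k
  have v_norm: "norm (v k) = 1" for k using pos[of k] by (simp add: v_def)
  have "\<exists>r' :: nat \<Rightarrow> nat. strict_mono r' \<and> iso_polyhedral (closure (span (range ((\<lambda>k. x (r k)) \<circ> r'))))"
  proof (rule iso_polyhedral_subsequence_of_summable[of v c _ 0])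
    show "0 < c" by (rule c_pos)
    show "c \<le> p (v k)" for k using lower[of "v k"] v_norm[of k] by simp
    show "x (r k) \<in> span {0, v k}" for k
    proof -
      have "x (r k) = norm (x (r k)) *\<^sub>R v k" using pos[of k] by (simp add: v_def)
      then show ?thesis by (metis insertI1 insert_commute span_base span_scale)
    qed
    show "v k \<in> span {0, x (r k)}" for k unfolding v_def by (intro span_scale span_base) simp
    fix e assume e: "e \<in> E"
    then have "Bseq (\<lambda>n. e (x n))" using conv convergent_imp_Bseq by blast
    then obtain B where B: "0 < B" "\<And>n. norm (e (x n)) \<le> B" by (auto simp: Bseq_def)
    show "summable (\<lambda>k. \<bar>e (v k)\<bar>)"
    proof (rule summable_comparison_test'[of "\<lambda>k. B * (1/2) ^ k" 0])
      show "summable (\<lambda>k. B * (1/2::real) ^ k)" by (intro summable_mult summable_geometric) simp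
      fix k
      have "\<bar>e (v k)\<bar> = \<bar>e (x (r k))\<bar> / norm (x (r k))"
        using pos[of k] by (simp add: v_def linear_scale[OF E_linear[OF e]] abs_mult)
      also have "\<dots> \<le> B / 2 ^ k" using B r(1)[of k] by (intro frac_le) auto
      finally show "norm \<bar>e (v k)\<bar> \<le> B * (1/2) ^ k" by (simp add: power_divide)
    qed
  qed
  then obtain r' where r': "strict_mono (r' :: nat \<Rightarrow> nat)" "iso_polyhedral (closure (span (range ((\<lambda>k. x (r k)) \<circ> r'))))"
    by blast
  have "(\<lambda>k. x (r k)) \<circ> r' = x \<circ> (r \<circ> r')" by auto
  then show ?thesis using r' strict_mono_o[OF mono r'(1)] by auto
qed

text \<open>Approximations that are uniform on \<open>E\<close> form a Cauchy sequence because
  \<open>E\<close> is norming, and completeness supplies the limit.\<close>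

lemma uniform_limit_of_evaluations:
  assumes approx: "\<And>\<epsilon>. 0 < \<epsilon> \<Longrightarrow> \<exists>g. \<forall>e\<in>E. \<bar>e g - (\<phi> e :: real)\<bar> < \<epsilon>"
  shows "\<exists>\<xi>. \<forall>e\<in>E. \<phi> e = e \<xi>"
proof -
  have "\<exists>g. \<forall>e\<in>E. \<bar>e g - \<phi> e\<bar> < 1 / real (Suc n)" for n by (rule approx) simp
  then obtain g where g: "\<And>n e. e \<in> E \<Longrightarrow> \<bar>e (g n) - \<phi> e\<bar> < 1 / real (Suc n)" by metis
  have "Cauchy g"
  proof (rule CauchyI)
    fix \<epsilon> :: real assume "0 < \<epsilon>"
    then have "0 < c * \<epsilon> / 3" using c_pos by simp
    then obtain N where N: "1 / real (Suc N) < c * \<epsilon> / 3" by (rule nat_approx_posE)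
    have small: "1 / real (Suc n) < c * \<epsilon> / 3" if "N \<le> n" for n
    proof -
      have "1 / real (Suc n) \<le> 1 / real (Suc N)" using that by (simp add: frac_le)
      then show ?thesis using N by linarith
    qed
    have "norm (g m - g n) < \<epsilon>" if "N \<le> m" "N \<le> n" for m n
    proof -
      have "p (g m - g n) \<le> 2 * (c * \<epsilon> / 3)"
      proof (rule p_le)
        fix e assume e: "e \<in> E"
        show "\<bar>e (g m - g n)\<bar> \<le> 2 * (c * \<epsilon> / 3)"
          using g[OF e, of m] g[OF e, of n] small[OF that(1)] small[OF that(2)]
          unfolding linear_diff[OF E_linear[OF e]] by linarith
      qed
      then have "c * norm (g m - g n) \<le> 2 * (c * \<epsilon> / 3)" using lower[of "g m - g n"] by linarith
      then have "c * norm (g m - g n) \<le> c * (2 * \<epsilon> / 3)" by simp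
      then have "norm (g m - g n) \<le> 2 * \<epsilon> / 3" using c_pos by simp
      then show ?thesis using \<open>0 < \<epsilon>\<close> by linarith
    qed
    then show "\<exists>M. \<forall>m\<ge>M. \<forall>n\<ge>M. norm (g m - g n) < \<epsilon>" by blast
  qed
  then obtain \<xi> where \<xi>: "g \<longlonglongrightarrow> \<xi>" using Cauchy_convergent convergent_def by blast
  have "\<phi> e = e \<xi>" if e: "e \<in> E" for e
  proof (rule LIMSEQ_unique)
    show "(\<lambda>n. e (g n)) \<longlonglongrightarrow> e \<xi>" by (rule E_tendsto[OF e \<xi>])
    have "(\<lambda>n. e (g n) - \<phi> e) \<longlonglongrightarrow> 0"
    proof (rule Lim_null_comparison)
      show "\<forall>\<^sub>F n in sequentially. norm (e (g n) - \<phi> e) \<le> 1 / real (Suc n)"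
        using g[OF e] by (intro always_eventually allI) (simp add: less_imp_le)
      show "(\<lambda>n. 1 / real (Suc n)) \<longlonglongrightarrow> 0" by (rule LIMSEQ_Suc[OF lim_1_over_n])
    qed
    then show "(\<lambda>n. e (g n)) \<longlonglongrightarrow> \<phi> e" by (rule LIM_zero_cancel)
  qed
  then show ?thesis by blast
qed

lemma iso_polyhedral_subsequence:
  assumes x: "\<not> convergent x" and summ: "\<And>e. e \<in> E \<Longrightarrow> summable (\<lambda>n. \<bar>e (x (Suc n) - x n)\<bar>)"
  shows "\<exists>r :: nat \<Rightarrow> nat. strict_mono r \<and> iso_polyhedral (closure (span (range (x \<circ> r))))"
proof (cases "\<exists>M. \<forall>n. norm (x n) \<le> M")
  case False
  then show ?thesis
    by (rule iso_polyhedral_subsequence_of_unbounded) (rule convergent_functional[OF _ summ])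
next
  case True
  then obtain M where M: "\<And>n. norm (x n) \<le> M" by blast
  define \<phi> where "\<phi> e = lim (\<lambda>n. e (x n))" for e :: "'a \<Rightarrow> real"
  have lim: "(\<lambda>n. e (x n)) \<longlonglongrightarrow> \<phi> e" if "e \<in> E" for e
    unfolding \<phi>_def using convergent_functional[OF that summ[OF that]] by (simp add: convergent_LIMSEQ_iff)
  \<comment> \<open>Without a positive distance, \<open>\<phi>\<close> is uniformly approximated on
    \<open>E\<close> by evaluations, and so it is an evaluation itself.\<close>
  show ?thesis
  proof (cases "\<exists>d>0. \<forall>g. \<exists>e\<in>E. d \<le> \<bar>e g - \<phi> e\<bar>")
    case True
    then obtain d where d: "0 < d" "\<And>g. \<exists>e\<in>E. d \<le> \<bar>e g - \<phi> e\<bar>" by blast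
    show ?thesis by (rule iso_polyhedral_subsequence_of_distant_limit[OF M lim summ d])
  next
    case False
    then have "\<exists>g. \<forall>e\<in>E. \<bar>e g - \<phi> e\<bar> < \<epsilon>" if "0 < \<epsilon>" for \<epsilon> using that by (meson not_le)
    then have "\<exists>\<xi>. \<forall>e\<in>E. \<phi> e = e \<xi>" by (intro uniform_limit_of_evaluations) auto
    then obtain \<xi> where \<xi>: "\<And>e. e \<in> E \<Longrightarrow> \<phi> e = e \<xi>" by blast
    have "\<not> x \<longlonglongrightarrow> \<xi>" using x by (auto simp: convergent_def)
    then obtain \<delta> where \<delta>: "0 < \<delta>" "\<And>n. \<exists>m\<ge>n. \<delta> \<le> norm (x m - \<xi>)"
      unfolding LIMSEQ_iff by (meson not_le)
    have freq: "\<exists>m\<ge>n. c * \<delta> \<le> p (x m - \<xi>)" for n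
    proof -
      obtain m where m: "n \<le> m" "\<delta> \<le> norm (x m - \<xi>)" using \<delta>(2) by blast
      have "c * \<delta> \<le> c * norm (x m - \<xi>)" using m c_pos by simp
      then show ?thesis using m lower[of "x m - \<xi>"] by (intro exI[of _ m]) linarith
    qed
    have bdd: "norm (x n - \<xi>) \<le> M + norm \<xi>" for n
      using norm_triangle_ineq4[of "x n" \<xi>] M[of n] by linarith
    have lim_\<xi>: "(\<lambda>n. e (x n)) \<longlonglongrightarrow> e \<xi>" if "e \<in> E" for e
      using lim[OF that] \<xi>[OF that] by simp
    have "\<exists>r :: nat \<Rightarrow> nat. strict_mono r \<and> (\<forall>k. c * \<delta> \<le> p (x (r k) - \<xi>)) \<and>
        (\<forall>e\<in>E. summable (\<lambda>k. \<bar>e (x (r k) - \<xi>)\<bar>))"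
      using bdd lim_\<xi> summ freq by (rule summable_subsequence_of_null)
    then obtain r where r: "strict_mono (r :: nat \<Rightarrow> nat)" "\<forall>k. c * \<delta> \<le> p (x (r k) - \<xi>)"
      "\<forall>e\<in>E. summable (\<lambda>k. \<bar>e (x (r k) - \<xi>)\<bar>)" by blast
    have "\<exists>r' :: nat \<Rightarrow> nat. strict_mono r' \<and> iso_polyhedral (closure (span (range ((\<lambda>k. x (r k)) \<circ> r'))))"
    proof (rule iso_polyhedral_subsequence_of_summable[of "\<lambda>k. x (r k) - \<xi>" "c * \<delta>" _ \<xi>])
      show "0 < c * \<delta>" using c_pos \<delta>(1) by simp
      show "x (r k) \<in> span {\<xi>, x (r k) - \<xi>}" for k
      proof -
        have "x (r k) = \<xi> + (x (r k) - \<xi>)" by simp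
        moreover have "\<xi> + (x (r k) - \<xi>) \<in> span {\<xi>, x (r k) - \<xi>}" by (intro span_add span_base) auto
        ultimately show ?thesis by simp
      qed
      show "x (r k) - \<xi> \<in> span {\<xi>, x (r k)}" for k by (intro span_diff span_base) auto
    qed (use r in auto)
    then obtain r' where r': "strict_mono (r' :: nat \<Rightarrow> nat)" "iso_polyhedral (closure (span (range ((\<lambda>k. x (r k)) \<circ> r'))))"
      by blast
    have "(\<lambda>k. x (r k)) \<circ> r' = x \<circ> (r \<circ> r')" by auto
    then show ?thesis using r' strict_mono_o[OF r(1) r'(1)] by auto
  qed
qed

end

lemma iso_precisely_norming_subsequence:
  fixes x :: "nat \<Rightarrow> 'a::banach"
  assumes x: "\<not> convergent x" and E: "iso_precisely_norming E"
    and summ: "\<And>e. e \<in> E \<Longrightarrow> summable (\<lambda>n. \<bar>e (x (Suc n) - x n)\<bar>)"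
  shows "\<exists>r :: nat \<Rightarrow> nat. strict_mono r \<and> iso_polyhedral (closure (span (range (x \<circ> r))))"
proof -
  obtain C where C: "1 \<le> C" "E \<subseteq> dual_ball C" "\<And>x. norm x / C \<le> (SUP e\<in>E. \<bar>e x\<bar>)"
    and att: "\<And>x. \<exists>e0\<in>E. \<bar>e0 x\<bar> = (SUP e\<in>E. \<bar>e x\<bar>)"
    using E unfolding iso_precisely_norming_def by blast
  interpret norming_family E "1 / C" C
  proof (rule norming_family.intro)
    fix e assume "e \<in> E"
    then have e: "bounded_linear e" "onorm e \<le> C" using C(2) by (auto simp: dual_ball_def)
    then show "linear e" by (intro bounded_linear.linear)
    show "\<bar>e u\<bar> \<le> C * norm u" for u
      using onorm[OF e(1), of u] mult_right_mono[OF e(2), of "norm u"] by simp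
  next
    show "E \<noteq> {}" using att by blast
  qed (use C in auto)
  interpret precisely_norming_family E "1 / C" C
    using att by unfold_locales (simp add: p_def)
  show ?thesis by (rule iso_polyhedral_subsequence[OF x summ])
qed

theorem theorem1p4:
  shows "(\<forall>(x :: nat \<Rightarrow> 'a::banach) E.
            \<not> convergent x \<and> iso_precisely_norming E
            \<and> (\<forall>f\<in>E. summable (\<lambda>n. \<bar>f (x (Suc n) - x n)\<bar>))
          \<longrightarrow> (\<exists>r :: nat \<Rightarrow> nat. strict_mono r \<and> iso_polyhedral (closure (span (range (x \<circ> r))))))
       \<and> (separable_space (euclidean :: 'b::banach topology) \<and> iso_polyhedral (UNIV :: 'b set)
          \<longrightarrow> (\<exists>(x :: nat \<Rightarrow> 'b) E.
                 \<not> convergent x \<and> iso_precisely_norming E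
                 \<and> closure (span (range x)) = UNIV
                 \<and> (\<forall>f\<in>E. summable (\<lambda>n. \<bar>f (x (Suc n) - x n)\<bar>))))"
proof (intro conjI allI impI)
  fix x :: "nat \<Rightarrow> 'a" and E
  assume "\<not> convergent x \<and> iso_precisely_norming E
    \<and> (\<forall>f\<in>E. summable (\<lambda>n. \<bar>f (x (Suc n) - x n)\<bar>))"
  then show "\<exists>r :: nat \<Rightarrow> nat. strict_mono r \<and> iso_polyhedral (closure (span (range (x \<circ> r))))"
    by (intro iso_precisely_norming_subsequence) auto
next
  assume "separable_space (euclidean :: 'b topology) \<and> iso_polyhedral (UNIV :: 'b set)"
  then have sep: "separable_space (euclidean :: 'b topology)" and iso: "iso_polyhedral (UNIV :: 'b set)"
    by auto
  show "\<exists>(x :: nat \<Rightarrow> 'b) E. \<not> convergent x \<and> iso_precisely_norming E \<and> closure (span (range x)) = UNIV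
    \<and> (\<forall>f\<in>E. summable (\<lambda>n. \<bar>f (x (Suc n) - x n)\<bar>))"
  proof (rule separable_polyhedral_sequence[OF sep iso])
    fix x :: "nat \<Rightarrow> 'b" and E
    assume "\<not> convergent x" "iso_precisely_norming E" "closure (span (range x)) = UNIV"
      "\<And>f. f \<in> E \<Longrightarrow> summable (\<lambda>n. \<bar>f (x (Suc n) - x n)\<bar>)"
    then show ?thesis by (intro exI[of _ x] exI[of _ E] conjI ballI)
  qed
qed

end
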